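(* Let $\Lambda_i=(V_i,E_i)$, $i=1,2$, be hypergraphs. If $\mathcal O(\Lambda_1,\Lambda_2)\neq0$, then $\mathcal O(\Lambda_1,\Lambda_2)$ is an $\mathcal O(\Lambda_1)$--$\mathcal O(\Lambda_2)$ bi-Galois extension via the left coaction $$\delta(p_{v_1,v_2})=\sum_{w_1\in V_1}u_{v_1,w_1}\otimes p_{w_1,v_2},\qquad \delta(p_{e_1,e_2})=\sum_{d_1\in E_1}u_{e_1,d_1}\otimes p_{d_1,e_2},$$ and the right coaction $$\gamma(p_{v_1,v_2})=\sum_{w_2\in V_2}p_{v_1,w_2}\otimes v_{w_2,v_2},\qquad \gamma(p_{e_1,e_2})=\sum_{f_2\in E_2}p_{e_1,f_2}\otimes v_{f_2,e_2}.$$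
   Context: Algebras are over $\mathbb C$; $\otimes$ between $*$-algebras is the algebraic tensor product. A hypergraph $\Lambda=(V,E)$ consists of a finite set $V$ of vertices and a finite non-empty family $E$ of hyperedges, each identified with a subset of $V$ (repeated hyperedges allowed); all hypergraphs are assumed full (every vertex lies in some hyperedge). Its incidence matrix $A_\Lambda$ is the $V\times E$ matrix with entry $1$ at $(v,e)$ if $v\in e$ and $0$ otherwise. A magic unitary over a unital $*$-algebra is a matrix $(p_{i,j})$ with $p_{i,j}=p_{i,j}^*=p_{i,j}^2$, all rows and columns summing to $1$, $p_{i,j}p_{i,j'}=0$ for $j\ne j'$, $p_{i,j}p_{i',j}=0$ for $i\ne i'$. $\mathcal O(\Lambda_1,\Lambda_2)$ (the game $*$-algebra of the hypergraph isomorphism game) is the universal unital $*$-algebra generated by the entries of magic unitaries $P_V=(p_{v_1,v_2})_{v_1\in V_1,v_2\in V_2}$ and $P_E=(p_{e_1,e_2})_{e_1\in E_1,e_2\in E_2}$ with $A_{\Lambda_1}P_E=P_VA_{\Lambda_2}$. $\mathcal O(\Lambda):=\mathcal O(\Lambda,\Lambda)$ is the Hopf $*$-algebra of the quantum automorphism group of $\Lambda$: with generating magic unitaries $(u_{v,w})_{v,w\in V}$, $(u_{e,f})_{e,f\in E}$, its structure maps are $\Delta(u_{ij})=\sum_ku_{ik}\otimes u_{kj}$, $\varepsilon(u_{ij})=\delta_{ij}$, $S(u_{ij})=u_{ji}$ (sums within the vertex, resp. edge, block). The generators of $\mathcal O(\Lambda_1)$ are denoted $u$, those of $\mathcal O(\Lambda_2)$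 are denoted $v$ (i.e. $v_{w_2,v_2}$, $v_{f_2,e_2}$). Let $\mathcal A,\mathcal B$ be Hopf $*$-algebras. A unital $*$-algebra $\mathcal Z$ is a left $\mathcal A$-$*$-comodule algebra if it carries a unital $*$-homomorphism $\delta:\mathcal Z\to\mathcal A\otimes\mathcal Z$ with $(\mathrm{id}\otimes\delta)\delta=(\Delta\otimes\mathrm{id})\delta$ and $(\varepsilon\otimes\mathrm{id})\delta=\mathrm{id}$; a right $\mathcal B$-$*$-comodule algebra if it carries a unital $*$-homomorphism $\gamma:\mathcal Z\to\mathcal Z\otimes\mathcal B$ with $(\gamma\otimes\mathrm{id})\gamma=(\mathrm{id}\otimes\Delta)\gamma$ and $(\mathrm{id}\otimes\varepsilon)\gamma=\mathrm{id}$. $\mathcal Z$ is an $\mathcal A$--$\mathcal B$ bi-Galois extension (via $\delta,\gamma$) if both hold, $(\delta\otimes\mathrm{id})\gamma=(\mathrm{id}\otimes\gamma)\delta$, and the maps $\kappa_\delta:\mathcal Z\otimes\mathcal Z\to\mathcal A\otimes\mathcal Z$, $z\otimes z'\mapsto\delta(z)(1\otimes z')$ and $\kappa_\gamma:\mathcal Z\otimes\mathcal Z\to\mathcal Z\otimes\mathcal B$, $z\otimes z'\mapsto(z\otimes1)\gamma(z')$ are bijections. *)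

theory Defs
  imports Complex_Main "HOL-Algebra.Module" "HOL-Algebra.QuotRing" "HOL-Library.Poly_Mapping"
begin

section \<open>Unital $*$-algebras over the complex numbers\<close>

record 'a star_alg = "(complex, 'a) module" +
  adj :: "'a \<Rightarrow> 'a"

text \<open>The complex numbers, both as scalar ring and as $*$-algebra.\<close>

definition cplx :: "complex star_alg" where
  "cplx = \<lparr>carrier = UNIV, mult = (*), one = 1, zero = 0, add = (+), smult = (*), adj = cnj\<rparr>"

text \<open>The zero algebra is allowed: \<^locale>\<open>ring\<close> does not require that one differs from zero.\<close>

locale star_algebra = ring A + module cplx A for A (structure) +
  assumes smult_mult_l:
      "\<lbrakk>x \<in> carrier A; y \<in> carrier A\<rbrakk> \<Longrightarrow> (c \<odot> x) \<otimes> y = c \<odot> (x \<otimes> y)"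
    and smult_mult_r:
      "\<lbrakk>x \<in> carrier A; y \<in> carrier A\<rbrakk> \<Longrightarrow> x \<otimes> (c \<odot> y) = c \<odot> (x \<otimes> y)"
    and adj_closed: "x \<in> carrier A \<Longrightarrow> adj A x \<in> carrier A"
    and adj_adj: "x \<in> carrier A \<Longrightarrow> adj A (adj A x) = x"
    and adj_add:
      "\<lbrakk>x \<in> carrier A; y \<in> carrier A\<rbrakk> \<Longrightarrow> adj A (x \<oplus> y) = adj A x \<oplus> adj A y"
    and adj_smult: "x \<in> carrier A \<Longrightarrow> adj A (c \<odot> x) = cnj c \<odot> adj A x"
    and adj_mult:
      "\<lbrakk>x \<in> carrier A; y \<in> carrier A\<rbrakk> \<Longrightarrow> adj A (x \<otimes> y) = adj A y \<otimes> adj A x"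

definition linear_on ::
    "('a, 'm) star_alg_scheme \<Rightarrow> ('b, 'n) star_alg_scheme \<Rightarrow> ('a \<Rightarrow> 'b) \<Rightarrow> bool" where
  "linear_on A B h \<longleftrightarrow> h \<in> carrier A \<rightarrow> carrier B \<and>
     (\<forall>x\<in>carrier A. \<forall>y\<in>carrier A. h (x \<oplus>\<^bsub>A\<^esub> y) = h x \<oplus>\<^bsub>B\<^esub> h y) \<and>
     (\<forall>c. \<forall>x\<in>carrier A. h (c \<odot>\<^bsub>A\<^esub> x) = c \<odot>\<^bsub>B\<^esub> h x)"

definition unital_star_hom ::
    "('a, 'm) star_alg_scheme \<Rightarrow> ('b, 'n) star_alg_scheme \<Rightarrow> ('a \<Rightarrow> 'b) \<Rightarrow> bool" where
  "unital_star_hom A B h \<longleftrightarrow> linear_on A B h \<and> h \<in> ring_hom A B \<and>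
     (\<forall>x\<in>carrier A. h (adj A x) = adj B (h x))"

definition opposite_alg :: "('a, 'm) star_alg_scheme \<Rightarrow> ('a, 'm) star_alg_scheme" where
  "opposite_alg A = A\<lparr>mult := (\<lambda>x y. y \<otimes>\<^bsub>A\<^esub> x)\<rparr>"


section \<open>Monoid algebras and quotients\<close>

text \<open>The complex algebra of a monoid $M$: finite formal linear combinations of elements
  of $M$, with the involution extending an involution \<open>st\<close> of $M$ antilinearly.\<close>

definition monoid_star_alg ::
    "('m, 'z) monoid_scheme \<Rightarrow> ('m \<Rightarrow> 'm) \<Rightarrow> ('m \<Rightarrow>\<^sub>0 complex) star_alg" where
  "monoid_star_alg M st =
     \<lparr>carrier = {f. Poly_Mapping.keys f \<subseteq> carrier M},
      mult = (\<lambda>f g. \<Sum>x\<in>Poly_Mapping.keys f. \<Sum>y\<in>Poly_Mapping.keys g.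
        Poly_Mapping.single (x \<otimes>\<^bsub>M\<^esub> y) (Poly_Mapping.lookup f x * Poly_Mapping.lookup g y)),
      one = Poly_Mapping.single \<one>\<^bsub>M\<^esub> 1,
      zero = 0,
      add = (+),
      smult = (\<lambda>c. Poly_Mapping.map ((*) c)),
      adj = (\<lambda>f. \<Sum>x\<in>Poly_Mapping.keys f.
        Poly_Mapping.single (st x) (cnj (Poly_Mapping.lookup f x)))\<rparr>"

definition quot_star_alg ::
    "('a, 'm) star_alg_scheme \<Rightarrow> 'a set \<Rightarrow> 'a set star_alg" where
  "quot_star_alg A I =
     \<lparr>carrier = carrier (A Quot I), mult = mult (A Quot I), one = one (A Quot I),
      zero = zero (A Quot I), add = add (A Quot I),
      smult = (\<lambda>c X. \<Union>x\<in>X. I +>\<^bsub>A\<^esub> (c \<odot>\<^bsub>A\<^esub> x)),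
      adj = (\<lambda>X. adj A ` X)\<rparr>"

definition gen_star_ideal :: "('a, 'm) star_alg_scheme \<Rightarrow> 'a set \<Rightarrow> 'a set" where
  "gen_star_ideal A R = \<Inter>{I. ideal I A \<and> adj A ` I \<subseteq> I \<and> R \<subseteq> I}"

definition lin_span :: "('a, 'm) star_alg_scheme \<Rightarrow> 'a set \<Rightarrow> 'a set" where
  "lin_span A R = \<Inter>{N. submodule N cplx A \<and> R \<subseteq> N}"

text \<open>The linear extension of \<open>h\<close>, and the map it induces on cosets of formal linear
  combinations.  The latter is meaningful when the linear extension is constant on each
  coset, so that \<open>lin_ext B h ` X\<close> is a singleton; compare \<open>the_elem (h ` X)\<close> in the first
  isomorphism theorem of \<^theory>\<open>HOL-Algebra.QuotRing\<close>.\<close>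

definition lin_ext ::
    "('b, 'n) star_alg_scheme \<Rightarrow> ('m \<Rightarrow> 'b) \<Rightarrow> ('m \<Rightarrow>\<^sub>0 complex) \<Rightarrow> 'b" where
  "lin_ext B h f = (\<Oplus>\<^bsub>B\<^esub>x\<in>Poly_Mapping.keys f. Poly_Mapping.lookup f x \<odot>\<^bsub>B\<^esub> h x)"

definition induced ::
    "('b, 'n) star_alg_scheme \<Rightarrow> ('m \<Rightarrow> 'b) \<Rightarrow> ('m \<Rightarrow>\<^sub>0 complex) set \<Rightarrow> 'b" where
  "induced B h X = the_elem (lin_ext B h ` X)"


section \<open>Algebraic tensor products\<close>

text \<open>The tensor product is the space of formal linear combinations of pairs modulo the
  span of the bilinearity relations, with $(a \otimes b)(a' \otimes b') = aa' \otimes bb'$ and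
  $(a \otimes b)^* = a^* \otimes b^*$.\<close>

definition pair_alg ::
    "('a, 'm) star_alg_scheme \<Rightarrow> ('b, 'n) star_alg_scheme \<Rightarrow> ('a \<times> 'b \<Rightarrow>\<^sub>0 complex) star_alg" where
  "pair_alg A B = monoid_star_alg (A \<times>\<times> B) (map_prod (adj A) (adj B))"

definition bilinear_relators ::
    "('a, 'm) star_alg_scheme \<Rightarrow> ('b, 'n) star_alg_scheme \<Rightarrow> ('a \<times> 'b \<Rightarrow>\<^sub>0 complex) set" where
  "bilinear_relators A B = (let e = Poly_Mapping.single in
     {e (a \<oplus>\<^bsub>A\<^esub> a', b) 1 - e (a, b) 1 - e (a', b) 1 | a a' b.
        a \<in> carrier A \<and> a' \<in> carrier A \<and> b \<in> carrier B} \<union>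
     {e (a, b \<oplus>\<^bsub>B\<^esub> b') 1 - e (a, b) 1 - e (a, b') 1 | a b b'.
        a \<in> carrier A \<and> b \<in> carrier B \<and> b' \<in> carrier B} \<union>
     {e (c \<odot>\<^bsub>A\<^esub> a, b) 1 - e (a, b) c | c a b. a \<in> carrier A \<and> b \<in> carrier B} \<union>
     {e (a, c \<odot>\<^bsub>B\<^esub> b) 1 - e (a, b) c | c a b. a \<in> carrier A \<and> b \<in> carrier B})"

definition tensor_null ::
    "('a, 'm) star_alg_scheme \<Rightarrow> ('b, 'n) star_alg_scheme \<Rightarrow> ('a \<times> 'b \<Rightarrow>\<^sub>0 complex) set" where
  "tensor_null A B = lin_span (pair_alg A B) (bilinear_relators A B)"

definition tensor_alg ::
    "('a, 'm) star_alg_scheme \<Rightarrow> ('b, 'n) star_alg_scheme \<Rightarrow> ('a \<times> 'b \<Rightarrow>\<^sub>0 complex) set star_alg" where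
  "tensor_alg A B = quot_star_alg (pair_alg A B) (tensor_null A B)"

definition tens ::
    "('a, 'm) star_alg_scheme \<Rightarrow> ('b, 'n) star_alg_scheme \<Rightarrow> 'a \<Rightarrow> 'b \<Rightarrow> ('a \<times> 'b \<Rightarrow>\<^sub>0 complex) set" where
  "tens A B a b = tensor_null A B +>\<^bsub>pair_alg A B\<^esub> Poly_Mapping.single (a, b) 1"

text \<open>The map $f \otimes g$ into $C \otimes D$, for linear $f$ and $g$.\<close>

definition tensor_map ::
    "('c, 'm) star_alg_scheme \<Rightarrow> ('d, 'n) star_alg_scheme \<Rightarrow> ('a \<Rightarrow> 'c) \<Rightarrow> ('b \<Rightarrow> 'd) \<Rightarrow>
     ('a \<times> 'b \<Rightarrow>\<^sub>0 complex) set \<Rightarrow> ('c \<times> 'd \<Rightarrow>\<^sub>0 complex) set" where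
  "tensor_map C D f g = induced (tensor_alg C D) (\<lambda>(a, b). tens C D (f a) (g b))"

text \<open>The canonical identification $(A \otimes B) \otimes C \to A \otimes (B \otimes C)$.\<close>

definition tensor_assoc ::
    "('a, 'm) star_alg_scheme \<Rightarrow> ('b, 'n) star_alg_scheme \<Rightarrow> ('c, 'k) star_alg_scheme \<Rightarrow>
     (('a \<times> 'b \<Rightarrow>\<^sub>0 complex) set \<times> 'c \<Rightarrow>\<^sub>0 complex) set \<Rightarrow>
     ('a \<times> ('b \<times> 'c \<Rightarrow>\<^sub>0 complex) set \<Rightarrow>\<^sub>0 complex) set" where
  "tensor_assoc A B C = (let T = tensor_alg A (tensor_alg B C) in
     induced T (\<lambda>(t, c).
       induced T (\<lambda>(a, b). tens A (tensor_alg B C) a (tens B C b c)) t))"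


section \<open>Hopf $*$-algebras and bi-Galois extensions\<close>

record 'a hopf_star_alg = "'a star_alg" +
  comult :: "'a \<Rightarrow> ('a \<times> 'a \<Rightarrow>\<^sub>0 complex) set"
  counit :: "'a \<Rightarrow> complex"
  antipode :: "'a \<Rightarrow> 'a"

text \<open>In the counit laws below (also for comodule algebras), $\mathbb C \otimes A$ and
  $A \otimes \mathbb C$ are identified with $A$ via $c \otimes a \mapsto ca$ and
  $a \otimes c \mapsto ca$.\<close>

locale hopf_star_algebra = star_algebra H for H (structure) +
  assumes comult_hom: "unital_star_hom H (tensor_alg H H) (comult H)"
    and coassoc: "x \<in> carrier H \<Longrightarrow>
      tensor_assoc H H H (tensor_map (tensor_alg H H) H (comult H) id (comult H x)) =
      tensor_map H (tensor_alg H H) id (comult H) (comult H x)"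
    and counit_hom: "unital_star_hom H cplx (counit H)"
    and counit_l: "x \<in> carrier H \<Longrightarrow> induced H (\<lambda>(a, b). counit H a \<odot> b) (comult H x) = x"
    and counit_r: "x \<in> carrier H \<Longrightarrow> induced H (\<lambda>(a, b). counit H b \<odot> a) (comult H x) = x"
    and antipode_linear: "linear_on H H (antipode H)"
    and antipode_l: "x \<in> carrier H \<Longrightarrow>
      induced H (\<lambda>(a, b). antipode H a \<otimes> b) (comult H x) = counit H x \<odot> \<one>"
    and antipode_r: "x \<in> carrier H \<Longrightarrow>
      induced H (\<lambda>(a, b). a \<otimes> antipode H b) (comult H x) = counit H x \<odot> \<one>"

definition left_comodule_algebra ::
    "('a, 'm) hopf_star_alg_scheme \<Rightarrow> ('z, 'k) star_alg_scheme \<Rightarrow>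
     ('z \<Rightarrow> ('a \<times> 'z \<Rightarrow>\<^sub>0 complex) set) \<Rightarrow> bool" where
  "left_comodule_algebra A Z \<delta> \<longleftrightarrow>
     hopf_star_algebra A \<and> star_algebra Z \<and> unital_star_hom Z (tensor_alg A Z) \<delta> \<and>
     (\<forall>z\<in>carrier Z.
        tensor_map A (tensor_alg A Z) id \<delta> (\<delta> z) =
          tensor_assoc A A Z (tensor_map (tensor_alg A A) Z (comult A) id (\<delta> z)) \<and>
        induced Z (\<lambda>(a, y). counit A a \<odot>\<^bsub>Z\<^esub> y) (\<delta> z) = z)"

definition right_comodule_algebra ::
    "('b, 'm) hopf_star_alg_scheme \<Rightarrow> ('z, 'k) star_alg_scheme \<Rightarrow>
     ('z \<Rightarrow> ('z \<times> 'b \<Rightarrow>\<^sub>0 complex) set) \<Rightarrow> bool" where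
  "right_comodule_algebra B Z \<gamma> \<longleftrightarrow>
     hopf_star_algebra B \<and> star_algebra Z \<and> unital_star_hom Z (tensor_alg Z B) \<gamma> \<and>
     (\<forall>z\<in>carrier Z.
        tensor_assoc Z B B (tensor_map (tensor_alg Z B) B \<gamma> id (\<gamma> z)) =
          tensor_map Z (tensor_alg B B) id (comult B) (\<gamma> z) \<and>
        induced Z (\<lambda>(y, b). counit B b \<odot>\<^bsub>Z\<^esub> y) (\<gamma> z) = z)"

definition galois_map_left ::
    "('a, 'm) star_alg_scheme \<Rightarrow> ('z, 'k) star_alg_scheme \<Rightarrow>
     ('z \<Rightarrow> ('a \<times> 'z \<Rightarrow>\<^sub>0 complex) set) \<Rightarrow>
     ('z \<times> 'z \<Rightarrow>\<^sub>0 complex) set \<Rightarrow> ('a \<times> 'z \<Rightarrow>\<^sub>0 complex) set" where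
  "galois_map_left A Z \<delta> = induced (tensor_alg A Z)
     (\<lambda>(z, z'). \<delta> z \<otimes>\<^bsub>tensor_alg A Z\<^esub> tens A Z \<one>\<^bsub>A\<^esub> z')"

definition galois_map_right ::
    "('b, 'm) star_alg_scheme \<Rightarrow> ('z, 'k) star_alg_scheme \<Rightarrow>
     ('z \<Rightarrow> ('z \<times> 'b \<Rightarrow>\<^sub>0 complex) set) \<Rightarrow>
     ('z \<times> 'z \<Rightarrow>\<^sub>0 complex) set \<Rightarrow> ('z \<times> 'b \<Rightarrow>\<^sub>0 complex) set" where
  "galois_map_right B Z \<gamma> = induced (tensor_alg Z B)
     (\<lambda>(z, z'). tens Z B z \<one>\<^bsub>B\<^esub> \<otimes>\<^bsub>tensor_alg Z B\<^esub> \<gamma> z')"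

definition bi_galois ::
    "('a, 'm) hopf_star_alg_scheme \<Rightarrow> ('b, 'n) hopf_star_alg_scheme \<Rightarrow> ('z, 'k) star_alg_scheme \<Rightarrow>
     ('z \<Rightarrow> ('a \<times> 'z \<Rightarrow>\<^sub>0 complex) set) \<Rightarrow> ('z \<Rightarrow> ('z \<times> 'b \<Rightarrow>\<^sub>0 complex) set) \<Rightarrow> bool" where
  "bi_galois A B Z \<delta> \<gamma> \<longleftrightarrow>
     left_comodule_algebra A Z \<delta> \<and> right_comodule_algebra B Z \<gamma> \<and>
     (\<forall>z\<in>carrier Z.
        tensor_assoc A Z B (tensor_map (tensor_alg A Z) B \<delta> id (\<gamma> z)) =
        tensor_map A (tensor_alg Z B) id \<gamma> (\<delta> z)) \<and>
     bij_betw (galois_map_left A Z \<delta>) (carrier (tensor_alg Z Z)) (carrier (tensor_alg A Z)) \<and>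
     bij_betw (galois_map_right B Z \<gamma>) (carrier (tensor_alg Z Z)) (carrier (tensor_alg Z B))"


section \<open>Hypergraphs\<close>

text \<open>A family of hyperedges is given by a set of labels together with the vertex set
  \<open>ends \<Lambda> e\<close> of each label \<open>e\<close>, so that hyperedges may be repeated.\<close>

record ('v, 'e) hypergraph =
  verts :: "'v set"
  edges :: "'e set"
  ends :: "'e \<Rightarrow> 'v set"

definition full_hypergraph :: "('v, 'e) hypergraph \<Rightarrow> bool" where
  "full_hypergraph \<Lambda> \<longleftrightarrow> finite (verts \<Lambda>) \<and> finite (edges \<Lambda>) \<and> edges \<Lambda> \<noteq> {} \<and>
     (\<forall>e\<in>edges \<Lambda>. ends \<Lambda> e \<subseteq> verts \<Lambda>) \<and> (\<forall>v\<in>verts \<Lambda>. \<exists>e\<in>edges \<Lambda>. v \<in> ends \<Lambda> e)"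

definition incidence :: "('v, 'e) hypergraph \<Rightarrow> 'v \<Rightarrow> 'e \<Rightarrow> complex" where
  "incidence \<Lambda> v e = (if v \<in> ends \<Lambda> e then 1 else 0)"


section \<open>The game algebra\<close>

text \<open>Free unital $*$-algebra on \<open>X\<close>: noncommutative polynomials in the letters
  \<open>(x, False)\<close>, standing for $x$, and \<open>(x, True)\<close>, standing for $x^*$.\<close>

definition free_star_alg :: "'x set \<Rightarrow> (('x \<times> bool) list \<Rightarrow>\<^sub>0 complex) star_alg" where
  "free_star_alg X = monoid_star_alg
     \<lparr>carrier = lists (X \<times> UNIV), mult = (@), one = []\<rparr> (\<lambda>w. rev (map (apsnd Not) w))"

definition free_gen :: "'x \<Rightarrow> (('x \<times> bool) list \<Rightarrow>\<^sub>0 complex)" where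
  "free_gen x = Poly_Mapping.single [(x, False)] 1"

text \<open>The elements that have to vanish for $(p_{i,j})_{i \in I, j \in J}$ to be a magic unitary.\<close>

definition magic_relators ::
    "('a, 'm) star_alg_scheme \<Rightarrow> 'i set \<Rightarrow> 'j set \<Rightarrow> ('i \<Rightarrow> 'j \<Rightarrow> 'a) \<Rightarrow> 'a set" where
  "magic_relators A I J p =
     {p i j \<ominus>\<^bsub>A\<^esub> adj A (p i j) | i j. i \<in> I \<and> j \<in> J} \<union>
     {p i j \<ominus>\<^bsub>A\<^esub> p i j \<otimes>\<^bsub>A\<^esub> p i j | i j. i \<in> I \<and> j \<in> J} \<union>
     {(\<Oplus>\<^bsub>A\<^esub>j\<in>J. p i j) \<ominus>\<^bsub>A\<^esub> \<one>\<^bsub>A\<^esub> | i. i \<in> I} \<union>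
     {(\<Oplus>\<^bsub>A\<^esub>i\<in>I. p i j) \<ominus>\<^bsub>A\<^esub> \<one>\<^bsub>A\<^esub> | j. j \<in> J} \<union>
     {p i j \<otimes>\<^bsub>A\<^esub> p i j' | i j j'. i \<in> I \<and> j \<in> J \<and> j' \<in> J \<and> j \<noteq> j'} \<union>
     {p i j \<otimes>\<^bsub>A\<^esub> p i' j | i i' j. i \<in> I \<and> i' \<in> I \<and> j \<in> J \<and> i \<noteq> i'}"

datatype ('v1, 'e1, 'v2, 'e2) game_gen = Vtx 'v1 'v2 | Edg 'e1 'e2

type_synonym ('v1, 'e1, 'v2, 'e2) game_poly =
  "(('v1, 'e1, 'v2, 'e2) game_gen \<times> bool) list \<Rightarrow>\<^sub>0 complex"

definition free_game_alg ::
    "('v1, 'e1) hypergraph \<Rightarrow> ('v2, 'e2) hypergraph \<Rightarrow> ('v1, 'e1, 'v2, 'e2) game_poly star_alg" where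
  "free_game_alg \<Lambda>1 \<Lambda>2 = free_star_alg
     ({Vtx v1 v2 | v1 v2. v1 \<in> verts \<Lambda>1 \<and> v2 \<in> verts \<Lambda>2} \<union>
      {Edg e1 e2 | e1 e2. e1 \<in> edges \<Lambda>1 \<and> e2 \<in> edges \<Lambda>2})"

definition game_relators ::
    "('v1, 'e1) hypergraph \<Rightarrow> ('v2, 'e2) hypergraph \<Rightarrow> ('v1, 'e1, 'v2, 'e2) game_poly set" where
  "game_relators \<Lambda>1 \<Lambda>2 = (let F = free_game_alg \<Lambda>1 \<Lambda>2;
       pV = (\<lambda>v1 v2. free_gen (Vtx v1 v2)); pE = (\<lambda>e1 e2. free_gen (Edg e1 e2)) in
     magic_relators F (verts \<Lambda>1) (verts \<Lambda>2) pV \<union>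
     magic_relators F (edges \<Lambda>1) (edges \<Lambda>2) pE \<union>
     {(\<Oplus>\<^bsub>F\<^esub>e1\<in>edges \<Lambda>1. incidence \<Lambda>1 v1 e1 \<odot>\<^bsub>F\<^esub> pE e1 e2) \<ominus>\<^bsub>F\<^esub>
      (\<Oplus>\<^bsub>F\<^esub>v2\<in>verts \<Lambda>2. incidence \<Lambda>2 v2 e2 \<odot>\<^bsub>F\<^esub> pV v1 v2) | v1 e2.
        v1 \<in> verts \<Lambda>1 \<and> e2 \<in> edges \<Lambda>2})"

definition game_ideal ::
    "('v1, 'e1) hypergraph \<Rightarrow> ('v2, 'e2) hypergraph \<Rightarrow> ('v1, 'e1, 'v2, 'e2) game_poly set" where
  "game_ideal \<Lambda>1 \<Lambda>2 = gen_star_ideal (free_game_alg \<Lambda>1 \<Lambda>2) (game_relators \<Lambda>1 \<Lambda>2)"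

definition game_alg ::
    "('v1, 'e1) hypergraph \<Rightarrow> ('v2, 'e2) hypergraph \<Rightarrow>
     ('v1, 'e1, 'v2, 'e2) game_poly set star_alg" where
  "game_alg \<Lambda>1 \<Lambda>2 = quot_star_alg (free_game_alg \<Lambda>1 \<Lambda>2) (game_ideal \<Lambda>1 \<Lambda>2)"

definition gen_vtx ::
    "('v1, 'e1) hypergraph \<Rightarrow> ('v2, 'e2) hypergraph \<Rightarrow> 'v1 \<Rightarrow> 'v2 \<Rightarrow>
     ('v1, 'e1, 'v2, 'e2) game_poly set" where
  "gen_vtx \<Lambda>1 \<Lambda>2 v1 v2 = game_ideal \<Lambda>1 \<Lambda>2 +>\<^bsub>free_game_alg \<Lambda>1 \<Lambda>2\<^esub> free_gen (Vtx v1 v2)"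

definition gen_edg ::
    "('v1, 'e1) hypergraph \<Rightarrow> ('v2, 'e2) hypergraph \<Rightarrow> 'e1 \<Rightarrow> 'e2 \<Rightarrow>
     ('v1, 'e1, 'v2, 'e2) game_poly set" where
  "gen_edg \<Lambda>1 \<Lambda>2 e1 e2 = game_ideal \<Lambda>1 \<Lambda>2 +>\<^bsub>free_game_alg \<Lambda>1 \<Lambda>2\<^esub> free_gen (Edg e1 e2)"

text \<open>The unital $*$-homomorphism from the game algebra into \<open>B\<close> that sends the vertex
  generators to \<open>a\<close> and the edge generators to \<open>b\<close>, when these satisfy the defining
  relations.\<close>

definition game_hom ::
    "('b, 'n) star_alg_scheme \<Rightarrow> ('v1 \<Rightarrow> 'v2 \<Rightarrow> 'b) \<Rightarrow> ('e1 \<Rightarrow> 'e2 \<Rightarrow> 'b) \<Rightarrow>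
     ('v1, 'e1, 'v2, 'e2) game_poly set \<Rightarrow> 'b" where
  "game_hom B a b = induced B (\<lambda>w. foldr
     (\<lambda>(x, s) y. (let z = case_game_gen a b x in if s then adj B z else z) \<otimes>\<^bsub>B\<^esub> y) w \<one>\<^bsub>B\<^esub>)"

text \<open>The antipode is antimultiplicative, hence a homomorphism into the opposite algebra.\<close>

definition qaut :: "('v, 'e) hypergraph \<Rightarrow> ('v, 'e, 'v, 'e) game_poly set hopf_star_alg" where
  "qaut \<Lambda> = (let A = game_alg \<Lambda> \<Lambda>; u = gen_vtx \<Lambda> \<Lambda>; u' = gen_edg \<Lambda> \<Lambda> in
     star_alg.extend A
       \<lparr>comult = game_hom (tensor_alg A A)
          (\<lambda>v w. \<Oplus>\<^bsub>tensor_alg A A\<^esub>k\<in>verts \<Lambda>. tens A A (u v k) (u k w))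
          (\<lambda>e f. \<Oplus>\<^bsub>tensor_alg A A\<^esub>k\<in>edges \<Lambda>. tens A A (u' e k) (u' k f)),
        counit = game_hom cplx (\<lambda>v w. if v = w then 1 else 0) (\<lambda>e f. if e = f then 1 else 0),
        antipode = game_hom (opposite_alg A) (\<lambda>v w. u w v) (\<lambda>e f. u' f e)\<rparr>)"

end

theory Submission
  imports Defs
begin

text \<open>
  Write $C(i,j)$ for the game algebra of the pair $(\Lambda_i, \Lambda_j)$.  The theorem holds because these
  algebras, taken together, behave like the function algebras of the morphism spaces of a groupoid.

  Let $P$ and $Q$ be the generating magic unitaries of $C(i,k)$ and $C(k,j)$.  The matrix with entries
  $\sum_k p_{ik} \otimes q_{kj}$ is again a magic unitary and intertwines the incidence matrices
  (\<open>tens_prod_game_pair\<close>), so it defines a $*$-homomorphism $\Delta : C(i,j) \to C(i,k) \otimes C(k,j)$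
  (\<open>game_comult\<close>).  The comultiplications of the two quantum automorphism groups and the two coactions are
  instances of $\Delta$.  The transposed matrices also intertwine the incidence matrices, because a magic unitary
  satisfies $P P^t = P^t P = 1$ (\<open>game_pair_transpose\<close>); hence there is an antihomomorphism
  $S : C(i,j) \to C(j,i)$ (\<open>game_antipode\<close>).  Two homomorphisms on $C(i,j)$ are equal if they agree on the
  generators, and this gives the left counit law and one coassociativity law for four hypergraphs
  (\<open>comult_coassoc\<close>), which contains coassociativity of both Hopf algebras, both comodule laws and the
  compatibility of the two coactions.  The antipode law $S(x_1) x_2 = \varepsilon(x) 1$, for
  $x \in C(i,i)$ and $\Delta x = x_1 \otimes x_2 \in C(i,k) \otimes C(k,i)$, does not compare homomorphisms; the
  elements that satisfy it form a subalgebra, and the generators lie in it (\<open>antipode_left\<close>).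

  Let now $Z = C(1,2)$.  The left Galois map is $z \otimes z' \mapsto z_1 \otimes z_2 z'$ with
  $z_1 \otimes z_2 \in C(1,1) \otimes Z$, and its inverse is $a \otimes z \mapsto a_1 \otimes S(a_2) z$ with
  $a_1 \otimes a_2 \in Z \otimes C(2,1)$.  Both maps commute with right multiplication by $Z$ in the second factor.
  It therefore suffices to evaluate their composites on $z \otimes 1$ and on $a \otimes 1$, and there
  coassociativity, the antipode law and the counit law give
  $z_1 \otimes S(z_2) z_3 = z \otimes 1$ (\<open>translation_coaction\<close>) and $a_1 \otimes a_2 S(a_3) = a \otimes 1$
  (\<open>coaction_translation\<close>).

  The antipode is invertible and reverses cocomposition: $\Delta(S x) = S(x_2) \otimes S(x_1)$
  (\<open>comult_antipode\<close>).  Hence $a \otimes b \mapsto S(b) \otimes S(a)$ exchanges left and right.  It turns the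
  right Galois map of $C(1,2)$ into the left Galois map of $C(2,1)$, and it carries the left counit and antipode
  laws to the right ones (\<open>galois_map_right_bij\<close>, \<open>comult_counit_right\<close>, \<open>antipode_right\<close>).

  What remains is to provide the universal properties that make these definitions by generators legitimate: the
  tensor product represents bilinear maps (\<open>tensor_lift_linear\<close>, \<open>tensor_lift_tens\<close>), and the game algebra
  represents pairs of magic unitaries that intertwine the incidence matrices (\<open>game_hom_hom\<close>,
  \<open>game_hom_gen\<close>).
\<close>

section \<open>Star algebras and their homomorphisms\<close>

lemma cplx_simps [simp]:
  "carrier cplx = UNIV" "mult cplx = (*)" "one cplx = 1" "zero cplx = 0" "add cplx = (+)"
  "smult cplx = (*)" "adj cplx = cnj"
  by (simp_all add: cplx_def)

lemma cring_cplx: "cring cplx"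
proof (rule cringI)
  show "abelian_group cplx"
    by (rule abelian_groupI) (auto intro: exI[of _ "- x" for x :: complex])
  show "comm_monoid cplx"
    by unfold_locales auto
qed (simp add: algebra_simps)

lemma star_algebraI:
  fixes A (structure)
  assumes "ring A"
    and "\<And>c x. x \<in> carrier A \<Longrightarrow> c \<odot> x \<in> carrier A"
    and "\<And>c d x. x \<in> carrier A \<Longrightarrow> (c + d) \<odot> x = c \<odot> x \<oplus> d \<odot> x"
    and "\<And>c x y. x \<in> carrier A \<Longrightarrow> y \<in> carrier A \<Longrightarrow> c \<odot> (x \<oplus> y) = c \<odot> x \<oplus> c \<odot> y"
    and "\<And>c d x. x \<in> carrier A \<Longrightarrow> (c * d) \<odot> x = c \<odot> (d \<odot> x)"
    and "\<And>x. x \<in> carrier A \<Longrightarrow> 1 \<odot> x = x"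
    and "\<And>c x y. x \<in> carrier A \<Longrightarrow> y \<in> carrier A \<Longrightarrow> (c \<odot> x) \<otimes> y = c \<odot> (x \<otimes> y)"
    and "\<And>c x y. x \<in> carrier A \<Longrightarrow> y \<in> carrier A \<Longrightarrow> x \<otimes> (c \<odot> y) = c \<odot> (x \<otimes> y)"
    and "\<And>x. x \<in> carrier A \<Longrightarrow> adj A x \<in> carrier A"
    and "\<And>x. x \<in> carrier A \<Longrightarrow> adj A (adj A x) = x"
    and "\<And>x y. x \<in> carrier A \<Longrightarrow> y \<in> carrier A \<Longrightarrow> adj A (x \<oplus> y) = adj A x \<oplus> adj A y"
    and "\<And>c x. x \<in> carrier A \<Longrightarrow> adj A (c \<odot> x) = cnj c \<odot> adj A x"
    and "\<And>x y. x \<in> carrier A \<Longrightarrow> y \<in> carrier A \<Longrightarrow> adj A (x \<otimes> y) = adj A y \<otimes> adj A x"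
  shows "star_algebra A"
proof -
  have "module cplx A"
    by (rule moduleI) (use assms cring_cplx in \<open>auto simp: ring_def\<close>)
  then show ?thesis
    unfolding star_algebra_def star_algebra_axioms_def using assms by auto
qed

lemma star_algebra_cplx: "star_algebra cplx"
  by (rule star_algebraI) (use cring_cplx in \<open>auto simp: cring_def algebra_simps\<close>)

context star_algebra
begin

lemma ring_A: "ring A"
  using star_algebra_axioms unfolding star_algebra_def by blast

lemma abelian_monoid_A: "abelian_monoid A"
  using ring.is_abelian_group[OF ring_A] by (simp add: abelian_group_def)

end

text \<open>The locale \<^locale>\<open>star_algebra\<close> inherits every ring fact twice, once for the algebra and once for the scalars,
  under the same names.  The next locale has the same models but exports only the facts about the algebra.\<close>

locale star_alg_ring = ring A for A (structure) +
  assumes star_algebra: "star_algebra A"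

lemma star_alg_ringI: "star_algebra A \<Longrightarrow> star_alg_ring A"
  by (simp add: star_alg_ring_def star_alg_ring_axioms_def star_algebra.ring_A)

context star_alg_ring
begin

interpretation S: star_algebra A by (rule star_algebra)

lemmas smult_mult_l = S.smult_mult_l and smult_mult_r = S.smult_mult_r and adj_adj = S.adj_adj
  and adj_add = S.adj_add and adj_smult = S.adj_smult and adj_mult = S.adj_mult

lemma smult_cl [simp, intro]: "x \<in> carrier A \<Longrightarrow> c \<odot> x \<in> carrier A"
  using S.smult_closed by simp

lemma smult_add_scalar: "x \<in> carrier A \<Longrightarrow> (c + d) \<odot> x = c \<odot> x \<oplus> d \<odot> x"
  using S.smult_l_distr by simp

lemma smult_add_vector:
  "x \<in> carrier A \<Longrightarrow> y \<in> carrier A \<Longrightarrow> c \<odot> (x \<oplus> y) = c \<odot> x \<oplus> c \<odot> y"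
  using S.smult_r_distr by simp

lemma smult_smult: "x \<in> carrier A \<Longrightarrow> c \<odot> (d \<odot> x) = (c * d) \<odot> x"
  using S.smult_assoc1 by simp

lemma smult_unit [simp]: "x \<in> carrier A \<Longrightarrow> 1 \<odot> x = x"
  using S.smult_one by simp

lemma smult_zero_scalar [simp]: "x \<in> carrier A \<Longrightarrow> 0 \<odot> x = \<zero>"
  using S.smult_l_null by simp

lemma smult_zero_vector [simp]: "c \<odot> \<zero> = \<zero>"
  using S.smult_r_null by simp

lemma smult_minus_one: "x \<in> carrier A \<Longrightarrow> (- 1) \<odot> x = \<ominus> x"
  using smult_add_scalar[of x "-1" 1] by (intro minus_equality[symmetric]) auto

lemma minus_as_smult: "x \<in> carrier A \<Longrightarrow> y \<in> carrier A \<Longrightarrow> x \<ominus> y = x \<oplus> (- 1) \<odot> y"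
  by (simp add: a_minus_def smult_minus_one)

lemma adj_cl [simp, intro]: "x \<in> carrier A \<Longrightarrow> adj A x \<in> carrier A"
  by (rule S.adj_closed)

lemma adj_zero [simp]: "adj A \<zero> = \<zero>"
  using adj_smult[of \<zero> 0] by simp

lemma adj_one [simp]: "adj A \<one> = \<one>"
proof -
  have "adj A (\<one> \<otimes> adj A \<one>) = adj A (adj A \<one>) \<otimes> adj A \<one>" by (intro adj_mult) auto
  then show ?thesis by (simp add: adj_adj)
qed

lemma diff_zero_iff: "x \<in> carrier A \<Longrightarrow> y \<in> carrier A \<Longrightarrow> x \<ominus> y = \<zero> \<longleftrightarrow> x = y"
  using minus_equality[of x "\<ominus> y"] by (auto simp: a_minus_def r_neg)

end

lemma linear_onI:
  assumes "\<And>x. x \<in> carrier A \<Longrightarrow> h x \<in> carrier B"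
    and "\<And>x y. x \<in> carrier A \<Longrightarrow> y \<in> carrier A \<Longrightarrow> h (x \<oplus>\<^bsub>A\<^esub> y) = h x \<oplus>\<^bsub>B\<^esub> h y"
    and "\<And>c x. x \<in> carrier A \<Longrightarrow> h (c \<odot>\<^bsub>A\<^esub> x) = c \<odot>\<^bsub>B\<^esub> h x"
  shows "linear_on A B h"
  using assms by (auto simp: linear_on_def)

lemma
  assumes "linear_on A B h"
  shows linear_closed: "x \<in> carrier A \<Longrightarrow> h x \<in> carrier B"
    and linear_add: "x \<in> carrier A \<Longrightarrow> y \<in> carrier A \<Longrightarrow> h (x \<oplus>\<^bsub>A\<^esub> y) = h x \<oplus>\<^bsub>B\<^esub> h y"
    and linear_smult: "x \<in> carrier A \<Longrightarrow> h (c \<odot>\<^bsub>A\<^esub> x) = c \<odot>\<^bsub>B\<^esub> h x"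
  using assms by (auto simp: linear_on_def)

lemma linear_compose:
  "linear_on A B f \<Longrightarrow> linear_on B C g \<Longrightarrow> linear_on A C (\<lambda>x. g (f x))"
  by (auto simp: linear_on_def Pi_iff)

lemma linear_zero:
  assumes "star_algebra A" "star_algebra B" "linear_on A B h"
  shows "h \<zero>\<^bsub>A\<^esub> = \<zero>\<^bsub>B\<^esub>"
proof -
  interpret A: star_alg_ring A by (rule star_alg_ringI) fact
  interpret B: star_alg_ring B by (rule star_alg_ringI) fact
  have "h (0 \<odot>\<^bsub>A\<^esub> \<zero>\<^bsub>A\<^esub>) = 0 \<odot>\<^bsub>B\<^esub> h \<zero>\<^bsub>A\<^esub>"
    by (rule linear_smult[OF assms(3)]) simp
  then show ?thesis using linear_closed[OF assms(3), of "\<zero>\<^bsub>A\<^esub>"] by simp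
qed

lemma linear_finsum:
  assumes "star_algebra A" "star_algebra B" and h: "linear_on A B h"
    and "finite I" "\<And>i. i \<in> I \<Longrightarrow> f i \<in> carrier A"
  shows "h (\<Oplus>\<^bsub>A\<^esub>i\<in>I. f i) = (\<Oplus>\<^bsub>B\<^esub>i\<in>I. h (f i))"
proof -
  interpret A: star_alg_ring A by (rule star_alg_ringI) fact
  interpret B: star_alg_ring B by (rule star_alg_ringI) fact
  show ?thesis using assms(4,5)
  proof (induction I)
    case empty
    then show ?case using linear_zero[OF assms(1,2) h] by simp
  next
    case (insert i I)
    have 1: "f \<in> I \<rightarrow> carrier A" using insert by auto
    have 2: "(\<lambda>i. h (f i)) \<in> I \<rightarrow> carrier B" using insert linear_closed[OF h] by auto
    show ?case using insert 1 2 by (simp add: linear_add[OF h] linear_closed[OF h])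
  qed
qed

lemma unital_star_homI:
  assumes "linear_on A B h"
    and "\<And>x y. x \<in> carrier A \<Longrightarrow> y \<in> carrier A \<Longrightarrow> h (x \<otimes>\<^bsub>A\<^esub> y) = h x \<otimes>\<^bsub>B\<^esub> h y"
    and "h \<one>\<^bsub>A\<^esub> = \<one>\<^bsub>B\<^esub>"
    and "\<And>x. x \<in> carrier A \<Longrightarrow> h (adj A x) = adj B (h x)"
  shows "unital_star_hom A B h"
  using assms by (auto simp: unital_star_hom_def linear_on_def ring_hom_def)

lemma
  assumes "unital_star_hom A B h"
  shows hom_linear: "linear_on A B h"
    and hom_mult: "x \<in> carrier A \<Longrightarrow> y \<in> carrier A \<Longrightarrow> h (x \<otimes>\<^bsub>A\<^esub> y) = h x \<otimes>\<^bsub>B\<^esub> h y"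
    and hom_one: "h \<one>\<^bsub>A\<^esub> = \<one>\<^bsub>B\<^esub>"
    and hom_adj: "x \<in> carrier A \<Longrightarrow> h (adj A x) = adj B (h x)"
    and hom_closed: "x \<in> carrier A \<Longrightarrow> h x \<in> carrier B"
  using assms by (auto simp: unital_star_hom_def linear_on_def ring_hom_def)

lemma hom_compose:
  assumes f: "unital_star_hom A B f" and g: "unital_star_hom B C g"
  shows "unital_star_hom A C (\<lambda>x. g (f x))"
proof (rule unital_star_homI)
  show "linear_on A C (\<lambda>x. g (f x))"
    by (rule linear_compose[OF hom_linear[OF f] hom_linear[OF g]])
qed (simp_all add: hom_mult[OF f] hom_mult[OF g] hom_one[OF f] hom_one[OF g]
    hom_adj[OF f] hom_adj[OF g] hom_closed[OF f])

lemma hom_id: "unital_star_hom A A id"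
  by (intro unital_star_homI linear_onI) auto

section \<open>The algebra of a monoid with involution\<close>

lemma sum_keys_superset:
  assumes "finite K" "Poly_Mapping.keys f \<subseteq> K" "\<And>x. F x 0 = 0"
  shows "(\<Sum>x\<in>Poly_Mapping.keys f. F x (Poly_Mapping.lookup f x)) = (\<Sum>x\<in>K. F x (Poly_Mapping.lookup f x))"
  by (rule sum.mono_neutral_left) (use assms in \<open>auto simp: in_keys_iff\<close>)

text \<open>The sum over the support is additive although the supports of \<open>f\<close>, \<open>g\<close> and \<open>f + g\<close> differ:
  all three sums may be taken over the union of the first two supports, since \<open>F x 0 = 0\<close>.\<close>

lemma sum_keys_add:
  assumes "\<And>x. F x 0 = (0 :: 'b :: comm_monoid_add)" "\<And>x a b. F x (a + b) = F x a + F x b"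
  shows "(\<Sum>x\<in>Poly_Mapping.keys (f + g). F x (Poly_Mapping.lookup (f + g) x)) =
    (\<Sum>x\<in>Poly_Mapping.keys f. F x (Poly_Mapping.lookup f x)) +
    (\<Sum>x\<in>Poly_Mapping.keys g. F x (Poly_Mapping.lookup g x))"
proof -
  let ?K = "Poly_Mapping.keys f \<union> Poly_Mapping.keys g"
  have K: "finite ?K" "Poly_Mapping.keys (f + g) \<subseteq> ?K" by (auto simp: keys_add)
  show ?thesis
    using sum_keys_superset[of ?K "f + g" F] sum_keys_superset[of ?K f F] sum_keys_superset[of ?K g F]
      K assms by (simp add: lookup_add sum.distrib keys_add)
qed

lemma keys_scale: "Poly_Mapping.keys (Poly_Mapping.map ((*) (c :: complex)) f) \<subseteq> Poly_Mapping.keys f"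
  by (auto simp: in_keys_iff Poly_Mapping.map.rep_eq when_def)

lemma lookup_scale: "Poly_Mapping.lookup (Poly_Mapping.map ((*) (c :: complex)) f) x = c * Poly_Mapping.lookup f x"
  by (auto simp: Poly_Mapping.map.rep_eq when_def)

lemma scale_single: "Poly_Mapping.map ((*) (c :: complex)) (Poly_Mapping.single x a) = Poly_Mapping.single x (c * a)"
  by (rule poly_mapping_eqI) (simp add: lookup_scale lookup_single when_def)

lemma scale_add: "Poly_Mapping.map ((*) (c :: complex)) (f + g) = Poly_Mapping.map ((*) c) f + Poly_Mapping.map ((*) c) g"
  by (rule poly_mapping_eqI) (simp add: lookup_scale lookup_add algebra_simps)

lemma scale_zero: "Poly_Mapping.map ((*) (c :: complex)) 0 = 0"
  by (rule poly_mapping_eqI) (simp add: lookup_scale)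

text \<open>Identities between additive operations on formal linear combinations follow from their validity on
  multiples of basis elements.\<close>

lemma poly_mapping_additive_induct:
  fixes f :: "'a \<Rightarrow>\<^sub>0 'b :: comm_monoid_add"
  assumes "Poly_Mapping.keys f \<subseteq> S" "P 0"
    and "\<And>x a. x \<in> S \<Longrightarrow> P (Poly_Mapping.single x a)"
    and "\<And>f g. Poly_Mapping.keys f \<subseteq> S \<Longrightarrow> Poly_Mapping.keys g \<subseteq> S \<Longrightarrow> P f \<Longrightarrow> P g \<Longrightarrow> P (f + g)"
  shows "P f"
proof -
  let ?s = "\<lambda>K. \<Sum>x\<in>K. Poly_Mapping.single x (Poly_Mapping.lookup f x)"
  have *: "Poly_Mapping.keys (?s K) \<subseteq> S \<and> P (?s K)" if "finite K" "K \<subseteq> S" for K using that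
  proof (induction K)
    case (insert x K)
    have k: "Poly_Mapping.keys (Poly_Mapping.single x (Poly_Mapping.lookup f x)) \<subseteq> S"
      using insert by auto
    then have "Poly_Mapping.keys (Poly_Mapping.single x (Poly_Mapping.lookup f x) + ?s K) \<subseteq> S"
      using insert keys_add[of "Poly_Mapping.single x (Poly_Mapping.lookup f x)" "?s K"] by blast
    moreover have "P (Poly_Mapping.single x (Poly_Mapping.lookup f x) + ?s K)"
      by (rule assms(4)) (use k insert assms(3) in auto)
    ultimately show ?case using insert by simp
  qed (use assms(2) in auto)
  have "?s (Poly_Mapping.keys f) = f"
    by (rule poly_mapping_eqI)
      (auto simp: lookup_sum lookup_single when_def in_keys_iff)
  then show ?thesis using *[of "Poly_Mapping.keys f"] assms(1) by simp
qed

locale monoid_involution = Group.monoid M for M (structure) and st +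
  assumes st_closed: "x \<in> carrier M \<Longrightarrow> st x \<in> carrier M"
    and st_st: "x \<in> carrier M \<Longrightarrow> st (st x) = x"
    and st_mult: "x \<in> carrier M \<Longrightarrow> y \<in> carrier M \<Longrightarrow> st (x \<otimes> y) = st y \<otimes> st x"
begin

abbreviation "CM \<equiv> monoid_star_alg M st"

lemma CM_simps:
  "carrier CM = {f. Poly_Mapping.keys f \<subseteq> carrier M}"
  "one CM = Poly_Mapping.single \<one> 1" "zero CM = 0" "add CM = (+)"
  "smult CM = (\<lambda>c. Poly_Mapping.map ((*) c))"
  by (simp_all add: monoid_star_alg_def)

lemma CM_mult_add_left: "(f + g) \<otimes>\<^bsub>CM\<^esub> h = f \<otimes>\<^bsub>CM\<^esub> h + g \<otimes>\<^bsub>CM\<^esub> h"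
  unfolding monoid_star_alg_def by simp
    (rule sum_keys_add, auto simp: algebra_simps single_add sum.distrib)

lemma CM_mult_add_right: "h \<otimes>\<^bsub>CM\<^esub> (f + g) = h \<otimes>\<^bsub>CM\<^esub> f + h \<otimes>\<^bsub>CM\<^esub> g"
  unfolding monoid_star_alg_def by simp
    (subst sum.distrib[symmetric], rule sum.cong[OF refl], rule sum_keys_add,
      auto simp: algebra_simps single_add)

lemma CM_mult_single:
  "Poly_Mapping.single x a \<otimes>\<^bsub>CM\<^esub> Poly_Mapping.single y b = Poly_Mapping.single (x \<otimes> y) (a * b)"
  unfolding monoid_star_alg_def by simp

lemma CM_mult_zero: "0 \<otimes>\<^bsub>CM\<^esub> f = 0" "f \<otimes>\<^bsub>CM\<^esub> 0 = 0"
  unfolding monoid_star_alg_def by simp_all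

lemma CM_adj_add: "adj CM (f + g) = adj CM f + adj CM g"
  unfolding monoid_star_alg_def by simp
    (rule sum_keys_add, auto simp: single_add)

lemma CM_adj_single: "adj CM (Poly_Mapping.single x a) = Poly_Mapping.single (st x) (cnj a)"
  unfolding monoid_star_alg_def by simp

lemma CM_adj_zero: "adj CM 0 = 0"
  unfolding monoid_star_alg_def by simp

lemma CM_induct [consumes 1, case_names zero single add]:
  assumes "f \<in> carrier CM" "P 0"
    and "\<And>x a. x \<in> carrier M \<Longrightarrow> P (Poly_Mapping.single x a)"
    and "\<And>f g. f \<in> carrier CM \<Longrightarrow> g \<in> carrier CM \<Longrightarrow> P f \<Longrightarrow> P g \<Longrightarrow> P (f + g)"
  shows "P f"
  by (rule poly_mapping_additive_induct[of f "carrier M"]) (use assms in \<open>auto simp: CM_simps\<close>)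

lemma CM_single_closed: "x \<in> carrier M \<Longrightarrow> Poly_Mapping.single x a \<in> carrier CM"
  by (simp add: CM_simps)

lemma CM_add_closed: "f \<in> carrier CM \<Longrightarrow> g \<in> carrier CM \<Longrightarrow> f + g \<in> carrier CM"
  using keys_add[of f g] by (auto simp: CM_simps)

lemma CM_zero_closed: "0 \<in> carrier CM"
  by (simp add: CM_simps)

lemma CM_mult_closed: "f \<in> carrier CM \<Longrightarrow> g \<in> carrier CM \<Longrightarrow> f \<otimes>\<^bsub>CM\<^esub> g \<in> carrier CM"
proof (induction f rule: CM_induct)
  case (single x a)
  show ?case using single(2,1)
    by (induction g rule: CM_induct)
     (auto simp: CM_mult_zero CM_mult_add_right CM_mult_single CM_single_closed CM_zero_closed intro: CM_add_closed)
qed (auto simp: CM_mult_zero CM_mult_add_left CM_zero_closed intro: CM_add_closed)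

lemma CM_adj_closed: "f \<in> carrier CM \<Longrightarrow> adj CM f \<in> carrier CM"
  by (induction f rule: CM_induct)
     (auto simp: CM_adj_zero CM_adj_add CM_adj_single st_closed CM_single_closed CM_zero_closed intro: CM_add_closed)

lemmas CM_calc = CM_mult_zero CM_mult_add_left CM_mult_add_right CM_mult_single CM_adj_add
  CM_adj_single CM_adj_zero scale_add scale_single scale_zero

lemma CM_mult_assoc:
  assumes "f \<in> carrier CM" "g \<in> carrier CM" "h \<in> carrier CM"
  shows "(f \<otimes>\<^bsub>CM\<^esub> g) \<otimes>\<^bsub>CM\<^esub> h = f \<otimes>\<^bsub>CM\<^esub> (g \<otimes>\<^bsub>CM\<^esub> h)"
  using assms
proof (induction f rule: CM_induct)
  case (single x a)
  show ?case using single(2,1,3)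
  proof (induction g rule: CM_induct)
    case (single y b)
    show ?case using single(3,1,2)
      by (induction h rule: CM_induct) (auto simp: CM_calc m_assoc mult.assoc)
  qed (auto simp: CM_calc)
qed (auto simp: CM_calc)

lemma CM_mult_one: "f \<in> carrier CM \<Longrightarrow> f \<otimes>\<^bsub>CM\<^esub> \<one>\<^bsub>CM\<^esub> = f" "f \<in> carrier CM \<Longrightarrow> \<one>\<^bsub>CM\<^esub> \<otimes>\<^bsub>CM\<^esub> f = f"
  by (induction f rule: CM_induct) (auto simp: CM_calc CM_simps(2))

lemma CM_mult_smult:
  assumes "f \<in> carrier CM" "g \<in> carrier CM"
  shows "(c \<odot>\<^bsub>CM\<^esub> f) \<otimes>\<^bsub>CM\<^esub> g = c \<odot>\<^bsub>CM\<^esub> (f \<otimes>\<^bsub>CM\<^esub> g)" (is ?A)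
    and "f \<otimes>\<^bsub>CM\<^esub> (c \<odot>\<^bsub>CM\<^esub> g) = c \<odot>\<^bsub>CM\<^esub> (f \<otimes>\<^bsub>CM\<^esub> g)" (is ?B)
proof -
  have "?A \<and> ?B" using assms
  proof (induction f rule: CM_induct)
    case (single x a)
    show ?case using single(2,1)
      by (induction g rule: CM_induct) (auto simp: CM_calc CM_simps(5) algebra_simps)
  qed (auto simp: CM_calc CM_simps(5))
  then show ?A ?B by auto
qed

lemma CM_adj_mult:
  assumes "f \<in> carrier CM" "g \<in> carrier CM"
  shows "adj CM (f \<otimes>\<^bsub>CM\<^esub> g) = adj CM g \<otimes>\<^bsub>CM\<^esub> adj CM f"
  using assms
proof (induction f rule: CM_induct)
  case (single x a)
  show ?case using single(2,1)
    by (induction g rule: CM_induct) (auto simp: CM_calc st_mult mult.commute)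
qed (auto simp: CM_calc)

lemma CM_adj_adj: "f \<in> carrier CM \<Longrightarrow> adj CM (adj CM f) = f"
  by (induction f rule: CM_induct) (auto simp: CM_calc st_st)

lemma CM_adj_smult: "f \<in> carrier CM \<Longrightarrow> adj CM (c \<odot>\<^bsub>CM\<^esub> f) = cnj c \<odot>\<^bsub>CM\<^esub> adj CM f"
  by (induction f rule: CM_induct) (auto simp: CM_calc CM_simps(5))

lemma star_algebra_CM: "star_algebra CM"
proof (rule star_algebraI)
  have "abelian_group CM"
  proof (rule abelian_groupI)
    fix x assume "x \<in> carrier CM"
    then show "\<exists>y\<in>carrier CM. y \<oplus>\<^bsub>CM\<^esub> x = \<zero>\<^bsub>CM\<^esub>"
      by (intro bexI[of _ "- x"]) (simp_all add: CM_simps)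
  qed (use CM_add_closed in \<open>auto simp: CM_simps algebra_simps\<close>)
  moreover have "Group.monoid CM"
    by (rule monoidI) (use CM_mult_closed CM_mult_assoc CM_mult_one CM_simps in auto)
  ultimately show "ring CM"
    by (rule ringI) (auto simp: CM_simps(4) CM_calc)
next
  fix c x assume "x \<in> carrier CM"
  then show "c \<odot>\<^bsub>CM\<^esub> x \<in> carrier CM" using keys_scale[of c x] by (auto simp: CM_simps)
next
  fix c x y assume "x \<in> carrier CM" "y \<in> carrier CM"
  then show "(c \<odot>\<^bsub>CM\<^esub> x) \<otimes>\<^bsub>CM\<^esub> y = c \<odot>\<^bsub>CM\<^esub> (x \<otimes>\<^bsub>CM\<^esub> y)"
    "x \<otimes>\<^bsub>CM\<^esub> (c \<odot>\<^bsub>CM\<^esub> y) = c \<odot>\<^bsub>CM\<^esub> (x \<otimes>\<^bsub>CM\<^esub> y)"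
    by (rule CM_mult_smult)+
next
  fix c x assume "x \<in> carrier CM"
  then show "adj CM (c \<odot>\<^bsub>CM\<^esub> x) = cnj c \<odot>\<^bsub>CM\<^esub> adj CM x" by (rule CM_adj_smult)
qed (auto simp: CM_adj_mult CM_adj_adj CM_adj_closed CM_adj_add CM_simps(4,5)
     scale_add lookup_scale lookup_add algebra_simps intro!: poly_mapping_eqI)

end

section \<open>Quotients\<close>

text \<open>For ring operations that are copied into a record with more fields.\<close>

lemma ring_eqI:
  assumes "ring R"
    and eqs: "carrier S = carrier R" "mult S = mult R" "one S = one R" "zero S = zero R" "add S = add R"
  shows "ring S"
proof -
  interpret R: ring R by fact
  show ?thesis
  proof (rule ringI)
    show "abelian_group S"
    proof (rule abelian_groupI)
      fix x assume "x \<in> carrier S"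
      then show "\<exists>y\<in>carrier S. y \<oplus>\<^bsub>S\<^esub> x = \<zero>\<^bsub>S\<^esub>"
        by (intro bexI[of _ "\<ominus>\<^bsub>R\<^esub> x"]) (simp_all add: eqs R.l_neg)
    qed (simp_all add: eqs R.a_ac)
    show "Group.monoid S" by (rule monoidI) (simp_all add: eqs R.m_assoc)
  qed (simp_all add: eqs R.l_distr R.r_distr)
qed

text \<open>Submodules and star-closed ideals in terms of explicit closure conditions.  The zero element and the scalar
  multiples replace the additive inverses in the definitions of \<^locale>\<open>submodule\<close> and \<^locale>\<open>ideal\<close>.\<close>

definition linear_subspace :: "('a, 'm) star_alg_scheme \<Rightarrow> 'a set \<Rightarrow> bool" where
  "linear_subspace A N \<longleftrightarrow> N \<subseteq> carrier A \<and> \<zero>\<^bsub>A\<^esub> \<in> N \<and>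
     (\<forall>x\<in>N. \<forall>y\<in>N. x \<oplus>\<^bsub>A\<^esub> y \<in> N) \<and> (\<forall>c. \<forall>x\<in>N. c \<odot>\<^bsub>A\<^esub> x \<in> N)"

definition star_ideal :: "('a, 'm) star_alg_scheme \<Rightarrow> 'a set \<Rightarrow> bool" where
  "star_ideal A I \<longleftrightarrow> linear_subspace A I \<and>
     (\<forall>x\<in>I. \<forall>y\<in>carrier A. y \<otimes>\<^bsub>A\<^esub> x \<in> I \<and> x \<otimes>\<^bsub>A\<^esub> y \<in> I) \<and> (\<forall>x\<in>I. adj A x \<in> I)"

lemma linear_subspaceI:
  assumes "N \<subseteq> carrier A" "\<zero>\<^bsub>A\<^esub> \<in> N" "\<And>x y. x \<in> N \<Longrightarrow> y \<in> N \<Longrightarrow> x \<oplus>\<^bsub>A\<^esub> y \<in> N"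
    "\<And>c x. x \<in> N \<Longrightarrow> c \<odot>\<^bsub>A\<^esub> x \<in> N"
  shows "linear_subspace A N"
  using assms by (auto simp: linear_subspace_def)

lemma submodule_iff:
  assumes "star_algebra A"
  shows "submodule N cplx A \<longleftrightarrow> linear_subspace A N"
proof -
  interpret A: star_alg_ring A by (rule star_alg_ringI) fact
  interpret M: star_algebra A by fact
  show ?thesis
  proof
    assume N: "submodule N cplx A"
    show "linear_subspace A N"
    proof (rule linear_subspaceI)
      show "\<zero>\<^bsub>A\<^esub> \<in> N"
        using subgroup.one_closed[OF submodule.axioms(1)[OF N]] by simp
    qed (use M.submoduleE[OF N] in auto)
  next
    assume N: "linear_subspace A N"
    show "submodule N cplx A"
    proof (rule M.submoduleI)
      fix a assume "a \<in> N"
      then have "(-1) \<odot>\<^bsub>A\<^esub> a \<in> N" "a \<in> carrier A" using N by (auto simp: linear_subspace_def)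
      then show "\<ominus>\<^bsub>A\<^esub> a \<in> N" by (simp add: A.smult_minus_one)
    qed (use N in \<open>auto simp: linear_subspace_def\<close>)
  qed
qed

text \<open>An ideal of a unital algebra is automatically a linear subspace, because $c x = (c 1) x$.\<close>

lemma ideal_iff:
  assumes "star_algebra A"
  shows "ideal I A \<and> adj A ` I \<subseteq> I \<longleftrightarrow> star_ideal A I"
proof -
  interpret A: star_alg_ring A by (rule star_alg_ringI) fact
  show ?thesis
  proof
    assume I: "ideal I A \<and> adj A ` I \<subseteq> I"
    then interpret I: ideal I A by blast
    have sub: "I \<subseteq> carrier A" by (rule I.a_subset)
    have "linear_subspace A I"
    proof (rule linear_subspaceI)
      fix c x assume x: "x \<in> I"
      have "(c \<odot>\<^bsub>A\<^esub> \<one>\<^bsub>A\<^esub>) \<otimes>\<^bsub>A\<^esub> x \<in> I" using x by (intro I.I_l_closed) auto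
      then show "c \<odot>\<^bsub>A\<^esub> x \<in> I" using x sub by (auto simp: A.smult_mult_l)
    qed (use sub in auto)
    then show "star_ideal A I"
      using I I.I_l_closed I.I_r_closed by (auto simp: star_ideal_def)
  next
    assume I: "star_ideal A I"
    have "subgroup I (add_monoid A)"
      using I submodule_iff[OF assms, of I] by (simp add: star_ideal_def submodule_def)
    then have "ideal I A"
      using I by (intro idealI A.ring_axioms) (auto simp: star_ideal_def)
    then show "ideal I A \<and> adj A ` I \<subseteq> I" using I by (auto simp: star_ideal_def)
  qed
qed

context
  fixes A :: "('a, 'm) star_alg_scheme" and I
  assumes A: "star_algebra A" and I: "star_ideal A I"
begin

interpretation A: star_alg_ring A by (rule star_alg_ringI[OF A])
interpretation I: ideal I A using I ideal_iff[OF A] by blast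

private abbreviation (input) "\<pi> \<equiv> \<lambda>x. I +>\<^bsub>A\<^esub> x"
private abbreviation (input) "Q \<equiv> quot_star_alg A I"

lemma quot_carrier: "carrier Q = \<pi> ` carrier A"
  by (auto simp: quot_star_alg_def FactRing_def A_RCOSETS_def')

lemma quot_eq_iff:
  "x \<in> carrier A \<Longrightarrow> y \<in> carrier A \<Longrightarrow> \<pi> x = \<pi> y \<longleftrightarrow> x \<oplus>\<^bsub>A\<^esub> (-1) \<odot>\<^bsub>A\<^esub> y \<in> I"
  using A.quotient_eq_iff_same_a_r_cos[OF I.ideal_axioms, of x y] by (simp add: A.minus_as_smult)

lemma quot_add:
  "x \<in> carrier A \<Longrightarrow> y \<in> carrier A \<Longrightarrow> \<pi> x \<oplus>\<^bsub>Q\<^esub> \<pi> y = \<pi> (x \<oplus>\<^bsub>A\<^esub> y)"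
  by (simp add: quot_star_alg_def FactRing_def I.a_rcos_sum)

lemma quot_mult:
  "x \<in> carrier A \<Longrightarrow> y \<in> carrier A \<Longrightarrow> \<pi> x \<otimes>\<^bsub>Q\<^esub> \<pi> y = \<pi> (x \<otimes>\<^bsub>A\<^esub> y)"
  by (simp add: quot_star_alg_def FactRing_def I.rcoset_mult_add)

lemma quot_one: "\<one>\<^bsub>Q\<^esub> = \<pi> \<one>\<^bsub>A\<^esub>"
  by (simp add: quot_star_alg_def FactRing_def)

lemma quot_zero: "\<zero>\<^bsub>Q\<^esub> = \<pi> \<zero>\<^bsub>A\<^esub>"
  using I.a_subset A.a_coset_add_zero[of I] by (simp add: quot_star_alg_def FactRing_def)

text \<open>The scalar multiple of a coset is defined as a union over all representatives.  It is a single coset because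
  the ideal is a linear subspace.\<close>

lemma quot_smult:
  assumes x: "x \<in> carrier A"
  shows "c \<odot>\<^bsub>Q\<^esub> \<pi> x = \<pi> (c \<odot>\<^bsub>A\<^esub> x)"
proof -
  have *: "\<pi> (c \<odot>\<^bsub>A\<^esub> y) = \<pi> (c \<odot>\<^bsub>A\<^esub> x)" if y: "y \<in> \<pi> x" for y
  proof -
    have yc: "y \<in> carrier A" using y x I.a_subset by (auto simp: a_r_coset_def')
    have "\<pi> y = \<pi> x" using y x I.a_repr_independence' by metis
    then have "y \<oplus>\<^bsub>A\<^esub> (-1) \<odot>\<^bsub>A\<^esub> x \<in> I" using quot_eq_iff[OF yc x] by simp
    then have "c \<odot>\<^bsub>A\<^esub> (y \<oplus>\<^bsub>A\<^esub> (-1) \<odot>\<^bsub>A\<^esub> x) \<in> I"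
      using I by (auto simp: star_ideal_def linear_subspace_def)
    then show ?thesis using x yc
      by (simp add: quot_eq_iff A.smult_add_vector A.smult_smult)
  qed
  have "x \<in> \<pi> x" using x by (rule I.a_rcos_self)
  then have "(\<Union>y\<in>\<pi> x. \<pi> (c \<odot>\<^bsub>A\<^esub> y)) = \<pi> (c \<odot>\<^bsub>A\<^esub> x)" using * by blast
  then show ?thesis by (simp add: quot_star_alg_def)
qed

text \<open>The image of a coset under the involution is all of a coset, and not only a part of it, because the involution maps
  the ideal onto itself.\<close>

lemma quot_adj:
  assumes x: "x \<in> carrier A"
  shows "adj Q (\<pi> x) = \<pi> (adj A x)"
proof -
  have IA: "h \<in> carrier A" "adj A h \<in> I" if "h \<in> I" for h
    using I that by (auto simp: star_ideal_def linear_subspace_def)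
  have "adj A ` \<pi> x = \<pi> (adj A x)"
  proof (intro equalityI subsetI)
    fix y assume "y \<in> adj A ` \<pi> x"
    then obtain h where "h \<in> I" "y = adj A (h \<oplus>\<^bsub>A\<^esub> x)" by (auto simp: a_r_coset_def')
    then show "y \<in> \<pi> (adj A x)" using IA[of h] x by (auto simp: a_r_coset_def' A.adj_add)
  next
    fix y assume "y \<in> \<pi> (adj A x)"
    then obtain h where h: "h \<in> I" "y = h \<oplus>\<^bsub>A\<^esub> adj A x" by (auto simp: a_r_coset_def')
    then have "y = adj A (adj A h \<oplus>\<^bsub>A\<^esub> x)" using IA[of h] x by (simp add: A.adj_add A.adj_adj)
    moreover have "adj A h \<oplus>\<^bsub>A\<^esub> x \<in> \<pi> x" using IA[of h] h by (auto simp: a_r_coset_def')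
    ultimately show "y \<in> adj A ` \<pi> x" by blast
  qed
  then show ?thesis by (simp add: quot_star_alg_def)
qed

lemma star_algebra_quot: "star_algebra Q"
proof (rule star_algebraI)
  have "ring (A Quot I)" by (rule I.quotient_is_ring)
  then show "ring Q" by (rule ring_eqI) (simp_all add: quot_star_alg_def)
qed (auto simp: quot_carrier quot_add quot_mult quot_smult quot_adj A.smult_add_scalar
    A.smult_add_vector A.smult_smult A.smult_mult_l A.smult_mult_r A.adj_adj A.adj_add A.adj_smult
    A.adj_mult)

lemma hom_quot: "unital_star_hom A Q \<pi>"
  by (intro unital_star_homI linear_onI)
     (auto simp: quot_carrier quot_add quot_mult quot_smult quot_adj quot_one)

end

lemma lin_span_subspace:
  assumes A: "star_algebra A" and R: "R \<subseteq> carrier A"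
  shows "linear_subspace A (lin_span A R)"
    and "R \<subseteq> lin_span A R"
    and "\<And>N. linear_subspace A N \<Longrightarrow> R \<subseteq> N \<Longrightarrow> lin_span A R \<subseteq> N"
proof -
  interpret A: star_alg_ring A by (rule star_alg_ringI) fact
  have "linear_subspace A (carrier A)" by (rule linear_subspaceI) auto
  then show "linear_subspace A (lin_span A R)"
    using R unfolding lin_span_def submodule_iff[OF A] by (auto simp: linear_subspace_def)
qed (auto simp: lin_span_def submodule_iff[OF A])

lemma gen_star_ideal_ideal:
  assumes A: "star_algebra A" and R: "R \<subseteq> carrier A"
  shows "star_ideal A (gen_star_ideal A R)"
    and "R \<subseteq> gen_star_ideal A R"
    and "\<And>I. star_ideal A I \<Longrightarrow> R \<subseteq> I \<Longrightarrow> gen_star_ideal A R \<subseteq> I"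
proof -
  interpret A: star_alg_ring A by (rule star_alg_ringI) fact
  have eq: "gen_star_ideal A R = \<Inter>{I. star_ideal A I \<and> R \<subseteq> I}"
    unfolding gen_star_ideal_def ideal_iff[OF A, symmetric] by (simp add: conj_assoc)
  have "star_ideal A (carrier A)" unfolding star_ideal_def by (auto intro!: linear_subspaceI)
  then show "star_ideal A (gen_star_ideal A R)"
    using R unfolding eq by (auto simp: linear_subspace_def star_ideal_def)
  show "R \<subseteq> gen_star_ideal A R" unfolding eq by blast
  show "\<And>I. star_ideal A I \<Longrightarrow> R \<subseteq> I \<Longrightarrow> gen_star_ideal A R \<subseteq> I" unfolding eq by blast
qed

section \<open>Linear extensions\<close>

context monoid_involution
begin

context
  fixes B :: "('tgt, 'ext) star_alg_scheme" and h :: "'a \<Rightarrow> 'tgt"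
  assumes B: "star_algebra B" and h: "\<And>x. x \<in> carrier M \<Longrightarrow> h x \<in> carrier B"
begin

interpretation B: star_alg_ring B by (rule star_alg_ringI[OF B])

lemma lin_ext_zero: "lin_ext B h 0 = \<zero>\<^bsub>B\<^esub>"
  by (simp add: lin_ext_def)

lemma lin_ext_single:
  "x \<in> carrier M \<Longrightarrow> lin_ext B h (Poly_Mapping.single x a) = a \<odot>\<^bsub>B\<^esub> h x"
  using h by (simp add: lin_ext_def)

text \<open>The support may be enlarged to a common finite set, which is what makes the linear extension additive.\<close>

lemma lin_ext_superset:
  assumes "finite K" "Poly_Mapping.keys f \<subseteq> K" "K \<subseteq> carrier M"
  shows "lin_ext B h f = (\<Oplus>\<^bsub>B\<^esub>x\<in>K. Poly_Mapping.lookup f x \<odot>\<^bsub>B\<^esub> h x)"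
  unfolding lin_ext_def
  by (rule B.add.finprod_mono_neutral_cong_left)
     (use assms h in \<open>auto simp: in_keys_iff Pi_iff subset_iff\<close>)

lemma lin_ext_closed: "f \<in> carrier CM \<Longrightarrow> lin_ext B h f \<in> carrier B"
  using h unfolding lin_ext_def by (intro B.finsum_closed) (auto simp: CM_simps)

lemma lin_ext_add:
  assumes "f \<in> carrier CM" "g \<in> carrier CM"
  shows "lin_ext B h (f + g) = lin_ext B h f \<oplus>\<^bsub>B\<^esub> lin_ext B h g"
proof -
  let ?K = "Poly_Mapping.keys f \<union> Poly_Mapping.keys g"
  have K: "finite ?K" "?K \<subseteq> carrier M" using assms by (auto simp: CM_simps)
  have "lin_ext B h (f + g) = (\<Oplus>\<^bsub>B\<^esub>x\<in>?K. Poly_Mapping.lookup (f + g) x \<odot>\<^bsub>B\<^esub> h x)"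
    by (rule lin_ext_superset) (use K keys_add[of f g] in auto)
  also have "\<dots> = (\<Oplus>\<^bsub>B\<^esub>x\<in>?K. Poly_Mapping.lookup f x \<odot>\<^bsub>B\<^esub> h x \<oplus>\<^bsub>B\<^esub> Poly_Mapping.lookup g x \<odot>\<^bsub>B\<^esub> h x)"
    by (rule B.finsum_cong') (use K h in \<open>auto simp: lookup_add B.smult_add_scalar subset_iff\<close>)
  also have "\<dots> = (\<Oplus>\<^bsub>B\<^esub>x\<in>?K. Poly_Mapping.lookup f x \<odot>\<^bsub>B\<^esub> h x) \<oplus>\<^bsub>B\<^esub> (\<Oplus>\<^bsub>B\<^esub>x\<in>?K. Poly_Mapping.lookup g x \<odot>\<^bsub>B\<^esub> h x)"
    by (rule B.finsum_addf) (use K h in \<open>auto simp: subset_iff\<close>)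
  also have "\<dots> = lin_ext B h f \<oplus>\<^bsub>B\<^esub> lin_ext B h g"
    using K lin_ext_superset[of ?K f] lin_ext_superset[of ?K g] by simp
  finally show ?thesis .
qed

lemma lin_ext_linear: "linear_on CM B (lin_ext B h)"
proof (rule linear_onI)
  show "lin_ext B h (c \<odot>\<^bsub>CM\<^esub> f) = c \<odot>\<^bsub>B\<^esub> lin_ext B h f" if "f \<in> carrier CM" for c f
    using that
  proof (induction f rule: CM_induct)
    case (add f g)
    then show ?case
      using star_alg_ring.smult_cl[OF star_alg_ringI[OF star_algebra_CM], of _ c]
      by (simp add: CM_simps(5) scale_add lin_ext_add lin_ext_closed B.smult_add_vector)
  qed (auto simp: CM_simps(5) CM_calc lin_ext_zero lin_ext_single B.smult_smult h)
qed (simp_all add: lin_ext_closed lin_ext_add CM_simps(4))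

text \<open>Multiplicativity, unit and involution can be checked on the monoid.  This serves twice: for words in the generators
  of the free algebra and for pairs in the construction of the tensor product.\<close>

lemma lin_ext_hom:
  assumes one: "h \<one> = \<one>\<^bsub>B\<^esub>"
    and mult: "\<And>x y. x \<in> carrier M \<Longrightarrow> y \<in> carrier M \<Longrightarrow> h (x \<otimes> y) = h x \<otimes>\<^bsub>B\<^esub> h y"
    and star: "\<And>x. x \<in> carrier M \<Longrightarrow> h (st x) = adj B (h x)"
  shows "unital_star_hom CM B (lin_ext B h)"
proof (rule unital_star_homI[OF lin_ext_linear])
  show "lin_ext B h (f \<otimes>\<^bsub>CM\<^esub> g) = lin_ext B h f \<otimes>\<^bsub>B\<^esub> lin_ext B h g"
    if "f \<in> carrier CM" "g \<in> carrier CM" for f g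
    using that
  proof (induction f rule: CM_induct)
    case (single x a)
    show ?case using single(2,1)
    proof (induction g rule: CM_induct)
      case (add f g)
      then show ?case using h by (simp add: CM_calc lin_ext_add CM_mult_closed CM_single_closed lin_ext_closed B.r_distr)
    next
      case (single y b)
      then show ?case using h by (simp add: CM_calc lin_ext_single mult B.smult_mult_l B.smult_mult_r B.smult_smult mult.commute)
    qed (use h in \<open>auto simp: CM_calc lin_ext_zero lin_ext_single\<close>)
  qed (simp_all add: CM_calc lin_ext_add lin_ext_zero lin_ext_closed CM_mult_closed B.l_distr)
  show "lin_ext B h \<one>\<^bsub>CM\<^esub> = \<one>\<^bsub>B\<^esub>"
    by (simp add: CM_simps lin_ext_single one)
  show "lin_ext B h (adj CM f) = adj B (lin_ext B h f)" if "f \<in> carrier CM" for f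
    using that
  proof (induction f rule: CM_induct)
    case (add f g)
    then show ?case by (simp add: CM_adj_add lin_ext_add CM_adj_closed B.adj_add lin_ext_closed)
  next
    case (single x a)
    then show ?case by (simp add: CM_adj_single lin_ext_single st_closed star h B.adj_smult)
  qed (simp add: CM_calc lin_ext_zero)
qed

text \<open>On a coset of a set of zeros of the linear extension, the extension is constant, so that the choice
  made by \<^const>\<open>the_elem\<close> is forced.\<close>

lemma induced_coset:
  assumes "N \<subseteq> carrier CM" "\<zero>\<^bsub>CM\<^esub> \<in> N" "\<And>n. n \<in> N \<Longrightarrow> lin_ext B h n = \<zero>\<^bsub>B\<^esub>" "f \<in> carrier CM"
  shows "induced B h (N +>\<^bsub>CM\<^esub> f) = lin_ext B h f"
proof -
  have coset: "N +>\<^bsub>CM\<^esub> f = (\<lambda>n. n + f) ` N" by (auto simp: a_r_coset_def' CM_simps(4))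
  have "lin_ext B h (n + f) = lin_ext B h f" if "n \<in> N" for n
  proof -
    have "lin_ext B h (n + f) = lin_ext B h n \<oplus>\<^bsub>B\<^esub> lin_ext B h f"
      using that assms(1,4) by (intro lin_ext_add) auto
    then show ?thesis using assms(3)[OF that] lin_ext_closed[OF assms(4)] by simp
  qed
  moreover have "N \<noteq> {}" using assms(2) by blast
  ultimately have "lin_ext B h ` (N +>\<^bsub>CM\<^esub> f) = {lin_ext B h f}"
    unfolding coset image_image by (simp add: image_constant_conv)
  then show ?thesis by (simp add: induced_def)
qed

end
end

section \<open>Tensor products\<close>

definition bilinear_on ::
    "('a, 'm) star_alg_scheme \<Rightarrow> ('b, 'n) star_alg_scheme \<Rightarrow> ('c, 'k) star_alg_scheme \<Rightarrow>
     ('a \<Rightarrow> 'b \<Rightarrow> 'c) \<Rightarrow> bool" where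
  "bilinear_on A B C h \<longleftrightarrow>
     (\<forall>b\<in>carrier B. linear_on A C (\<lambda>a. h a b)) \<and> (\<forall>a\<in>carrier A. linear_on B C (h a))"

lemma bilinear_onI:
  assumes "\<And>b. b \<in> carrier B \<Longrightarrow> linear_on A C (\<lambda>a. h a b)" "\<And>a. a \<in> carrier A \<Longrightarrow> linear_on B C (\<lambda>b. h a b)"
  shows "bilinear_on A B C h"
  using assms by (auto simp: bilinear_on_def)

lemma
  assumes "bilinear_on A B C h"
  shows bilinear_left: "b \<in> carrier B \<Longrightarrow> linear_on A C (\<lambda>a. h a b)"
    and bilinear_right: "a \<in> carrier A \<Longrightarrow> linear_on B C (\<lambda>b. h a b)"
    and bilinear_closed: "a \<in> carrier A \<Longrightarrow> b \<in> carrier B \<Longrightarrow> h a b \<in> carrier C"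
  using assms by (auto simp: bilinear_on_def linear_on_def)

context
  fixes A :: "('a, 'm) star_alg_scheme" and B :: "('b, 'n) star_alg_scheme"
  assumes A: "star_algebra A" and B: "star_algebra B"
begin

interpretation A: star_alg_ring A by (rule star_alg_ringI[OF A])
interpretation B: star_alg_ring B by (rule star_alg_ringI[OF B])

private abbreviation (input) "P \<equiv> pair_alg A B"
private abbreviation (input) "N \<equiv> tensor_null A B"
private abbreviation (input) "T \<equiv> tensor_alg A B"
private abbreviation (input) "sg \<equiv> Poly_Mapping.single"

private lemma pair_monoid: "monoid_involution (A \<times>\<times> B) (map_prod (adj A) (adj B))"
  unfolding monoid_involution_def monoid_involution_axioms_def
  using DirProd_monoid[OF A.monoid_axioms B.monoid_axioms]
  by (auto simp: DirProd_def A.adj_adj B.adj_adj A.adj_mult B.adj_mult)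

interpretation M: monoid_involution "A \<times>\<times> B" "map_prod (adj A) (adj B)"
  by (rule pair_monoid)

private lemma P: "star_algebra P" unfolding pair_alg_def by (rule M.star_algebra_CM)

interpretation P: star_alg_ring P by (rule star_alg_ringI[OF P])

private lemmas P_simps = M.CM_simps[folded pair_alg_def]
private lemmas P_calc = M.CM_calc[folded pair_alg_def]

private lemma pair_carrier: "(a, b) \<in> carrier (A \<times>\<times> B) \<longleftrightarrow> a \<in> carrier A \<and> b \<in> carrier B"
  by (simp add: DirProd_def)

private lemma pair_mult: "(a, b) \<otimes>\<^bsub>A \<times>\<times> B\<^esub> (a', b') = (a \<otimes>\<^bsub>A\<^esub> a', b \<otimes>\<^bsub>B\<^esub> b')"
  by (simp add: DirProd_def)

private lemma P_single: "a \<in> carrier A \<Longrightarrow> b \<in> carrier B \<Longrightarrow> sg (a, b) c \<in> carrier P"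
  by (simp add: P_simps)

private lemma P_add: "x \<in> carrier P \<Longrightarrow> y \<in> carrier P \<Longrightarrow> x + y \<in> carrier P"
  using M.CM_add_closed by (simp add: pair_alg_def)

text \<open>Written without subtraction, the relators match the induction rule for formal linear combinations, which knows
  only sums.\<close>

private lemma bilinear_relators_alt: "bilinear_relators A B =
     {sg (a \<oplus>\<^bsub>A\<^esub> a', b) 1 + sg (a, b) (-1) + sg (a', b) (-1) | a a' b.
        a \<in> carrier A \<and> a' \<in> carrier A \<and> b \<in> carrier B} \<union>
     {sg (a, b \<oplus>\<^bsub>B\<^esub> b') 1 + sg (a, b) (-1) + sg (a, b') (-1) | a b b'.
        a \<in> carrier A \<and> b \<in> carrier B \<and> b' \<in> carrier B} \<union>
     {sg (c \<odot>\<^bsub>A\<^esub> a, b) 1 + sg (a, b) (-c) | c a b. a \<in> carrier A \<and> b \<in> carrier B} \<union>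
     {sg (a, c \<odot>\<^bsub>B\<^esub> b) 1 + sg (a, b) (-c) | c a b. a \<in> carrier A \<and> b \<in> carrier B}"
  unfolding bilinear_relators_def Let_def by (simp add: single_uminus)

private lemma bilinear_relators_closed: "bilinear_relators A B \<subseteq> carrier P"
  unfolding bilinear_relators_alt by (auto intro!: P_add P_single)

private lemma N_subspace: "linear_subspace P N"
  and N_relators: "bilinear_relators A B \<subseteq> N"
  and N_least: "\<And>K. linear_subspace P K \<Longrightarrow> bilinear_relators A B \<subseteq> K \<Longrightarrow> N \<subseteq> K"
  unfolding tensor_null_def using lin_span_subspace[OF P bilinear_relators_closed] by auto

private lemma N_add: "x \<in> N \<Longrightarrow> y \<in> N \<Longrightarrow> x + y \<in> N"
  using N_subspace by (auto simp: linear_subspace_def P_simps)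

private lemma N_scale: "x \<in> N \<Longrightarrow> Poly_Mapping.map ((*) c) x \<in> N"
  using N_subspace by (auto simp: linear_subspace_def P_simps)

private lemma N_zero: "0 \<in> N"
  using N_subspace by (auto simp: linear_subspace_def P_simps)

private lemma N_closed: "x \<in> N \<Longrightarrow> x \<in> carrier P"
  using N_subspace by (auto simp: linear_subspace_def)

text \<open>Multiples of the relators, with an arbitrary coefficient.  In this form the relators are stable under multiplication
  by \<open>sg (p, q) k\<close> from either side.\<close>

private lemma N_rel:
  assumes "a \<in> carrier A" "a' \<in> carrier A" "b \<in> carrier B" "b' \<in> carrier B"
  shows "sg (a \<oplus>\<^bsub>A\<^esub> a', b) c + sg (a, b) (-c) + sg (a', b) (-c) \<in> N"
    and "sg (a, b \<oplus>\<^bsub>B\<^esub> b') c + sg (a, b) (-c) + sg (a, b') (-c) \<in> N"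
    and "sg (d \<odot>\<^bsub>A\<^esub> a, b) c + sg (a, b) (-(d * c)) \<in> N"
    and "sg (a, d \<odot>\<^bsub>B\<^esub> b) c + sg (a, b) (-(d * c)) \<in> N"
proof -
  have "sg (a \<oplus>\<^bsub>A\<^esub> a', b) 1 + sg (a, b) (-1) + sg (a', b) (-1) \<in> N"
    by (rule subsetD[OF N_relators], unfold bilinear_relators_alt, rule UnI1, rule UnI1, rule UnI1,
      intro CollectI exI conjI, rule refl) (use assms in auto)
  from N_scale[OF this, of c]
  show "sg (a \<oplus>\<^bsub>A\<^esub> a', b) c + sg (a, b) (-c) + sg (a', b) (-c) \<in> N"
    by (simp add: scale_add scale_single)
  have "sg (a, b \<oplus>\<^bsub>B\<^esub> b') 1 + sg (a, b) (-1) + sg (a, b') (-1) \<in> N"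
    by (rule subsetD[OF N_relators], unfold bilinear_relators_alt, rule UnI1, rule UnI1, rule UnI2,
      intro CollectI exI conjI, rule refl) (use assms in auto)
  from N_scale[OF this, of c]
  show "sg (a, b \<oplus>\<^bsub>B\<^esub> b') c + sg (a, b) (-c) + sg (a, b') (-c) \<in> N"
    by (simp add: scale_add scale_single)
  have "sg (d \<odot>\<^bsub>A\<^esub> a, b) 1 + sg (a, b) (-d) \<in> N"
    by (rule subsetD[OF N_relators], unfold bilinear_relators_alt, rule UnI1, rule UnI2,
      intro CollectI exI conjI, rule refl) (use assms in auto)
  from N_scale[OF this, of c]
  show "sg (d \<odot>\<^bsub>A\<^esub> a, b) c + sg (a, b) (-(d * c)) \<in> N"
    by (simp add: scale_add scale_single mult.commute)
  have "sg (a, d \<odot>\<^bsub>B\<^esub> b) 1 + sg (a, b) (-d) \<in> N"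
    by (rule subsetD[OF N_relators], unfold bilinear_relators_alt, rule UnI2,
      intro CollectI exI conjI, rule refl) (use assms in auto)
  from N_scale[OF this, of c]
  show "sg (a, d \<odot>\<^bsub>B\<^esub> b) c + sg (a, b) (-(d * c)) \<in> N"
    by (simp add: scale_add scale_single mult.commute)
qed

private lemma N_induct [consumes 1, case_names zero add scale add_left add_right smult_left smult_right]:
  assumes "x \<in> N" "Q 0" "\<And>x y. x \<in> N \<Longrightarrow> y \<in> N \<Longrightarrow> Q x \<Longrightarrow> Q y \<Longrightarrow> Q (x + y)"
    and "\<And>c x. x \<in> N \<Longrightarrow> Q x \<Longrightarrow> Q (Poly_Mapping.map ((*) c) x)"
    and "\<And>a a' b. a \<in> carrier A \<Longrightarrow> a' \<in> carrier A \<Longrightarrow> b \<in> carrier B \<Longrightarrow>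
       Q (sg (a \<oplus>\<^bsub>A\<^esub> a', b) 1 + sg (a, b) (-1) + sg (a', b) (-1))"
    and "\<And>a b b'. a \<in> carrier A \<Longrightarrow> b \<in> carrier B \<Longrightarrow> b' \<in> carrier B \<Longrightarrow>
       Q (sg (a, b \<oplus>\<^bsub>B\<^esub> b') 1 + sg (a, b) (-1) + sg (a, b') (-1))"
    and "\<And>c a b. a \<in> carrier A \<Longrightarrow> b \<in> carrier B \<Longrightarrow> Q (sg (c \<odot>\<^bsub>A\<^esub> a, b) 1 + sg (a, b) (-c))"
    and "\<And>c a b. a \<in> carrier A \<Longrightarrow> b \<in> carrier B \<Longrightarrow> Q (sg (a, c \<odot>\<^bsub>B\<^esub> b) 1 + sg (a, b) (-c))"
  shows "Q x"
proof -
  have "linear_subspace P {x \<in> N. Q x}"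
    by (rule linear_subspaceI)
       (use assms(2-4) N_closed N_zero N_add N_scale in \<open>auto simp: P_simps(3,4,5)\<close>)
  moreover have "bilinear_relators A B \<subseteq> {x. Q x}"
    using assms(5-8) unfolding bilinear_relators_alt by auto
  then have "bilinear_relators A B \<subseteq> {x \<in> N. Q x}" using N_relators by blast
  ultimately show ?thesis using N_least assms(1) by blast
qed

text \<open>The span of the relators is an ideal: a product of a basis element and a relator is again a multiple of a relator,
  since multiplication in each factor is bilinear.  The involution permutes the relators up to conjugation of
  the scalars.\<close>

private lemma N_star_ideal: "star_ideal P N"
proof -
  have adj: "adj P x \<in> N" if "x \<in> N" for x
    using that
  proof (induction x rule: N_induct)
    case (scale c x)
    then show ?case using N_scale[of "adj P x" "cnj c"] P.adj_smult[OF N_closed, of x c]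
      by (simp add: P_simps)
  next
    case (add_left a a' b)
    then show ?case using N_rel(1)[of "adj A a" "adj A a'" "adj B b" "adj B b" 1]
      by (simp add: P_calc A.adj_add)
  next
    case (add_right a b b')
    then show ?case using N_rel(2)[of "adj A a" "adj A a" "adj B b" "adj B b'" 1]
      by (simp add: P_calc B.adj_add)
  next
    case (smult_left c a b)
    then show ?case using N_rel(3)[of "adj A a" "adj A a" "adj B b" "adj B b" "cnj c" 1]
      by (simp add: P_calc A.adj_smult)
  next
    case (smult_right c a b)
    then show ?case using N_rel(4)[of "adj A a" "adj A a" "adj B b" "adj B b" "cnj c" 1]
      by (simp add: P_calc B.adj_smult)
  qed (auto simp: P_calc N_zero N_add)
  have single: "sg (p, q) k \<otimes>\<^bsub>P\<^esub> x \<in> N \<and> x \<otimes>\<^bsub>P\<^esub> sg (p, q) k \<in> N"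
    if "x \<in> N" and pq: "p \<in> carrier A" "q \<in> carrier B" for x p q k
    using that(1)
  proof (induction x rule: N_induct)
    case (scale c x)
    then show ?case using N_scale[of _ c] P.smult_mult_l[OF N_closed[of x] P_single[OF pq], of c]
      P.smult_mult_r[OF P_single[OF pq] N_closed[of x], of _ c]
      by (simp add: P_simps)
  next
    case (add_left a a' b)
    then show ?case using pq N_rel(1)[of "p \<otimes>\<^bsub>A\<^esub> a" "p \<otimes>\<^bsub>A\<^esub> a'" "q \<otimes>\<^bsub>B\<^esub> b" "q \<otimes>\<^bsub>B\<^esub> b" k]
       N_rel(1)[of "a \<otimes>\<^bsub>A\<^esub> p" "a' \<otimes>\<^bsub>A\<^esub> p" "b \<otimes>\<^bsub>B\<^esub> q" "b \<otimes>\<^bsub>B\<^esub> q" k]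
      by (simp add: P_calc pair_mult A.l_distr A.r_distr)
  next
    case (add_right a b b')
    then show ?case using pq N_rel(2)[of "p \<otimes>\<^bsub>A\<^esub> a" "p \<otimes>\<^bsub>A\<^esub> a" "q \<otimes>\<^bsub>B\<^esub> b" "q \<otimes>\<^bsub>B\<^esub> b'" k]
       N_rel(2)[of "a \<otimes>\<^bsub>A\<^esub> p" "a \<otimes>\<^bsub>A\<^esub> p" "b \<otimes>\<^bsub>B\<^esub> q" "b' \<otimes>\<^bsub>B\<^esub> q" k]
      by (simp add: P_calc pair_mult B.l_distr B.r_distr)
  next
    case (smult_left c a b)
    then show ?case using pq N_rel(3)[of "p \<otimes>\<^bsub>A\<^esub> a" "p \<otimes>\<^bsub>A\<^esub> a" "q \<otimes>\<^bsub>B\<^esub> b" "q \<otimes>\<^bsub>B\<^esub> b" c k]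
       N_rel(3)[of "a \<otimes>\<^bsub>A\<^esub> p" "a \<otimes>\<^bsub>A\<^esub> p" "b \<otimes>\<^bsub>B\<^esub> q" "b \<otimes>\<^bsub>B\<^esub> q" c k]
      by (simp add: P_calc pair_mult A.smult_mult_l A.smult_mult_r mult.commute)
  next
    case (smult_right c a b)
    then show ?case using pq N_rel(4)[of "p \<otimes>\<^bsub>A\<^esub> a" "p \<otimes>\<^bsub>A\<^esub> a" "q \<otimes>\<^bsub>B\<^esub> b" "q \<otimes>\<^bsub>B\<^esub> b" c k]
       N_rel(4)[of "a \<otimes>\<^bsub>A\<^esub> p" "a \<otimes>\<^bsub>A\<^esub> p" "b \<otimes>\<^bsub>B\<^esub> q" "b \<otimes>\<^bsub>B\<^esub> q" c k]
      by (simp add: P_calc pair_mult B.smult_mult_l B.smult_mult_r mult.commute)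
  qed (auto simp: P_calc N_zero N_add)
  have "y \<otimes>\<^bsub>P\<^esub> x \<in> N \<and> x \<otimes>\<^bsub>P\<^esub> y \<in> N" if x: "x \<in> N" and y: "y \<in> carrier P" for x y
    using y unfolding pair_alg_def
    by (induction y rule: M.CM_induct)
       (use single[OF x] in \<open>auto simp: M.CM_calc N_zero N_add pair_alg_def pair_carrier\<close>)
  with adj show ?thesis using N_subspace unfolding star_ideal_def by blast
qed

lemma star_algebra_tensor: "star_algebra T"
  unfolding tensor_alg_def by (rule star_algebra_quot[OF P N_star_ideal])

interpretation T: star_alg_ring T by (rule star_alg_ringI[OF star_algebra_tensor])

private abbreviation (input) "pr \<equiv> \<lambda>x. N +>\<^bsub>P\<^esub> x"

private lemma pr_single:
  assumes "a \<in> carrier A" "b \<in> carrier B"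
  shows "pr (sg (a, b) c) = c \<odot>\<^bsub>T\<^esub> tens A B a b"
  using quot_smult[OF P N_star_ideal P_single[OF assms], of c 1]
  by (simp add: tensor_alg_def tens_def P_simps scale_single)

lemma tens_closed: "a \<in> carrier A \<Longrightarrow> b \<in> carrier B \<Longrightarrow> tens A B a b \<in> carrier T"
  using P_single unfolding tensor_alg_def tens_def quot_carrier[OF P N_star_ideal] by blast

lemma tens_mult:
  assumes "a \<in> carrier A" "b \<in> carrier B" "a' \<in> carrier A" "b' \<in> carrier B"
  shows "tens A B a b \<otimes>\<^bsub>T\<^esub> tens A B a' b' = tens A B (a \<otimes>\<^bsub>A\<^esub> a') (b \<otimes>\<^bsub>B\<^esub> b')"
  using quot_mult[OF P N_star_ideal P_single[OF assms(1,2)] P_single[OF assms(3,4)]]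
  by (simp add: tensor_alg_def tens_def P_calc pair_mult)

lemma tens_adj:
  assumes "a \<in> carrier A" "b \<in> carrier B"
  shows "adj T (tens A B a b) = tens A B (adj A a) (adj B b)"
  using quot_adj[OF P N_star_ideal P_single[OF assms]]
  by (simp add: tensor_alg_def tens_def P_calc)

lemma tens_one: "\<one>\<^bsub>T\<^esub> = tens A B \<one>\<^bsub>A\<^esub> \<one>\<^bsub>B\<^esub>"
  using quot_one[OF P N_star_ideal] by (simp add: tensor_alg_def tens_def P_simps DirProd_def)

private lemma tens_null:
  assumes "x \<in> N"
  shows "pr x = \<zero>\<^bsub>T\<^esub>"
proof -
  have "pr x = pr \<zero>\<^bsub>P\<^esub>"
    using quot_eq_iff[OF P N_star_ideal N_closed[OF assms] P.zero_closed] N_zero N_add[OF assms N_zero]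
    by (simp add: P_simps scale_zero)
  then show ?thesis by (simp add: tensor_alg_def quot_zero[OF P N_star_ideal])
qed

private lemma pr_add: "x \<in> carrier P \<Longrightarrow> y \<in> carrier P \<Longrightarrow> pr (x + y) = pr x \<oplus>\<^bsub>T\<^esub> pr y"
  using quot_add[OF P N_star_ideal] by (simp add: tensor_alg_def P_simps)

private lemma T_cancel:
  assumes "x \<in> carrier T" "y \<in> carrier T" "x \<oplus>\<^bsub>T\<^esub> (-1) \<odot>\<^bsub>T\<^esub> y = \<zero>\<^bsub>T\<^esub>"
  shows "x = y"
  using assms T.diff_zero_iff T.minus_as_smult by simp

lemma bilinear_tens: "bilinear_on A B T (tens A B)"
proof (intro bilinear_onI linear_onI)
  fix a a' b assume *: "b \<in> carrier B" "a \<in> carrier A" "a' \<in> carrier A"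
  have "pr (sg (a \<oplus>\<^bsub>A\<^esub> a', b) 1 + sg (a, b) (-1) + sg (a', b) (-1)) = \<zero>\<^bsub>T\<^esub>"
    using * by (intro tens_null N_rel) auto
  then have "tens A B (a \<oplus>\<^bsub>A\<^esub> a') b \<oplus>\<^bsub>T\<^esub> (-1) \<odot>\<^bsub>T\<^esub> (tens A B a b \<oplus>\<^bsub>T\<^esub> tens A B a' b) = \<zero>\<^bsub>T\<^esub>"
    using * by (simp add: pr_add P_add P_single pr_single tens_closed T.smult_add_vector T.a_assoc)
  then show "tens A B (a \<oplus>\<^bsub>A\<^esub> a') b = tens A B a b \<oplus>\<^bsub>T\<^esub> tens A B a' b"
    using * by - (rule T_cancel, simp_all add: tens_closed)
next
  fix c a b assume *: "b \<in> carrier B" "a \<in> carrier A"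
  have "pr (sg (c \<odot>\<^bsub>A\<^esub> a, b) 1 + sg (a, b) (-(c*1))) = \<zero>\<^bsub>T\<^esub>"
    using * by (intro tens_null N_rel) auto
  then have "tens A B (c \<odot>\<^bsub>A\<^esub> a) b \<oplus>\<^bsub>T\<^esub> (-1) \<odot>\<^bsub>T\<^esub> (c \<odot>\<^bsub>T\<^esub> tens A B a b) = \<zero>\<^bsub>T\<^esub>"
    using * by (simp add: pr_add P_add P_single pr_single tens_closed T.smult_smult)
  then show "tens A B (c \<odot>\<^bsub>A\<^esub> a) b = c \<odot>\<^bsub>T\<^esub> tens A B a b"
    using * by - (rule T_cancel, simp_all add: tens_closed)
next
  fix a b b' assume *: "a \<in> carrier A" "b \<in> carrier B" "b' \<in> carrier B"
  have "pr (sg (a, b \<oplus>\<^bsub>B\<^esub> b') 1 + sg (a, b) (-1) + sg (a, b') (-1)) = \<zero>\<^bsub>T\<^esub>"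
    using * by (intro tens_null N_rel) auto
  then have "tens A B a (b \<oplus>\<^bsub>B\<^esub> b') \<oplus>\<^bsub>T\<^esub> (-1) \<odot>\<^bsub>T\<^esub> (tens A B a b \<oplus>\<^bsub>T\<^esub> tens A B a b') = \<zero>\<^bsub>T\<^esub>"
    using * by (simp add: pr_add P_add P_single pr_single tens_closed T.smult_add_vector T.a_assoc)
  then show "tens A B a (b \<oplus>\<^bsub>B\<^esub> b') = tens A B a b \<oplus>\<^bsub>T\<^esub> tens A B a b'"
    using * by - (rule T_cancel, simp_all add: tens_closed)
next
  fix c a b assume *: "a \<in> carrier A" "b \<in> carrier B"
  have "pr (sg (a, c \<odot>\<^bsub>B\<^esub> b) 1 + sg (a, b) (-(c*1))) = \<zero>\<^bsub>T\<^esub>"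
    using * by (intro tens_null N_rel) auto
  then have "tens A B a (c \<odot>\<^bsub>B\<^esub> b) \<oplus>\<^bsub>T\<^esub> (-1) \<odot>\<^bsub>T\<^esub> (c \<odot>\<^bsub>T\<^esub> tens A B a b) = \<zero>\<^bsub>T\<^esub>"
    using * by (simp add: pr_add P_add P_single pr_single tens_closed T.smult_smult)
  then show "tens A B a (c \<odot>\<^bsub>B\<^esub> b) = c \<odot>\<^bsub>T\<^esub> tens A B a b"
    using * by - (rule T_cancel, simp_all add: tens_closed)
qed (simp_all add: tens_closed)

text \<open>Every tensor is a finite sum of elementary tensors; a scalar coefficient can be absorbed into the first factor.\<close>

lemma tensor_induct [consumes 1, case_names tens add]:
  assumes "t \<in> carrier T"
    and "\<And>a b. a \<in> carrier A \<Longrightarrow> b \<in> carrier B \<Longrightarrow> Q (tens A B a b)"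
    and "\<And>s t. s \<in> carrier T \<Longrightarrow> t \<in> carrier T \<Longrightarrow> Q s \<Longrightarrow> Q t \<Longrightarrow> Q (s \<oplus>\<^bsub>T\<^esub> t)"
  shows "Q t"
proof -
  have sgQ: "Q (pr (sg (a, b) c))" if "a \<in> carrier A" "b \<in> carrier B" for a b c
    using assms(2)[of "c \<odot>\<^bsub>A\<^esub> a" b] that linear_smult[OF bilinear_left[OF bilinear_tens, of b], of a c]
    by (simp add: pr_single)
  have "Q (pr f)" if "f \<in> carrier P" for f
    using that[unfolded pair_alg_def]
  proof (induction f rule: M.CM_induct)
    case zero
    have "sg (\<zero>\<^bsub>A\<^esub>, \<zero>\<^bsub>B\<^esub>) 0 = (0 :: ('a \<times> 'b) \<Rightarrow>\<^sub>0 complex)" by simp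
    then show ?case using sgQ[of "\<zero>\<^bsub>A\<^esub>" "\<zero>\<^bsub>B\<^esub>" 0] by simp
  next
    case (add f g)
    then have fg: "f \<in> carrier P" "g \<in> carrier P" by (simp_all add: pair_alg_def)
    have cl: "pr f \<in> carrier T" "pr g \<in> carrier T"
      using fg unfolding tensor_alg_def quot_carrier[OF P N_star_ideal] by blast+
    show ?case using assms(3)[OF cl add(3,4)] by (simp add: pr_add[OF fg])
  qed (auto simp: pair_carrier sgQ)
  then show ?thesis
    using assms(1) unfolding tensor_alg_def quot_carrier[OF P N_star_ideal] by blast
qed

text \<open>The universal property of the tensor product.  The linear extension of a bilinear map vanishes on the
  relators, hence on their span.\<close>

lemma
  assumes C: "star_algebra C" and h: "bilinear_on A B C h"
  shows tensor_lift_linear: "linear_on T C (induced C (\<lambda>(a, b). h a b))"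
    and tensor_lift_tens: "a \<in> carrier A \<Longrightarrow> b \<in> carrier B \<Longrightarrow> induced C (\<lambda>(a, b). h a b) (tens A B a b) = h a b"
proof -
  interpret C: star_alg_ring C by (rule star_alg_ringI[OF C])
  let ?h = "\<lambda>(a, b). h a b"
  let ?L = "lin_ext C ?h"
  have cl: "?h x \<in> carrier C" if "x \<in> carrier (A \<times>\<times> B)" for x
    using that bilinear_closed[OF h] by (cases x) (simp add: pair_carrier)
  have lin: "linear_on P C ?L" unfolding pair_alg_def by (rule M.lin_ext_linear[OF C]) (rule cl)
  have single: "?L (sg (a, b) c) = c \<odot>\<^bsub>C\<^esub> h a b" if "a \<in> carrier A" "b \<in> carrier B" for a b c
    by (subst M.lin_ext_single[OF C]) (use cl that in \<open>auto simp: pair_carrier\<close>)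
  have add: "?L (x + y) = ?L x \<oplus>\<^bsub>C\<^esub> ?L y" if "x \<in> carrier P" "y \<in> carrier P" for x y
    using linear_add[OF lin that] by (simp add: P_simps)
  have neg1: "x \<oplus>\<^bsub>C\<^esub> - 1 \<odot>\<^bsub>C\<^esub> x = \<zero>\<^bsub>C\<^esub>" if "x \<in> carrier C" for x
    using that by (simp add: C.smult_minus_one C.r_neg)
  have neg: "x \<oplus>\<^bsub>C\<^esub> y \<oplus>\<^bsub>C\<^esub> - 1 \<odot>\<^bsub>C\<^esub> x \<oplus>\<^bsub>C\<^esub> - 1 \<odot>\<^bsub>C\<^esub> y = \<zero>\<^bsub>C\<^esub>"
    if "x \<in> carrier C" "y \<in> carrier C" for x y
  proof -
    have "(x \<oplus>\<^bsub>C\<^esub> y) \<oplus>\<^bsub>C\<^esub> \<ominus>\<^bsub>C\<^esub> (x \<oplus>\<^bsub>C\<^esub> y) = \<zero>\<^bsub>C\<^esub>" using that by (intro C.r_neg) simp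
    then show "x \<oplus>\<^bsub>C\<^esub> y \<oplus>\<^bsub>C\<^esub> - 1 \<odot>\<^bsub>C\<^esub> x \<oplus>\<^bsub>C\<^esub> - 1 \<odot>\<^bsub>C\<^esub> y = \<zero>\<^bsub>C\<^esub>"
      using that by (simp add: C.smult_minus_one C.minus_add C.a_assoc)
  qed
  have null: "?L n = \<zero>\<^bsub>C\<^esub>" if "n \<in> N" for n
    using that
  proof (induction n rule: N_induct)
    case zero
    then show ?case using linear_zero[OF P C lin] by (simp add: P_simps)
  next
    case (scale c x)
    then show ?case using linear_smult[OF lin N_closed, of x c] by (simp add: P_simps)
  next
    case (add_left a a' b)
    then show ?case
      by (simp add: add P_add P_single single linear_add[OF bilinear_left[OF h]] neg bilinear_closed[OF h])
  next
    case (add_right a b b')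
    then show ?case
      by (simp add: add P_add P_single single linear_add[OF bilinear_right[OF h]] neg bilinear_closed[OF h])
  next
    case (smult_left c a b)
    then show ?case using neg1[of "c \<odot>\<^bsub>C\<^esub> h a b"]
      by (simp add: add P_add P_single single linear_smult[OF bilinear_left[OF h]] bilinear_closed[OF h] C.smult_smult)
  next
    case (smult_right c a b)
    then show ?case using neg1[of "c \<odot>\<^bsub>C\<^esub> h a b"]
      by (simp add: add P_add P_single single linear_smult[OF bilinear_right[OF h]] bilinear_closed[OF h] C.smult_smult)
  qed (simp add: add N_closed)
  have ind: "induced C ?h (pr f) = ?L f" if "f \<in> carrier P" for f
    using that unfolding pair_alg_def
    by (intro M.induced_coset[OF C])
      (use cl null N_closed N_zero in \<open>auto simp: pair_alg_def[symmetric] P_simps(3)\<close>)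
  show "linear_on T C (induced C ?h)"
  proof (rule linear_onI)
    fix x y c assume "x \<in> carrier T"
    then obtain f where f: "f \<in> carrier P" "x = pr f"
      unfolding tensor_alg_def quot_carrier[OF P N_star_ideal] by blast
    show "induced C ?h x \<in> carrier C"
      using f linear_closed[OF lin] by (simp add: ind)
    show "induced C ?h (c \<odot>\<^bsub>T\<^esub> x) = c \<odot>\<^bsub>C\<^esub> induced C ?h x"
      using f quot_smult[OF P N_star_ideal f(1), of c]
      by (simp add: ind tensor_alg_def linear_smult[OF lin])
    assume "y \<in> carrier T"
    then obtain g where g: "g \<in> carrier P" "y = pr g"
      unfolding tensor_alg_def quot_carrier[OF P N_star_ideal] by blast
    show "induced C ?h (x \<oplus>\<^bsub>T\<^esub> y) = induced C ?h x \<oplus>\<^bsub>C\<^esub> induced C ?h y"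
      using f g by (simp add: pr_add[symmetric] ind add P_add)
  qed
  show "induced C ?h (tens A B a b) = h a b" if "a \<in> carrier A" "b \<in> carrier B"
    using that ind[OF P_single[OF that], of 1] bilinear_closed[OF h] by (simp add: tens_def single)
qed

end

section \<open>Maps on tensor products\<close>

lemma finsum_swap:
  assumes "abelian_monoid G" "finite I" "finite J" "\<And>i j. i \<in> I \<Longrightarrow> j \<in> J \<Longrightarrow> f i j \<in> carrier G"
  shows "(\<Oplus>\<^bsub>G\<^esub>i\<in>I. \<Oplus>\<^bsub>G\<^esub>j\<in>J. f i j) = (\<Oplus>\<^bsub>G\<^esub>j\<in>J. \<Oplus>\<^bsub>G\<^esub>i\<in>I. f i j)"
proof -
  interpret G: abelian_monoid G by fact
  show ?thesis using assms(2,4)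
  proof (induction I)
    case empty
    then show ?case by simp
  next
    case (insert i I)
    have "(\<Oplus>\<^bsub>G\<^esub>j\<in>J. \<Oplus>\<^bsub>G\<^esub>i\<in>insert i I. f i j) = (\<Oplus>\<^bsub>G\<^esub>j\<in>J. f i j \<oplus>\<^bsub>G\<^esub> (\<Oplus>\<^bsub>G\<^esub>i\<in>I. f i j))"
      by (rule G.finsum_cong') (use insert in \<open>auto intro!: G.finsum_insert G.finsum_closed\<close>)
    also have "\<dots> = (\<Oplus>\<^bsub>G\<^esub>j\<in>J. f i j) \<oplus>\<^bsub>G\<^esub> (\<Oplus>\<^bsub>G\<^esub>j\<in>J. \<Oplus>\<^bsub>G\<^esub>i\<in>I. f i j)"
      by (rule G.finsum_addf) (use insert in \<open>auto intro!: G.finsum_closed\<close>)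
    also have "\<dots> = (\<Oplus>\<^bsub>G\<^esub>i\<in>insert i I. \<Oplus>\<^bsub>G\<^esub>j\<in>J. f i j)"
      using insert by (subst G.finsum_insert) (auto intro!: G.finsum_closed)
    finally show ?case by simp
  qed
qed

text \<open>A linear map is a homomorphism as soon as it is multiplicative and star-preserving on a set \<open>G\<close> that spans
  additively.  The spanning property is stated as an induction principle, so that iterated tensor products can
  use it with \<open>G\<close> the set of elementary tensors of all levels.\<close>

lemma unital_star_hom_span:
  assumes T: "star_algebra T" and D: "star_algebra D" and F: "linear_on T D F"
    and span: "\<And>x Q. x \<in> carrier T \<Longrightarrow> (\<And>g. g \<in> G \<Longrightarrow> Q g) \<Longrightarrow>
      (\<And>s t. s \<in> carrier T \<Longrightarrow> t \<in> carrier T \<Longrightarrow> Q s \<Longrightarrow> Q t \<Longrightarrow> Q (s \<oplus>\<^bsub>T\<^esub> t)) \<Longrightarrow> Q x"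
    and G: "\<And>g. g \<in> G \<Longrightarrow> g \<in> carrier T"
    and mult: "\<And>x y. x \<in> G \<Longrightarrow> y \<in> G \<Longrightarrow> F (x \<otimes>\<^bsub>T\<^esub> y) = F x \<otimes>\<^bsub>D\<^esub> F y"
    and star: "\<And>x. x \<in> G \<Longrightarrow> F (adj T x) = adj D (F x)"
    and one: "F \<one>\<^bsub>T\<^esub> = \<one>\<^bsub>D\<^esub>"
  shows "unital_star_hom T D F"
proof -
  interpret T: star_alg_ring T by (rule star_alg_ringI[OF T])
  interpret D: star_alg_ring D by (rule star_alg_ringI[OF D])
  note cl = linear_closed[OF F]
  have 1: "F (x \<otimes>\<^bsub>T\<^esub> y) = F x \<otimes>\<^bsub>D\<^esub> F y" if "x \<in> carrier T" "y \<in> G" for x y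
    by (rule span[OF that(1)])
       (use that(2) G in \<open>auto simp: mult T.l_distr D.l_distr linear_add[OF F] cl\<close>)
  have 2: "F (x \<otimes>\<^bsub>T\<^esub> y) = F x \<otimes>\<^bsub>D\<^esub> F y" if "x \<in> carrier T" "y \<in> carrier T" for x y
    by (rule span[OF that(2)])
       (use that(1) 1 in \<open>auto simp: T.r_distr D.r_distr linear_add[OF F] cl\<close>)
  have 3: "F (adj T x) = adj D (F x)" if "x \<in> carrier T" for x
    by (rule span[OF that]) (auto simp: star T.adj_add D.adj_add linear_add[OF F] cl)
  show ?thesis by (rule unital_star_homI[OF F 2 one 3])
qed

context
  fixes A :: "('a, 'm) star_alg_scheme" and B :: "('b, 'n) star_alg_scheme"
  assumes A: "star_algebra A" and B: "star_algebra B"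
begin

lemma tensor_eqI:
  assumes "linear_on (tensor_alg A B) C f" "linear_on (tensor_alg A B) C g"
    and "\<And>a b. a \<in> carrier A \<Longrightarrow> b \<in> carrier B \<Longrightarrow> f (tens A B a b) = g (tens A B a b)"
    and "t \<in> carrier (tensor_alg A B)"
  shows "f t = g t"
  using assms(4)
  by (induction t rule: tensor_induct[OF A B, consumes 1, case_names tens add])
     (simp_all add: assms(3) linear_add[OF assms(1)] linear_add[OF assms(2)])

lemma tens_finsum_left:
  assumes "finite I" "\<And>i. i \<in> I \<Longrightarrow> f i \<in> carrier A" "b \<in> carrier B"
  shows "tens A B (\<Oplus>\<^bsub>A\<^esub>i\<in>I. f i) b = (\<Oplus>\<^bsub>tensor_alg A B\<^esub>i\<in>I. tens A B (f i) b)"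
  using linear_finsum[OF A star_algebra_tensor[OF A B] bilinear_left[OF bilinear_tens[OF A B]]] assms
  by blast

lemma tens_finsum_right:
  assumes "finite I" "\<And>i. i \<in> I \<Longrightarrow> f i \<in> carrier B" "a \<in> carrier A"
  shows "tens A B a (\<Oplus>\<^bsub>B\<^esub>i\<in>I. f i) = (\<Oplus>\<^bsub>tensor_alg A B\<^esub>i\<in>I. tens A B a (f i))"
  using linear_finsum[OF B star_algebra_tensor[OF A B] bilinear_right[OF bilinear_tens[OF A B]]] assms
  by blast

lemma tensor_lift_hom:
  assumes C: "star_algebra C" and h: "bilinear_on A B C h"
    and mult: "\<And>a a' b b'. a \<in> carrier A \<Longrightarrow> a' \<in> carrier A \<Longrightarrow> b \<in> carrier B \<Longrightarrow> b' \<in> carrier B \<Longrightarrow>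
      h (a \<otimes>\<^bsub>A\<^esub> a') (b \<otimes>\<^bsub>B\<^esub> b') = h a b \<otimes>\<^bsub>C\<^esub> h a' b'"
    and star: "\<And>a b. a \<in> carrier A \<Longrightarrow> b \<in> carrier B \<Longrightarrow> h (adj A a) (adj B b) = adj C (h a b)"
    and one: "h \<one>\<^bsub>A\<^esub> \<one>\<^bsub>B\<^esub> = \<one>\<^bsub>C\<^esub>"
  shows "unital_star_hom (tensor_alg A B) C (induced C (\<lambda>(a, b). h a b))"
proof -
  interpret A: star_alg_ring A by (rule star_alg_ringI[OF A])
  interpret B: star_alg_ring B by (rule star_alg_ringI[OF B])
  let ?G = "{tens A B a b | a b. a \<in> carrier A \<and> b \<in> carrier B}"
  note tv = tensor_lift_tens[OF A B C h]
  show ?thesis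
  proof (rule unital_star_hom_span[where G = ?G, OF star_algebra_tensor[OF A B] C tensor_lift_linear[OF A B C h]])
    fix x Q assume x: "x \<in> carrier (tensor_alg A B)" and g: "\<And>g. g \<in> ?G \<Longrightarrow> Q g"
      and add: "\<And>s t. s \<in> carrier (tensor_alg A B) \<Longrightarrow> t \<in> carrier (tensor_alg A B) \<Longrightarrow> Q s \<Longrightarrow> Q t \<Longrightarrow>
        Q (s \<oplus>\<^bsub>tensor_alg A B\<^esub> t)"
    show "Q x"
      using x
    proof (induction x rule: tensor_induct[OF A B, consumes 1, case_names tens add])
      case (tens a b)
      then show ?case by (intro g) blast
    qed (rule add)
  qed (auto simp: tens_closed[OF A B] tens_mult[OF A B] tens_adj[OF A B] tens_one[OF A B] tv mult star one)
qed

lemma bilinear_mult: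
  assumes C: "star_algebra C" and f: "linear_on A C f" and g: "linear_on B C g"
  shows "bilinear_on A B C (\<lambda>a b. f a \<otimes>\<^bsub>C\<^esub> g b)"
proof -
  interpret C: star_alg_ring C by (rule star_alg_ringI[OF C])
  show ?thesis
    by (intro bilinear_onI linear_onI)
       (auto simp: linear_closed[OF f] linear_closed[OF g] linear_add[OF f] linear_add[OF g]
         linear_smult[OF f] linear_smult[OF g] C.l_distr C.r_distr C.smult_mult_l C.smult_mult_r)
qed

lemma bilinear_smult:
  assumes C: "star_algebra C" and f: "linear_on A cplx f" and g: "linear_on B C g"
  shows "bilinear_on A B C (\<lambda>a b. f a \<odot>\<^bsub>C\<^esub> g b)"
proof -
  interpret C: star_alg_ring C by (rule star_alg_ringI[OF C])
  show ?thesis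
    by (intro bilinear_onI linear_onI)
       (auto simp: linear_closed[OF g] linear_add[OF f] linear_add[OF g]
         linear_smult[OF f] linear_smult[OF g] C.smult_add_scalar C.smult_add_vector C.smult_smult mult.commute)
qed

lemma bilinear_swap: "bilinear_on A B C h \<Longrightarrow> bilinear_on B A C (\<lambda>b a. h a b)"
  by (simp add: bilinear_on_def)

lemma bilinear_compose:
  "bilinear_on C D E h \<Longrightarrow> linear_on A C f \<Longrightarrow> linear_on B D g \<Longrightarrow> bilinear_on A B E (\<lambda>a b. h (f a) (g b))"
  by (auto simp: bilinear_on_def linear_on_def Pi_iff)

end

context
  fixes A :: "('a, 'm) star_alg_scheme" and B :: "('b, 'n) star_alg_scheme"
    and C :: "('c, 'k) star_alg_scheme" and D :: "('d, 'l) star_alg_scheme"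
  assumes A: "star_algebra A" and B: "star_algebra B" and C: "star_algebra C" and D: "star_algebra D"
begin

lemma tensor_map_bilinear:
  assumes "linear_on A C f" "linear_on B D g"
  shows "bilinear_on A B (tensor_alg C D) (\<lambda>a b. tens C D (f a) (g b))"
  by (rule bilinear_compose[OF A B bilinear_tens[OF C D] assms])

lemma tensor_map_linear:
  assumes "linear_on A C f" "linear_on B D g"
  shows "linear_on (tensor_alg A B) (tensor_alg C D) (tensor_map C D f g)"
  unfolding tensor_map_def
  by (rule tensor_lift_linear[OF A B star_algebra_tensor[OF C D] tensor_map_bilinear[OF assms]])

lemma tensor_map_tens:
  assumes "linear_on A C f" "linear_on B D g" "a \<in> carrier A" "b \<in> carrier B"
  shows "tensor_map C D f g (tens A B a b) = tens C D (f a) (g b)"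
  unfolding tensor_map_def
  by (rule tensor_lift_tens[OF A B star_algebra_tensor[OF C D] tensor_map_bilinear[OF assms(1,2)] assms(3,4)])

lemma tensor_map_hom:
  assumes f: "unital_star_hom A C f" and g: "unital_star_hom B D g"
  shows "unital_star_hom (tensor_alg A B) (tensor_alg C D) (tensor_map C D f g)"
  unfolding tensor_map_def
  by (rule tensor_lift_hom[OF A B star_algebra_tensor[OF C D] tensor_map_bilinear[OF hom_linear[OF f] hom_linear[OF g]]])
     (simp_all add: hom_mult[OF f] hom_mult[OF g] hom_closed[OF f] hom_closed[OF g] hom_one[OF f]
       hom_one[OF g] hom_adj[OF f] hom_adj[OF g] tens_mult[OF C D] tens_adj[OF C D] tens_one[OF C D])

end

context
  fixes A :: "('a, 'm) star_alg_scheme" and B :: "('b, 'n) star_alg_scheme"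
    and C :: "('c, 'k) star_alg_scheme"
  assumes A: "star_algebra A" and B: "star_algebra B" and C: "star_algebra C"
begin

private abbreviation (input) "AB \<equiv> tensor_alg A B"
private abbreviation (input) "BC \<equiv> tensor_alg B C"
private abbreviation (input) "ABC \<equiv> tensor_alg A (tensor_alg B C)"

private lemma AB: "star_algebra AB" by (rule star_algebra_tensor[OF A B])
private lemma BC: "star_algebra BC" by (rule star_algebra_tensor[OF B C])
private lemma ABC: "star_algebra ABC" by (rule star_algebra_tensor[OF A BC])

text \<open>The rebracketing map is defined in two stages: for fixed \<open>c\<close> it is bilinear in \<open>a\<close> and \<open>b\<close>, and the
  resulting linear map depends linearly on \<open>c\<close>.\<close>

private lemma assoc_inner:
  "c \<in> carrier C \<Longrightarrow> bilinear_on A B ABC (\<lambda>a b. tens A BC a (tens B C b c))"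
  by (intro bilinear_onI bilinear_left[OF bilinear_tens[OF A BC]] tens_closed[OF B C]
      linear_compose[OF bilinear_left[OF bilinear_tens[OF B C]] bilinear_right[OF bilinear_tens[OF A BC]]])

private abbreviation (input)
  "inner c \<equiv> induced ABC (\<lambda>(a, b). tens A BC a (tens B C b c))"

private lemma assoc_bilinear: "bilinear_on AB C ABC (\<lambda>t c. inner c t)"
proof (rule bilinear_onI)
  fix c assume c: "c \<in> carrier C"
  show "linear_on AB ABC (inner c)"
    by (rule tensor_lift_linear[OF A B ABC assoc_inner[OF c]])
next
  fix t assume t: "t \<in> carrier AB"
  interpret S: star_alg_ring ABC by (rule star_alg_ringI[OF ABC])
  interpret C: star_alg_ring C by (rule star_alg_ringI[OF C])
  note inner = tensor_lift_linear[OF A B ABC assoc_inner]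
  note val = tensor_lift_tens[OF A B ABC assoc_inner]
  note lin = linear_compose[OF bilinear_right[OF bilinear_tens[OF B C]] bilinear_right[OF bilinear_tens[OF A BC]]]
  show "linear_on C ABC (\<lambda>c. inner c t)"
  proof (rule linear_onI)
    fix c d assume cd: "c \<in> carrier C" "d \<in> carrier C"
    show "inner (c \<oplus>\<^bsub>C\<^esub> d) t = inner c t \<oplus>\<^bsub>ABC\<^esub> inner d t"
      using t
    proof (induction t rule: tensor_induct[OF A B, consumes 1, case_names tens add])
      case (tens a b)
      then show ?case using cd by (simp add: val linear_add[OF lin])
    next
      case (add s t)
      then show ?case using cd linear_closed[OF inner] by (simp add: linear_add[OF inner] S.a_ac)
    qed
  next
    fix c k assume c: "c \<in> carrier C"
    show "inner (k \<odot>\<^bsub>C\<^esub> c) t = k \<odot>\<^bsub>ABC\<^esub> inner c t"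
      using t
    proof (induction t rule: tensor_induct[OF A B, consumes 1, case_names tens add])
      case (tens a b)
      then show ?case using c by (simp add: val linear_smult[OF lin])
    next
      case (add s t)
      then show ?case using c linear_closed[OF inner] by (simp add: linear_add[OF inner] S.smult_add_vector)
    qed
  qed (use t linear_closed[OF inner] in blast)
qed

lemma tensor_assoc_linear: "linear_on (tensor_alg AB C) ABC (tensor_assoc A B C)"
  unfolding tensor_assoc_def Let_def
  by (rule tensor_lift_linear[OF AB C ABC assoc_bilinear])

lemma tensor_assoc_tens:
  assumes "a \<in> carrier A" "b \<in> carrier B" "c \<in> carrier C"
  shows "tensor_assoc A B C (tens AB C (tens A B a b) c) = tens A BC a (tens B C b c)"
  using tensor_lift_tens[OF AB C ABC assoc_bilinear tens_closed[OF A B assms(1,2)] assms(3)]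
    tensor_lift_tens[OF A B ABC assoc_inner assms(1,2)] assms(3)
  by (simp add: tensor_assoc_def Let_def)

lemma tensor_assoc_hom: "unital_star_hom (tensor_alg AB C) ABC (tensor_assoc A B C)"
proof -
  interpret A: star_alg_ring A by (rule star_alg_ringI[OF A])
  interpret B: star_alg_ring B by (rule star_alg_ringI[OF B])
  interpret C: star_alg_ring C by (rule star_alg_ringI[OF C])
  interpret ABR: ring AB by (rule star_algebra.ring_A[OF AB])
  let ?G = "{tens AB C (tens A B a b) c | a b c. a \<in> carrier A \<and> b \<in> carrier B \<and> c \<in> carrier C}"
  let ?T = "tensor_alg AB C"
  note cl = tens_closed[OF A B] tens_closed[OF B C] tens_closed[OF AB C] tens_closed[OF A BC]
  show ?thesis
  proof (rule unital_star_hom_span[where G = ?G, OF star_algebra_tensor[OF AB C] ABC tensor_assoc_linear])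
    fix x Q assume x: "x \<in> carrier ?T" and g: "\<And>g. g \<in> ?G \<Longrightarrow> Q g"
      and span_add: "\<And>s t. s \<in> carrier ?T \<Longrightarrow> t \<in> carrier ?T \<Longrightarrow> Q s \<Longrightarrow> Q t \<Longrightarrow> Q (s \<oplus>\<^bsub>?T\<^esub> t)"
    have elem: "Q (tens AB C t c)" if "t \<in> carrier AB" "c \<in> carrier C" for t c
      using that(1)
    proof (induction t rule: tensor_induct[OF A B, consumes 1, case_names tens add])
      case (tens a b)
      then show ?case using g that(2) by blast
    next
      case (add s t)
      have "Q (tens AB C s c \<oplus>\<^bsub>?T\<^esub> tens AB C t c)"
        by (rule span_add) (use add that(2) in \<open>simp_all add: cl\<close>)
      then show ?case
        using add(1,2) that(2) by (simp add: linear_add[OF bilinear_left[OF bilinear_tens[OF AB C]]])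
    qed
    show "Q x"
      using x by (induction x rule: tensor_induct[OF AB C, consumes 1, case_names tens add])
        (rule elem, assumption+, rule span_add)
  qed (auto simp: cl tens_mult[OF AB C] tens_mult[OF A B] tens_mult[OF A BC] tens_mult[OF B C]
       tens_adj[OF AB C] tens_adj[OF A B] tens_adj[OF A BC] tens_adj[OF B C]
       tens_one[OF AB C] tens_one[OF A B] tens_one[OF A BC] tens_one[OF B C] tensor_assoc_tens)
qed

end

section \<open>The universal property of the game algebra\<close>

text \<open>Idempotency and orthogonality are merged into one equation for rows and one for columns, which is the form in
  which products of entries are evaluated.\<close>

definition magic_unitary :: "('a, 'm) star_alg_scheme \<Rightarrow> 'i set \<Rightarrow> 'j set \<Rightarrow> ('i \<Rightarrow> 'j \<Rightarrow> 'a) \<Rightarrow> bool" where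
  "magic_unitary A I J p \<longleftrightarrow>
     (\<forall>i\<in>I. \<forall>j\<in>J. p i j \<in> carrier A \<and> adj A (p i j) = p i j) \<and>
     (\<forall>i\<in>I. \<forall>j\<in>J. \<forall>j'\<in>J. p i j \<otimes>\<^bsub>A\<^esub> p i j' = (if j = j' then p i j else \<zero>\<^bsub>A\<^esub>)) \<and>
     (\<forall>i\<in>I. \<forall>i'\<in>I. \<forall>j\<in>J. p i j \<otimes>\<^bsub>A\<^esub> p i' j = (if i = i' then p i j else \<zero>\<^bsub>A\<^esub>)) \<and>
     (\<forall>i\<in>I. (\<Oplus>\<^bsub>A\<^esub>j\<in>J. p i j) = \<one>\<^bsub>A\<^esub>) \<and> (\<forall>j\<in>J. (\<Oplus>\<^bsub>A\<^esub>i\<in>I. p i j) = \<one>\<^bsub>A\<^esub>)"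

definition intertwining_relators ::
    "('a, 'm) star_alg_scheme \<Rightarrow> ('v1, 'e1) hypergraph \<Rightarrow> ('v2, 'e2) hypergraph \<Rightarrow>
     ('v1 \<Rightarrow> 'v2 \<Rightarrow> 'a) \<Rightarrow> ('e1 \<Rightarrow> 'e2 \<Rightarrow> 'a) \<Rightarrow> 'a set" where
  "intertwining_relators A H1 H2 a b =
     {(\<Oplus>\<^bsub>A\<^esub>e1\<in>edges H1. incidence H1 v1 e1 \<odot>\<^bsub>A\<^esub> b e1 e2) \<ominus>\<^bsub>A\<^esub>
      (\<Oplus>\<^bsub>A\<^esub>v2\<in>verts H2. incidence H2 v2 e2 \<odot>\<^bsub>A\<^esub> a v1 v2) | v1 e2.
        v1 \<in> verts H1 \<and> e2 \<in> edges H2}"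

text \<open>A homomorphism from the game algebra into \<open>A\<close> amounts to such a pair.\<close>

definition game_pair ::
    "('a, 'm) star_alg_scheme \<Rightarrow> ('v1, 'e1) hypergraph \<Rightarrow> ('v2, 'e2) hypergraph \<Rightarrow>
     ('v1 \<Rightarrow> 'v2 \<Rightarrow> 'a) \<Rightarrow> ('e1 \<Rightarrow> 'e2 \<Rightarrow> 'a) \<Rightarrow> bool" where
  "game_pair A H1 H2 a b \<longleftrightarrow>
     magic_unitary A (verts H1) (verts H2) a \<and> magic_unitary A (edges H1) (edges H2) b \<and>
     (\<forall>v1\<in>verts H1. \<forall>e2\<in>edges H2.
        (\<Oplus>\<^bsub>A\<^esub>e1\<in>edges H1. incidence H1 v1 e1 \<odot>\<^bsub>A\<^esub> b e1 e2) =
        (\<Oplus>\<^bsub>A\<^esub>v2\<in>verts H2. incidence H2 v2 e2 \<odot>\<^bsub>A\<^esub> a v1 v2))"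

lemma set_comp_image:
  "h ` {f i | i. P i} = {h (f i) | i. P i}"
  "h ` {g i j | i j. Q i j} = {h (g i j) | i j. Q i j}"
  "h ` {k i j l | i j l. R i j l} = {h (k i j l) | i j l. R i j l}"
  by blast+

lemma set_comp_subset_singleton:
  "{f i | i. P i} \<subseteq> {z} \<longleftrightarrow> (\<forall>i. P i \<longrightarrow> f i = z)"
  "{g i j | i j. Q i j} \<subseteq> {z} \<longleftrightarrow> (\<forall>i j. Q i j \<longrightarrow> g i j = z)"
  "{k i j l | i j l. R i j l} \<subseteq> {z} \<longleftrightarrow> (\<forall>i j l. R i j l \<longrightarrow> k i j l = z)"
  by blast+

lemma hom_diff:
  assumes "star_algebra A" "star_algebra B" "unital_star_hom A B h" "x \<in> carrier A" "y \<in> carrier A"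
  shows "h (x \<ominus>\<^bsub>A\<^esub> y) = h x \<ominus>\<^bsub>B\<^esub> h y"
proof -
  interpret A: star_alg_ring A by (rule star_alg_ringI) fact
  interpret B: star_alg_ring B by (rule star_alg_ringI) fact
  note h = assms(3)
  show ?thesis using assms(4,5)
    by (simp add: A.minus_as_smult B.minus_as_smult hom_closed[OF h] linear_add[OF hom_linear[OF h]]
      linear_smult[OF hom_linear[OF h]])
qed

context
  fixes A :: "('a, 'm) star_alg_scheme" and B :: "('b, 'n) star_alg_scheme" and h
  assumes A: "star_algebra A" and B: "star_algebra B" and h: "unital_star_hom A B h"
begin

interpretation A: star_alg_ring A by (rule star_alg_ringI[OF A])
interpretation B: star_alg_ring B by (rule star_alg_ringI[OF B])

private lemmas lf = linear_finsum[OF A B hom_linear[OF h]]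

private lemma hom_diff_zero_iff:
  "x \<in> carrier A \<Longrightarrow> y \<in> carrier A \<Longrightarrow> h (x \<ominus>\<^bsub>A\<^esub> y) = \<zero>\<^bsub>B\<^esub> \<longleftrightarrow> h x = h y"
  using hom_diff[OF A B h] B.diff_zero_iff hom_closed[OF h] by simp

text \<open>A homomorphism kills the relators exactly if the images of the entries satisfy the relations.  Applied to the
  projection onto the game algebra this gives the relations between its generators; applied to a homomorphism on
  the free algebra it gives the universal property.\<close>

lemma hom_kills_magic_relators_iff:
  assumes fin: "finite I" "finite J" and p: "\<And>i j. i \<in> I \<Longrightarrow> j \<in> J \<Longrightarrow> p i j \<in> carrier A"
  shows "h ` magic_relators A I J p \<subseteq> {\<zero>\<^bsub>B\<^esub>} \<longleftrightarrow> magic_unitary B I J (\<lambda>i j. h (p i j))"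
proof -
  have s: "(\<Oplus>\<^bsub>A\<^esub>j\<in>J. p i j) \<in> carrier A" if "i \<in> I" for i
    using p that by (intro A.finsum_closed) auto
  have s': "(\<Oplus>\<^bsub>A\<^esub>i\<in>I. p i j) \<in> carrier A" if "j \<in> J" for j
    using p that by (intro A.finsum_closed) auto
  have "h ` magic_relators A I J p \<subseteq> {\<zero>\<^bsub>B\<^esub>} \<longleftrightarrow>
     (\<forall>i j. i \<in> I \<and> j \<in> J \<longrightarrow> h (p i j) = adj B (h (p i j))) \<and>
     (\<forall>i j. i \<in> I \<and> j \<in> J \<longrightarrow> h (p i j) = h (p i j) \<otimes>\<^bsub>B\<^esub> h (p i j)) \<and>
     (\<forall>i. i \<in> I \<longrightarrow> (\<Oplus>\<^bsub>B\<^esub>j\<in>J. h (p i j)) = \<one>\<^bsub>B\<^esub>) \<and>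
     (\<forall>j. j \<in> J \<longrightarrow> (\<Oplus>\<^bsub>B\<^esub>i\<in>I. h (p i j)) = \<one>\<^bsub>B\<^esub>) \<and>
     (\<forall>i j j'. i \<in> I \<and> j \<in> J \<and> j' \<in> J \<and> j \<noteq> j' \<longrightarrow> h (p i j) \<otimes>\<^bsub>B\<^esub> h (p i j') = \<zero>\<^bsub>B\<^esub>) \<and>
     (\<forall>i i' j. i \<in> I \<and> i' \<in> I \<and> j \<in> J \<and> i \<noteq> i' \<longrightarrow> h (p i j) \<otimes>\<^bsub>B\<^esub> h (p i' j) = \<zero>\<^bsub>B\<^esub>)"
    unfolding magic_relators_def image_Un set_comp_image Un_subset_iff set_comp_subset_singleton
    using p s s' fin by (simp add: hom_diff_zero_iff hom_adj[OF h] hom_mult[OF h] hom_one[OF h] lf)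
  also have "\<dots> \<longleftrightarrow> magic_unitary B I J (\<lambda>i j. h (p i j))"
    unfolding magic_unitary_def using p hom_closed[OF h] by (auto; metis)
  finally show ?thesis .
qed

lemma hom_kills_intertwining_relators_iff:
  assumes fin: "finite (edges H1)" "finite (verts H2)"
    and a: "\<And>i j. i \<in> verts H1 \<Longrightarrow> j \<in> verts H2 \<Longrightarrow> a i j \<in> carrier A"
    and b: "\<And>i j. i \<in> edges H1 \<Longrightarrow> j \<in> edges H2 \<Longrightarrow> b i j \<in> carrier A"
  shows "h ` intertwining_relators A H1 H2 a b \<subseteq> {\<zero>\<^bsub>B\<^esub>} \<longleftrightarrow>
    (\<forall>v1\<in>verts H1. \<forall>e2\<in>edges H2.
        (\<Oplus>\<^bsub>B\<^esub>e1\<in>edges H1. incidence H1 v1 e1 \<odot>\<^bsub>B\<^esub> h (b e1 e2)) =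
        (\<Oplus>\<^bsub>B\<^esub>v2\<in>verts H2. incidence H2 v2 e2 \<odot>\<^bsub>B\<^esub> h (a v1 v2)))"
proof -
  have t: "h (\<Oplus>\<^bsub>A\<^esub>e1\<in>edges H1. incidence H1 v1 e1 \<odot>\<^bsub>A\<^esub> b e1 e2) =
     (\<Oplus>\<^bsub>B\<^esub>e1\<in>edges H1. incidence H1 v1 e1 \<odot>\<^bsub>B\<^esub> h (b e1 e2))" if "e2 \<in> edges H2" for v1 e2
    using b that fin by (subst lf) (auto simp: linear_smult[OF hom_linear[OF h]] hom_closed[OF h] intro!: B.finsum_cong')
  have t': "h (\<Oplus>\<^bsub>A\<^esub>v2\<in>verts H2. incidence H2 v2 e2 \<odot>\<^bsub>A\<^esub> a v1 v2) =
     (\<Oplus>\<^bsub>B\<^esub>v2\<in>verts H2. incidence H2 v2 e2 \<odot>\<^bsub>B\<^esub> h (a v1 v2))" if "v1 \<in> verts H1" for v1 e2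
    using a that fin by (subst lf) (auto simp: linear_smult[OF hom_linear[OF h]] hom_closed[OF h] intro!: B.finsum_cong')
  have "h ` intertwining_relators A H1 H2 a b \<subseteq> {\<zero>\<^bsub>B\<^esub>} \<longleftrightarrow> (\<forall>v1 e2. v1 \<in> verts H1 \<and> e2 \<in> edges H2 \<longrightarrow>
      h (\<Oplus>\<^bsub>A\<^esub>e1\<in>edges H1. incidence H1 v1 e1 \<odot>\<^bsub>A\<^esub> b e1 e2) =
      h (\<Oplus>\<^bsub>A\<^esub>v2\<in>verts H2. incidence H2 v2 e2 \<odot>\<^bsub>A\<^esub> a v1 v2))"
    unfolding intertwining_relators_def set_comp_image set_comp_subset_singleton
    using a b by (intro all_cong1 imp_cong refl hom_diff_zero_iff A.finsum_closed) auto
  then show ?thesis by (auto simp: t t')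
qed

end

locale hypergraph_pair =
  fixes H1 :: "('v1, 'e1) hypergraph" and H2 :: "('v2, 'e2) hypergraph"
  assumes full1: "full_hypergraph H1" and full2: "full_hypergraph H2"
begin

lemma fin: "finite (verts H1)" "finite (edges H1)" "finite (verts H2)" "finite (edges H2)"
  using full1 full2 by (auto simp: full_hypergraph_def)

abbreviation "gens \<equiv> {Vtx v1 v2 | v1 v2. v1 \<in> verts H1 \<and> v2 \<in> verts H2} \<union>
      {Edg e1 e2 | e1 e2. e1 \<in> edges H1 \<and> e2 \<in> edges H2}"

abbreviation "W \<equiv> \<lparr>carrier = lists (gens \<times> (UNIV :: bool set)), mult = (@), one = []\<rparr>"
abbreviation "Fr \<equiv> free_game_alg H1 H2"
abbreviation "Z \<equiv> game_alg H1 H2"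
abbreviation "p \<equiv> gen_vtx H1 H2"
abbreviation "q \<equiv> gen_edg H1 H2"

sublocale W: monoid_involution W "\<lambda>w. rev (map (apsnd Not) w)"
proof
  fix x :: "(('v1, 'e1, 'v2, 'e2) game_gen \<times> bool) list"
  assume "x \<in> carrier W"
  then have x: "set x \<subseteq> gens \<times> UNIV" by (simp add: in_lists_conv_set subset_iff)
  show "rev (map (apsnd Not) x) \<in> carrier W"
    using x by (auto simp: in_lists_conv_set)
  show "rev (map (apsnd Not) (rev (map (apsnd Not) x))) = x"
    by (simp add: rev_map comp_def) (rule map_idI, auto)
qed auto

lemma Fr_eq: "Fr = W.CM"
  unfolding free_game_alg_def free_star_alg_def ..

lemma Fr: "star_algebra Fr" unfolding Fr_eq by (rule W.star_algebra_CM)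

lemma game_relators_eq: "game_relators H1 H2 =
    magic_relators Fr (verts H1) (verts H2) (\<lambda>v1 v2. free_gen (Vtx v1 v2)) \<union>
    magic_relators Fr (edges H1) (edges H2) (\<lambda>e1 e2. free_gen (Edg e1 e2)) \<union>
    intertwining_relators Fr H1 H2 (\<lambda>v1 v2. free_gen (Vtx v1 v2)) (\<lambda>e1 e2. free_gen (Edg e1 e2))"
  unfolding game_relators_def Let_def intertwining_relators_def ..

lemma free_gen_closed:
  "v1 \<in> verts H1 \<Longrightarrow> v2 \<in> verts H2 \<Longrightarrow> free_gen (Vtx v1 v2) \<in> carrier Fr"
  "e1 \<in> edges H1 \<Longrightarrow> e2 \<in> edges H2 \<Longrightarrow> free_gen (Edg e1 e2) \<in> carrier Fr"
  by (auto simp: Fr_eq W.CM_simps free_gen_def)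

lemma hom_kills_game_relators_iff:
  assumes B: "star_algebra B" and h: "unital_star_hom Fr B h"
  shows "h ` game_relators H1 H2 \<subseteq> {\<zero>\<^bsub>B\<^esub>} \<longleftrightarrow>
    game_pair B H1 H2 (\<lambda>v1 v2. h (free_gen (Vtx v1 v2))) (\<lambda>e1 e2. h (free_gen (Edg e1 e2)))"
  unfolding game_relators_eq image_Un Un_subset_iff game_pair_def conj_assoc
  by (simp only: hom_kills_magic_relators_iff[OF Fr B h fin(1,3)] hom_kills_magic_relators_iff[OF Fr B h fin(2,4)]
    hom_kills_intertwining_relators_iff[OF Fr B h fin(2,3)] free_gen_closed)

lemma game_relators_closed: "game_relators H1 H2 \<subseteq> carrier Fr"
proof -
  interpret S: star_alg_ring Fr by (rule star_alg_ringI[OF Fr])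
  note cl = free_gen_closed
  have "magic_relators Fr (verts H1) (verts H2) (\<lambda>v1 v2. free_gen (Vtx v1 v2)) \<subseteq> carrier Fr"
    unfolding magic_relators_def by (auto intro!: S.minus_closed S.finsum_closed S.m_closed S.adj_cl cl)
  moreover have "magic_relators Fr (edges H1) (edges H2) (\<lambda>v1 v2. free_gen (Edg v1 v2)) \<subseteq> carrier Fr"
    unfolding magic_relators_def by (auto intro!: S.minus_closed S.finsum_closed S.m_closed S.adj_cl cl)
  moreover have "intertwining_relators Fr H1 H2 (\<lambda>v1 v2. free_gen (Vtx v1 v2)) (\<lambda>e1 e2. free_gen (Edg e1 e2)) \<subseteq> carrier Fr"
    unfolding intertwining_relators_def by (auto intro!: S.minus_closed S.finsum_closed S.smult_cl cl)
  ultimately show ?thesis unfolding game_relators_eq by blast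
qed

lemma game_star_ideal: "star_ideal Fr (game_ideal H1 H2)"
  and game_ideal_relators: "game_relators H1 H2 \<subseteq> game_ideal H1 H2"
  and game_ideal_least: "\<And>I. star_ideal Fr I \<Longrightarrow> game_relators H1 H2 \<subseteq> I \<Longrightarrow> game_ideal H1 H2 \<subseteq> I"
  unfolding game_ideal_def using gen_star_ideal_ideal[OF Fr game_relators_closed] by auto

abbreviation "pr \<equiv> \<lambda>x. game_ideal H1 H2 +>\<^bsub>Fr\<^esub> x"

lemma Z: "star_algebra Z"
  unfolding game_alg_def by (rule star_algebra_quot[OF Fr game_star_ideal])

lemma pr_hom: "unital_star_hom Fr Z pr"
  unfolding game_alg_def by (rule hom_quot[OF Fr game_star_ideal])

lemma pr_null:
  assumes "x \<in> game_ideal H1 H2" shows "pr x = \<zero>\<^bsub>Z\<^esub>"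
proof -
  interpret S: star_alg_ring Fr by (rule star_alg_ringI[OF Fr])
  have x: "x \<in> carrier Fr" using assms game_star_ideal by (auto simp: star_ideal_def linear_subspace_def)
  have "pr x = pr \<zero>\<^bsub>Fr\<^esub>" using assms x by (subst quot_eq_iff[OF Fr game_star_ideal]) auto
  then show ?thesis by (simp add: game_alg_def quot_zero[OF Fr game_star_ideal])
qed

lemma gen_closed:
  "v1 \<in> verts H1 \<Longrightarrow> v2 \<in> verts H2 \<Longrightarrow> p v1 v2 \<in> carrier Z"
  "e1 \<in> edges H1 \<Longrightarrow> e2 \<in> edges H2 \<Longrightarrow> q e1 e2 \<in> carrier Z"
  unfolding gen_vtx_def gen_edg_def using hom_closed[OF pr_hom] free_gen_closed by auto

lemma gen_game_pair: "game_pair Z H1 H2 p q"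
proof -
  have "pr ` game_relators H1 H2 \<subseteq> {\<zero>\<^bsub>Z\<^esub>}" using pr_null game_ideal_relators by blast
  then show ?thesis using hom_kills_game_relators_iff[OF Z pr_hom] by (simp add: gen_vtx_def[abs_def] gen_edg_def[abs_def])
qed

text \<open>The letters for adjoints need no case of their own: the generators of the game algebra are self-adjoint.\<close>

lemma game_alg_induct [consumes 1, case_names one vtx edg mult add smult]:
  assumes z: "z \<in> carrier Z" and one: "Q \<one>\<^bsub>Z\<^esub>"
    and vtx: "\<And>v1 v2. v1 \<in> verts H1 \<Longrightarrow> v2 \<in> verts H2 \<Longrightarrow> Q (p v1 v2)"
    and edg: "\<And>e1 e2. e1 \<in> edges H1 \<Longrightarrow> e2 \<in> edges H2 \<Longrightarrow> Q (q e1 e2)"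
    and mult: "\<And>x y. x \<in> carrier Z \<Longrightarrow> y \<in> carrier Z \<Longrightarrow> Q x \<Longrightarrow> Q y \<Longrightarrow> Q (x \<otimes>\<^bsub>Z\<^esub> y)"
    and add: "\<And>x y. x \<in> carrier Z \<Longrightarrow> y \<in> carrier Z \<Longrightarrow> Q x \<Longrightarrow> Q y \<Longrightarrow> Q (x \<oplus>\<^bsub>Z\<^esub> y)"
    and smult: "\<And>c x. x \<in> carrier Z \<Longrightarrow> Q x \<Longrightarrow> Q (c \<odot>\<^bsub>Z\<^esub> x)"
  shows "Q z"
proof -
  interpret Z: star_alg_ring Z by (rule star_alg_ringI[OF Z])
  note prc = hom_closed[OF pr_hom]
  \<comment> \<open>The letters \<open>(x, True)\<close> and \<open>(x, False)\<close> have the same image.\<close>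
  have letter: "Q (pr (Poly_Mapping.single [(x, s)] 1))" if "x \<in> gens" for x s
  proof -
    have eq: "pr (Poly_Mapping.single [(x, s)] 1) = pr (free_gen x)"
    proof (cases s)
      case True
      have g: "free_gen x \<in> carrier Fr" using that free_gen_closed by auto
      have "Poly_Mapping.single [(x, s)] 1 = adj Fr (free_gen x)"
        using True by (simp add: Fr_eq free_gen_def W.CM_adj_single)
      then have "pr (Poly_Mapping.single [(x, s)] 1) = adj Z (pr (free_gen x))"
        using hom_adj[OF pr_hom g] by simp
      also have "\<dots> = pr (free_gen x)" using gen_game_pair that
        by (auto simp: game_pair_def magic_unitary_def gen_vtx_def gen_edg_def)
      finally show ?thesis .
    qed (simp add: free_gen_def)
    show ?thesis using that vtx edg unfolding eq by (auto simp: gen_vtx_def gen_edg_def)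
  qed
  have word: "Q (pr (Poly_Mapping.single w 1))" if "w \<in> lists (gens \<times> UNIV)" for w
    using that
  proof (induction w)
    case Nil
    then show ?case using one hom_one[OF pr_hom] by (simp add: Fr_eq W.CM_simps)
  next
    case (Cons l w)
    obtain x s where l: "l = (x, s)" by fastforce
    with Cons have x: "x \<in> gens" by auto
    have c: "Poly_Mapping.single [l] 1 \<in> carrier Fr" "Poly_Mapping.single w 1 \<in> carrier Fr"
      using Cons by (auto simp: Fr_eq W.CM_simps)
    have "Poly_Mapping.single (l # w) (1 :: complex) = Poly_Mapping.single [l] 1 \<otimes>\<^bsub>Fr\<^esub> Poly_Mapping.single w 1"
      by (simp add: Fr_eq W.CM_mult_single)
    then show ?case
      using mult[OF prc[OF c(1)] prc[OF c(2)]] letter[OF x, of s] Cons.IH l hom_mult[OF pr_hom c] by simp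
  qed
  have "Q (pr f)" if "f \<in> carrier Fr" for f
    using that[unfolded Fr_eq]
  proof (induction f rule: W.CM_induct)
    case zero
    have "Q (0 \<odot>\<^bsub>Z\<^esub> \<one>\<^bsub>Z\<^esub>)" by (rule smult) (use one in auto)
    then show ?case using linear_zero[OF Fr Z hom_linear[OF pr_hom]] by (simp add: Fr_eq W.CM_simps)
  next
    case (single w c)
    then have s: "Poly_Mapping.single w 1 \<in> carrier Fr" by (simp add: Fr_eq W.CM_simps)
    have "Poly_Mapping.single w c = c \<odot>\<^bsub>Fr\<^esub> Poly_Mapping.single w 1"
      by (simp add: Fr_eq W.CM_simps scale_single)
    then show ?case using smult[OF prc[OF s] word, of c] single linear_smult[OF hom_linear[OF pr_hom] s, of c]
      by simp
  next
    case (add f g)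
    then have fg: "f \<in> carrier Fr" "g \<in> carrier Fr" by (simp_all add: Fr_eq)
    have "f + g = f \<oplus>\<^bsub>Fr\<^esub> g" by (simp add: Fr_eq W.CM_simps)
    then show ?case using assms(6)[OF prc[OF fg(1)] prc[OF fg(2)] add(3,4)] linear_add[OF hom_linear[OF pr_hom] fg]
      by simp
  qed
  then show ?thesis using z unfolding game_alg_def quot_carrier[OF Fr game_star_ideal] by blast
qed

context
  fixes B :: "('tgt, 'ext) star_alg_scheme" and a b
  assumes B: "star_algebra B" and ab: "game_pair B H1 H2 a b"
begin

interpretation B: star_alg_ring B by (rule star_alg_ringI[OF B])

private abbreviation "letter_val \<equiv> \<lambda>(x, s). let z = case_game_gen a b x in if s then adj B z else z"
private abbreviation "word_val \<equiv> \<lambda>w. foldr (\<lambda>l y. letter_val l \<otimes>\<^bsub>B\<^esub> y) w \<one>\<^bsub>B\<^esub>"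

private lemma letter_val_closed: "l \<in> gens \<times> UNIV \<Longrightarrow> letter_val l \<in> carrier B"
  using ab by (auto simp: game_pair_def magic_unitary_def Let_def)

private lemma letter_val_adj: "l \<in> gens \<times> UNIV \<Longrightarrow> letter_val (apsnd Not l) = adj B (letter_val l)"
  using ab by (auto simp: game_pair_def magic_unitary_def Let_def)

private lemma word_val_closed: "w \<in> lists (gens \<times> UNIV) \<Longrightarrow> word_val w \<in> carrier B"
  by (induction w) (simp_all add: letter_val_closed del: split_paired_All)

private lemma word_val_append: "w \<in> lists (gens \<times> UNIV) \<Longrightarrow> w' \<in> lists (gens \<times> UNIV) \<Longrightarrow>
   word_val (w @ w') = word_val w \<otimes>\<^bsub>B\<^esub> word_val w'"
proof (induction w)
  case (Cons l w)
  have "letter_val l \<in> carrier B" "word_val w \<in> carrier B" "word_val w' \<in> carrier B"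
    using Cons.prems by (auto intro!: letter_val_closed word_val_closed simp del: split_paired_All)
  then show ?case using Cons by (simp add: B.m_assoc)
qed (simp add: word_val_closed)

private lemma word_val_adj: "w \<in> lists (gens \<times> UNIV) \<Longrightarrow> word_val (rev (map (apsnd Not) w)) = adj B (word_val w)"
proof (induction w)
  case (Cons l w)
  have l: "l \<in> gens \<times> UNIV" and w: "w \<in> lists (gens \<times> UNIV)" using Cons.prems by auto
  have l': "[apsnd Not l] \<in> lists (gens \<times> UNIV)" using l by auto
  have w': "rev (map (apsnd Not) w) \<in> lists (gens \<times> UNIV)" using W.st_closed w by simp
  have "word_val (rev (map (apsnd Not) (l # w))) = adj B (word_val w) \<otimes>\<^bsub>B\<^esub> (letter_val (apsnd Not l) \<otimes>\<^bsub>B\<^esub> \<one>\<^bsub>B\<^esub>)"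
    using word_val_append[OF w' l'] Cons.IH[OF w] by simp
  also have "\<dots> = adj B (word_val w) \<otimes>\<^bsub>B\<^esub> adj B (letter_val l)"
    unfolding letter_val_adj[OF l] using letter_val_closed[OF l] by simp
  also have "\<dots> = adj B (letter_val l \<otimes>\<^bsub>B\<^esub> word_val w)"
    by (rule B.adj_mult[symmetric, OF letter_val_closed[OF l] word_val_closed[OF w]])
  finally show ?case by simp
qed simp

private lemma word_hom: "unital_star_hom Fr B (lin_ext B word_val)"
  unfolding Fr_eq
  by (rule W.lin_ext_hom[OF B])
     (simp_all only: monoid.simps partial_object.simps word_val_closed word_val_append word_val_adj foldr.simps id_apply)

private lemma word_hom_gen:
  "v1 \<in> verts H1 \<Longrightarrow> v2 \<in> verts H2 \<Longrightarrow> lin_ext B word_val (free_gen (Vtx v1 v2)) = a v1 v2"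
  "e1 \<in> edges H1 \<Longrightarrow> e2 \<in> edges H2 \<Longrightarrow> lin_ext B word_val (free_gen (Edg e1 e2)) = b e1 e2"
  using ab by (simp_all add: free_gen_def lin_ext_def game_pair_def magic_unitary_def)

private lemma word_hom_null:
  assumes "x \<in> game_ideal H1 H2"
  shows "lin_ext B word_val x = \<zero>\<^bsub>B\<^esub>"
proof -
  interpret S: star_alg_ring Fr by (rule star_alg_ringI[OF Fr])
  let ?L = "lin_ext B word_val"
  let ?K = "{x \<in> carrier Fr. ?L x = \<zero>\<^bsub>B\<^esub>}"
  note L = word_hom
  have "star_ideal Fr ?K"
    unfolding star_ideal_def
    by (auto intro!: linear_subspaceI simp: linear_zero[OF Fr B hom_linear[OF L]] hom_mult[OF L]
      linear_add[OF hom_linear[OF L]] linear_smult[OF hom_linear[OF L]] hom_adj[OF L] hom_closed[OF L])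
  moreover have "?L ` game_relators H1 H2 \<subseteq> {\<zero>\<^bsub>B\<^esub>}"
  proof -
    have "game_pair B H1 H2 (\<lambda>i j. ?L (free_gen (Vtx i j))) (\<lambda>i j. ?L (free_gen (Edg i j)))"
      using ab unfolding game_pair_def magic_unitary_def
      by (simp add: word_hom_gen fin cong: B.finsum_cong ball_cong)
    then show ?thesis using hom_kills_game_relators_iff[OF B L] by blast
  qed
  ultimately have "game_ideal H1 H2 \<subseteq> ?K"
    using game_relators_closed by (intro game_ideal_least) blast+
  then show ?thesis using assms by blast
qed

private lemma game_hom_pr:
  assumes "f \<in> carrier Fr"
  shows "game_hom B a b (pr f) = lin_ext B word_val f"
proof -
  have eq: "game_hom B a b = induced B word_val"
    by (simp add: game_hom_def case_prod_unfold)
  show ?thesis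
    unfolding eq Fr_eq
    by (rule W.induced_coset[OF B])
       (use assms game_star_ideal word_hom_null word_val_closed
         in \<open>auto simp: star_ideal_def linear_subspace_def Fr_eq[symmetric] simp del: split_paired_All\<close>)
qed

lemma game_hom_hom: "unital_star_hom Z B (game_hom B a b)"
proof -
  note L = word_hom
  interpret S: star_alg_ring Fr by (rule star_alg_ringI[OF Fr])
  have rep: "\<exists>f\<in>carrier Fr. z = pr f" if "z \<in> carrier Z" for z
    using that unfolding game_alg_def quot_carrier[OF Fr game_star_ideal] by blast
  have sm: "c \<odot>\<^bsub>Z\<^esub> pr f = pr (c \<odot>\<^bsub>Fr\<^esub> f)" "adj Z (pr f) = pr (adj Fr f)" if "f \<in> carrier Fr" for c f
    using linear_smult[OF hom_linear[OF pr_hom] that] hom_adj[OF pr_hom that] by simp_all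
  have bin: "pr f \<oplus>\<^bsub>Z\<^esub> pr g = pr (f \<oplus>\<^bsub>Fr\<^esub> g)" "pr f \<otimes>\<^bsub>Z\<^esub> pr g = pr (f \<otimes>\<^bsub>Fr\<^esub> g)"
    if "f \<in> carrier Fr" "g \<in> carrier Fr" for f g
    using linear_add[OF hom_linear[OF pr_hom] that] hom_mult[OF pr_hom that] by simp_all
  have un: "\<one>\<^bsub>Z\<^esub> = pr \<one>\<^bsub>Fr\<^esub>" using hom_one[OF pr_hom] by simp
  show ?thesis
    by (intro unital_star_homI linear_onI; ((drule rep)+)?; (elim bexE)?)
       (simp_all add: sm bin un game_hom_pr hom_closed[OF L] hom_mult[OF L] hom_adj[OF L] hom_one[OF L]
         linear_add[OF hom_linear[OF L]] linear_smult[OF hom_linear[OF L]])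
qed

lemma game_hom_gen:
  "v1 \<in> verts H1 \<Longrightarrow> v2 \<in> verts H2 \<Longrightarrow> game_hom B a b (p v1 v2) = a v1 v2"
  "e1 \<in> edges H1 \<Longrightarrow> e2 \<in> edges H2 \<Longrightarrow> game_hom B a b (q e1 e2) = b e1 e2"
  by (simp_all add: gen_vtx_def gen_edg_def game_hom_pr free_gen_closed word_hom_gen)

end

text \<open>The equalizer of two homomorphisms is a subalgebra, so it is enough that it contains the generators.\<close>

lemma game_hom_eqI:
  assumes f: "unital_star_hom Z B f" and g: "unital_star_hom Z B g"
    and "\<And>v1 v2. v1 \<in> verts H1 \<Longrightarrow> v2 \<in> verts H2 \<Longrightarrow> f (p v1 v2) = g (p v1 v2)"
    and "\<And>e1 e2. e1 \<in> edges H1 \<Longrightarrow> e2 \<in> edges H2 \<Longrightarrow> f (q e1 e2) = g (q e1 e2)"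
    and "z \<in> carrier Z"
  shows "f z = g z"
  using assms(5)
  by (induction z rule: game_alg_induct)
     (simp_all add: assms(3,4) hom_one[OF f] hom_one[OF g] hom_mult[OF f] hom_mult[OF g]
       linear_add[OF hom_linear[OF f]] linear_add[OF hom_linear[OF g]]
       linear_smult[OF hom_linear[OF f]] linear_smult[OF hom_linear[OF g]])

end

section \<open>Products and transposes of magic unitaries\<close>

lemma (in abelian_monoid) finsum_delta:
  assumes "finite K" "k \<in> K" "f k \<in> carrier G"
  shows "(\<Oplus>l\<in>K. if k = l then f l else \<zero>) = f k"
proof -
  have "(\<Oplus>l\<in>K. if k = l then f l else \<zero>) = (\<Oplus>l\<in>K. if k = l then f k else \<zero>)"
    using assms by (intro finsum_cong') auto
  also have "\<dots> = f k" using assms by (intro finsum_singleton) auto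
  finally show ?thesis .
qed

lemma smult_finsum:
  assumes A: "star_algebra A" and "finite I" "\<And>i. i \<in> I \<Longrightarrow> f i \<in> carrier A"
  shows "c \<odot>\<^bsub>A\<^esub> (\<Oplus>\<^bsub>A\<^esub>i\<in>I. f i) = (\<Oplus>\<^bsub>A\<^esub>i\<in>I. c \<odot>\<^bsub>A\<^esub> f i)"
proof -
  interpret A: star_alg_ring A by (rule star_alg_ringI[OF A])
  have "linear_on A A (\<lambda>x. c \<odot>\<^bsub>A\<^esub> x)"
    by (rule linear_onI) (auto simp: A.smult_add_vector A.smult_smult mult.commute)
  from linear_finsum[OF A A this] assms(2,3) show ?thesis by blast
qed

lemma
  assumes "magic_unitary A I J p"
  shows magic_closed: "i \<in> I \<Longrightarrow> j \<in> J \<Longrightarrow> p i j \<in> carrier A"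
    and magic_adj: "i \<in> I \<Longrightarrow> j \<in> J \<Longrightarrow> adj A (p i j) = p i j"
    and magic_row: "i \<in> I \<Longrightarrow> j \<in> J \<Longrightarrow> j' \<in> J \<Longrightarrow> p i j \<otimes>\<^bsub>A\<^esub> p i j' = (if j = j' then p i j else \<zero>\<^bsub>A\<^esub>)"
    and magic_col: "i \<in> I \<Longrightarrow> i' \<in> I \<Longrightarrow> j \<in> J \<Longrightarrow> p i j \<otimes>\<^bsub>A\<^esub> p i' j = (if i = i' then p i j else \<zero>\<^bsub>A\<^esub>)"
    and magic_row_sum: "i \<in> I \<Longrightarrow> (\<Oplus>\<^bsub>A\<^esub>j\<in>J. p i j) = \<one>\<^bsub>A\<^esub>"
    and magic_col_sum: "j \<in> J \<Longrightarrow> (\<Oplus>\<^bsub>A\<^esub>i\<in>I. p i j) = \<one>\<^bsub>A\<^esub>"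
  using assms unfolding magic_unitary_def by blast+

lemma
  assumes "game_pair A H1 H2 a b"
  shows game_pair_verts: "magic_unitary A (verts H1) (verts H2) a"
    and game_pair_edges: "magic_unitary A (edges H1) (edges H2) b"
    and game_pair_intertwines: "v1 \<in> verts H1 \<Longrightarrow> e2 \<in> edges H2 \<Longrightarrow>
        (\<Oplus>\<^bsub>A\<^esub>e1\<in>edges H1. incidence H1 v1 e1 \<odot>\<^bsub>A\<^esub> b e1 e2) =
        (\<Oplus>\<^bsub>A\<^esub>v2\<in>verts H2. incidence H2 v2 e2 \<odot>\<^bsub>A\<^esub> a v1 v2)"
  using assms unfolding game_pair_def by blast+

text \<open>The product of a matrix over \<open>A\<close> and a matrix over \<open>B\<close>, with entries in the tensor product.\<close>

definition tens_prod ::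
    "('a, 'm) star_alg_scheme \<Rightarrow> ('b, 'n) star_alg_scheme \<Rightarrow> 'k set \<Rightarrow> ('i \<Rightarrow> 'k \<Rightarrow> 'a) \<Rightarrow> ('k \<Rightarrow> 'j \<Rightarrow> 'b) \<Rightarrow>
     'i \<Rightarrow> 'j \<Rightarrow> ('a \<times> 'b \<Rightarrow>\<^sub>0 complex) set" where
  "tens_prod A B K p q = (\<lambda>i j. \<Oplus>\<^bsub>tensor_alg A B\<^esub>k\<in>K. tens A B (p i k) (q k j))"

context
  fixes A :: "('a, 'm) star_alg_scheme" and B :: "('b, 'n) star_alg_scheme"
  assumes A: "star_algebra A" and B: "star_algebra B"
begin

private abbreviation (input) "TT \<equiv> tensor_alg A B"

interpretation A: star_alg_ring A by (rule star_alg_ringI[OF A])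
interpretation B: star_alg_ring B by (rule star_alg_ringI[OF B])
interpretation T: star_alg_ring TT by (rule star_alg_ringI[OF star_algebra_tensor[OF A B]])

private lemma tens_zero: "a \<in> carrier A \<Longrightarrow> tens A B a \<zero>\<^bsub>B\<^esub> = \<zero>\<^bsub>TT\<^esub>" "b \<in> carrier B \<Longrightarrow> tens A B \<zero>\<^bsub>A\<^esub> b = \<zero>\<^bsub>TT\<^esub>"
  using linear_zero[OF B T.star_algebra bilinear_right[OF bilinear_tens[OF A B]]]
    linear_zero[OF A T.star_algebra bilinear_left[OF bilinear_tens[OF A B]]] by auto

private lemmas tc = tens_closed[OF A B]

text \<open>In the product of two entries, the double sum over the inner indices collapses to the diagonal, by orthogonality
  of the entries of \<open>p\<close> in a row, or of \<open>q\<close> in a column.\<close>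

lemma tens_prod_magic:
  assumes fin: "finite I" "finite K" "finite J"
    and p: "magic_unitary A I K p" and q: "magic_unitary B K J q"
  shows "magic_unitary TT I J (tens_prod A B K p q)"
proof -
  note pc = magic_closed[OF p] and qc = magic_closed[OF q]
  let ?s = "tens_prod A B K p q"
  have sc: "?s i j \<in> carrier TT" if "i \<in> I" "j \<in> J" for i j
    unfolding tens_prod_def using that by (intro T.finsum_closed) (auto simp: pc qc tc)
  have mult: "?s i j \<otimes>\<^bsub>TT\<^esub> ?s i' j' =
      (\<Oplus>\<^bsub>TT\<^esub>k\<in>K. \<Oplus>\<^bsub>TT\<^esub>l\<in>K. tens A B (p i k \<otimes>\<^bsub>A\<^esub> p i' l) (q k j \<otimes>\<^bsub>B\<^esub> q l j'))"
    if "i \<in> I" "i' \<in> I" "j \<in> J" "j' \<in> J" for i i' j j'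
  proof -
    have "?s i j \<otimes>\<^bsub>TT\<^esub> ?s i' j' = (\<Oplus>\<^bsub>TT\<^esub>k\<in>K. tens A B (p i k) (q k j) \<otimes>\<^bsub>TT\<^esub> ?s i' j')"
      unfolding tens_prod_def[of A B K p q] using that fin
      by (subst T.finsum_ldistr) (auto simp: pc qc tc intro!: T.finsum_closed)
    also have "\<dots> = (\<Oplus>\<^bsub>TT\<^esub>k\<in>K. \<Oplus>\<^bsub>TT\<^esub>l\<in>K. tens A B (p i k \<otimes>\<^bsub>A\<^esub> p i' l) (q k j \<otimes>\<^bsub>B\<^esub> q l j'))"
    proof (rule T.finsum_cong')
      fix k assume k: "k \<in> K"
      have "tens A B (p i k) (q k j) \<otimes>\<^bsub>TT\<^esub> ?s i' j' =
         (\<Oplus>\<^bsub>TT\<^esub>l\<in>K. tens A B (p i k) (q k j) \<otimes>\<^bsub>TT\<^esub> tens A B (p i' l) (q l j'))"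
        unfolding tens_prod_def using that fin k
        by (subst T.finsum_rdistr) (auto simp: pc qc tc)
      also have "\<dots> = (\<Oplus>\<^bsub>TT\<^esub>l\<in>K. tens A B (p i k \<otimes>\<^bsub>A\<^esub> p i' l) (q k j \<otimes>\<^bsub>B\<^esub> q l j'))"
        using that k by (intro T.finsum_cong') (auto simp: pc qc tc tens_mult[OF A B])
      finally show "tens A B (p i k) (q k j) \<otimes>\<^bsub>TT\<^esub> ?s i' j' =
         (\<Oplus>\<^bsub>TT\<^esub>l\<in>K. tens A B (p i k \<otimes>\<^bsub>A\<^esub> p i' l) (q k j \<otimes>\<^bsub>B\<^esub> q l j'))" .
    qed (use that in \<open>auto simp: pc qc tc intro!: T.finsum_closed\<close>)
    finally show ?thesis .
  qed
  have diag: "?s i j \<otimes>\<^bsub>TT\<^esub> ?s i' j' = (if P then ?s i j else \<zero>\<^bsub>TT\<^esub>)"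
    if "i \<in> I" "i' \<in> I" "j \<in> J" "j' \<in> J"
      and "\<And>k l. k \<in> K \<Longrightarrow> l \<in> K \<Longrightarrow> tens A B (p i k \<otimes>\<^bsub>A\<^esub> p i' l) (q k j \<otimes>\<^bsub>B\<^esub> q l j') =
        (if k = l then if P then tens A B (p i k) (q k j) else \<zero>\<^bsub>TT\<^esub> else \<zero>\<^bsub>TT\<^esub>)" for i i' j j' P
  proof -
    let ?t = "\<lambda>k. if P then tens A B (p i k) (q k j) else \<zero>\<^bsub>TT\<^esub>"
    have "?s i j \<otimes>\<^bsub>TT\<^esub> ?s i' j' = (\<Oplus>\<^bsub>TT\<^esub>k\<in>K. \<Oplus>\<^bsub>TT\<^esub>l\<in>K. if k = l then ?t l else \<zero>\<^bsub>TT\<^esub>)"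
      unfolding mult[OF that(1-4)] using that
      by (intro T.finsum_cong') (auto simp: pc qc tc intro!: T.finsum_closed T.finsum_cong')
    also have "\<dots> = (\<Oplus>\<^bsub>TT\<^esub>k\<in>K. ?t k)"
      using that fin by (intro T.finsum_cong' T.finsum_delta) (auto simp: pc qc tc)
    also have "\<dots> = (if P then ?s i j else \<zero>\<^bsub>TT\<^esub>)" by (simp add: tens_prod_def)
    finally show ?thesis .
  qed
  have row: "?s i j \<otimes>\<^bsub>TT\<^esub> ?s i j' = (if j = j' then ?s i j else \<zero>\<^bsub>TT\<^esub>)"
    if "i \<in> I" "j \<in> J" "j' \<in> J" for i j j'
    by (rule diag) (use that in \<open>auto simp: pc qc magic_row[OF p] magic_row[OF q] tens_zero\<close>)
  have col: "?s i j \<otimes>\<^bsub>TT\<^esub> ?s i' j = (if i = i' then ?s i j else \<zero>\<^bsub>TT\<^esub>)"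
    if "i \<in> I" "i' \<in> I" "j \<in> J" for i i' j
    by (rule diag) (use that in \<open>auto simp: pc qc magic_col[OF p] magic_col[OF q] tens_zero\<close>)
  have adj: "adj TT (?s i j) = ?s i j" if "i \<in> I" "j \<in> J" for i j
  proof -
    have *: "adj TT (\<Oplus>\<^bsub>TT\<^esub>k\<in>L. tens A B (p i k) (q k j)) = (\<Oplus>\<^bsub>TT\<^esub>k\<in>L. tens A B (p i k) (q k j))"
      if "finite L" "L \<subseteq> K" for L
      using that
    proof (induction L)
      case (insert l L)
      have "(\<lambda>k. tens A B (p i k) (q k j)) \<in> L \<rightarrow> carrier TT" "l \<in> K"
        using insert \<open>i \<in> I\<close> \<open>j \<in> J\<close> by (auto simp: pc qc tc subset_iff)
      then show ?case using insert \<open>i \<in> I\<close> \<open>j \<in> J\<close>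
        by (simp add: pc qc tc T.adj_add tens_adj[OF A B] magic_adj[OF p] magic_adj[OF q])
    qed simp
    show ?thesis unfolding tens_prod_def using *[of K] fin by simp
  qed
  have rs: "(\<Oplus>\<^bsub>TT\<^esub>j\<in>J. ?s i j) = \<one>\<^bsub>TT\<^esub>" if "i \<in> I" for i
  proof -
    have "(\<Oplus>\<^bsub>TT\<^esub>j\<in>J. ?s i j) = (\<Oplus>\<^bsub>TT\<^esub>k\<in>K. \<Oplus>\<^bsub>TT\<^esub>j\<in>J. tens A B (p i k) (q k j))"
      unfolding tens_prod_def using that fin
      by (intro finsum_swap T.abelian_monoid_axioms) (auto simp: pc qc tc)
    also have "\<dots> = (\<Oplus>\<^bsub>TT\<^esub>k\<in>K. tens A B (p i k) \<one>\<^bsub>B\<^esub>)"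
      using that fin by (intro T.finsum_cong')
        (auto simp: pc qc tc tens_finsum_right[OF A B, symmetric] magic_row_sum[OF q])
    also have "\<dots> = \<one>\<^bsub>TT\<^esub>"
      using that fin by (simp add: pc tens_finsum_left[OF A B, symmetric] magic_row_sum[OF p] tens_one[OF A B])
    finally show ?thesis .
  qed
  have cs: "(\<Oplus>\<^bsub>TT\<^esub>i\<in>I. ?s i j) = \<one>\<^bsub>TT\<^esub>" if "j \<in> J" for j
  proof -
    have "(\<Oplus>\<^bsub>TT\<^esub>i\<in>I. ?s i j) = (\<Oplus>\<^bsub>TT\<^esub>k\<in>K. \<Oplus>\<^bsub>TT\<^esub>i\<in>I. tens A B (p i k) (q k j))"
      unfolding tens_prod_def using that fin
      by (intro finsum_swap T.abelian_monoid_axioms) (auto simp: pc qc tc)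
    also have "\<dots> = (\<Oplus>\<^bsub>TT\<^esub>k\<in>K. tens A B \<one>\<^bsub>A\<^esub> (q k j))"
      using that fin by (intro T.finsum_cong')
        (auto simp: pc qc tc tens_finsum_left[OF A B, symmetric] magic_col_sum[OF p])
    also have "\<dots> = \<one>\<^bsub>TT\<^esub>"
      using that fin by (simp add: qc tens_finsum_right[OF A B, symmetric] magic_col_sum[OF q] tens_one[OF A B])
    finally show ?thesis .
  qed
  show ?thesis unfolding magic_unitary_def using sc adj row col rs cs by blast
qed

text \<open>In matrix form: $A_1 (P_E \otimes Q_E) = (P_V A_2) \otimes Q_E = P_V \otimes (A_2 Q_E) = (P_V \otimes Q_V) A_3$,
  where $\otimes$ multiplies matrices and tensors their entries.\<close>

lemma tens_prod_game_pair:
  assumes full: "full_hypergraph H1" "full_hypergraph H2" "full_hypergraph H3"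
    and ab: "game_pair A H1 H2 a b" and cd: "game_pair B H2 H3 c d"
  shows "game_pair TT H1 H3 (tens_prod A B (verts H2) a c) (tens_prod A B (edges H2) b d)"
proof -
  have fin: "finite (verts H1)" "finite (verts H2)" "finite (verts H3)"
     "finite (edges H1)" "finite (edges H2)" "finite (edges H3)"
    using full by (auto simp: full_hypergraph_def)
  note ac = magic_closed[OF game_pair_verts[OF ab]] and bc = magic_closed[OF game_pair_edges[OF ab]]
    and cc = magic_closed[OF game_pair_verts[OF cd]] and dc = magic_closed[OF game_pair_edges[OF cd]]
  note sl = linear_smult[OF bilinear_left[OF bilinear_tens[OF A B]]]
    and sr = linear_smult[OF bilinear_right[OF bilinear_tens[OF A B]]]
  have "(\<Oplus>\<^bsub>TT\<^esub>e\<in>edges H1. incidence H1 v e \<odot>\<^bsub>TT\<^esub> tens_prod A B (edges H2) b d e f) =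
        (\<Oplus>\<^bsub>TT\<^esub>w\<in>verts H3. incidence H3 w f \<odot>\<^bsub>TT\<^esub> tens_prod A B (verts H2) a c v w)"
    if v: "v \<in> verts H1" and f: "f \<in> edges H3" for v f
  proof -
    note sm = smult_finsum[OF T.star_algebra]
    have "(\<Oplus>\<^bsub>TT\<^esub>e\<in>edges H1. incidence H1 v e \<odot>\<^bsub>TT\<^esub> tens_prod A B (edges H2) b d e f) =
      (\<Oplus>\<^bsub>TT\<^esub>e\<in>edges H1. \<Oplus>\<^bsub>TT\<^esub>g\<in>edges H2. tens A B (incidence H1 v e \<odot>\<^bsub>A\<^esub> b e g) (d g f))"
    proof (rule T.finsum_cong'[OF refl])
      fix e assume e: "e \<in> edges H1"
      have "incidence H1 v e \<odot>\<^bsub>TT\<^esub> tens_prod A B (edges H2) b d e f =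
        (\<Oplus>\<^bsub>TT\<^esub>g\<in>edges H2. incidence H1 v e \<odot>\<^bsub>TT\<^esub> tens A B (b e g) (d g f))"
        unfolding tens_prod_def using e f fin by (intro sm) (auto simp: bc dc tc)
      also have "\<dots> = (\<Oplus>\<^bsub>TT\<^esub>g\<in>edges H2. tens A B (incidence H1 v e \<odot>\<^bsub>A\<^esub> b e g) (d g f))"
        by (rule T.finsum_cong'[OF refl]) (use e f in \<open>auto simp: bc dc tc sl\<close>)
      finally show "incidence H1 v e \<odot>\<^bsub>TT\<^esub> tens_prod A B (edges H2) b d e f =
        (\<Oplus>\<^bsub>TT\<^esub>g\<in>edges H2. tens A B (incidence H1 v e \<odot>\<^bsub>A\<^esub> b e g) (d g f))" .
    qed (use f in \<open>auto simp: bc dc tc intro!: T.finsum_closed\<close>)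
    also have "\<dots> = (\<Oplus>\<^bsub>TT\<^esub>g\<in>edges H2. \<Oplus>\<^bsub>TT\<^esub>e\<in>edges H1. tens A B (incidence H1 v e \<odot>\<^bsub>A\<^esub> b e g) (d g f))"
      using f fin by (intro finsum_swap T.abelian_monoid_axioms) (auto simp: bc dc tc)
    also have "\<dots> = (\<Oplus>\<^bsub>TT\<^esub>g\<in>edges H2. tens A B (\<Oplus>\<^bsub>A\<^esub>e\<in>edges H1. incidence H1 v e \<odot>\<^bsub>A\<^esub> b e g) (d g f))"
      using f fin by (intro T.finsum_cong' refl)
        (auto simp: bc dc tc tens_finsum_left[OF A B] intro!: A.finsum_closed T.finsum_closed)
    also have "\<dots> = (\<Oplus>\<^bsub>TT\<^esub>g\<in>edges H2. tens A B (\<Oplus>\<^bsub>A\<^esub>x\<in>verts H2. incidence H2 x g \<odot>\<^bsub>A\<^esub> a v x) (d g f))"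
      using v f fin by (intro T.finsum_cong' refl)
        (auto simp: game_pair_intertwines[OF ab] ac dc intro!: A.finsum_closed tc)
    also have "\<dots> = (\<Oplus>\<^bsub>TT\<^esub>g\<in>edges H2. \<Oplus>\<^bsub>TT\<^esub>x\<in>verts H2. tens A B (a v x) (incidence H2 x g \<odot>\<^bsub>B\<^esub> d g f))"
    proof (rule T.finsum_cong'[OF refl])
      fix g assume g: "g \<in> edges H2"
      have "tens A B (\<Oplus>\<^bsub>A\<^esub>x\<in>verts H2. incidence H2 x g \<odot>\<^bsub>A\<^esub> a v x) (d g f) =
        (\<Oplus>\<^bsub>TT\<^esub>x\<in>verts H2. tens A B (incidence H2 x g \<odot>\<^bsub>A\<^esub> a v x) (d g f))"
        using v f g fin by (intro tens_finsum_left[OF A B]) (auto simp: ac dc)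
      also have "\<dots> = (\<Oplus>\<^bsub>TT\<^esub>x\<in>verts H2. tens A B (a v x) (incidence H2 x g \<odot>\<^bsub>B\<^esub> d g f))"
        by (rule T.finsum_cong'[OF refl]) (use v f g in \<open>auto simp: ac dc tc sl sr\<close>)
      finally show "tens A B (\<Oplus>\<^bsub>A\<^esub>x\<in>verts H2. incidence H2 x g \<odot>\<^bsub>A\<^esub> a v x) (d g f) =
        (\<Oplus>\<^bsub>TT\<^esub>x\<in>verts H2. tens A B (a v x) (incidence H2 x g \<odot>\<^bsub>B\<^esub> d g f))" .
    qed (use v f in \<open>auto simp: ac dc tc intro!: T.finsum_closed\<close>)
    also have "\<dots> = (\<Oplus>\<^bsub>TT\<^esub>x\<in>verts H2. \<Oplus>\<^bsub>TT\<^esub>g\<in>edges H2. tens A B (a v x) (incidence H2 x g \<odot>\<^bsub>B\<^esub> d g f))"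
      using v f fin by (intro finsum_swap T.abelian_monoid_axioms) (auto simp: ac dc tc)
    also have "\<dots> = (\<Oplus>\<^bsub>TT\<^esub>x\<in>verts H2. tens A B (a v x) (\<Oplus>\<^bsub>B\<^esub>g\<in>edges H2. incidence H2 x g \<odot>\<^bsub>B\<^esub> d g f))"
      using v f fin by (intro T.finsum_cong' refl)
        (auto simp: ac dc tc tens_finsum_right[OF A B] intro!: B.finsum_closed T.finsum_closed)
    also have "\<dots> = (\<Oplus>\<^bsub>TT\<^esub>x\<in>verts H2. tens A B (a v x) (\<Oplus>\<^bsub>B\<^esub>w\<in>verts H3. incidence H3 w f \<odot>\<^bsub>B\<^esub> c x w))"
      using v f fin by (intro T.finsum_cong' refl)
        (auto simp: game_pair_intertwines[OF cd] ac cc intro!: B.finsum_closed tc)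
    also have "\<dots> = (\<Oplus>\<^bsub>TT\<^esub>x\<in>verts H2. \<Oplus>\<^bsub>TT\<^esub>w\<in>verts H3. tens A B (a v x) (incidence H3 w f \<odot>\<^bsub>B\<^esub> c x w))"
      using v f fin by (intro T.finsum_cong' refl)
        (auto simp: ac cc tc tens_finsum_right[OF A B] intro!: B.finsum_closed T.finsum_closed)
    also have "\<dots> = (\<Oplus>\<^bsub>TT\<^esub>w\<in>verts H3. \<Oplus>\<^bsub>TT\<^esub>x\<in>verts H2. tens A B (a v x) (incidence H3 w f \<odot>\<^bsub>B\<^esub> c x w))"
      using v f fin by (intro finsum_swap T.abelian_monoid_axioms) (auto simp: ac cc tc)
    also have "\<dots> = (\<Oplus>\<^bsub>TT\<^esub>w\<in>verts H3. incidence H3 w f \<odot>\<^bsub>TT\<^esub> tens_prod A B (verts H2) a c v w)"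
    proof (rule T.finsum_cong'[OF refl])
      fix w assume w: "w \<in> verts H3"
      have "incidence H3 w f \<odot>\<^bsub>TT\<^esub> tens_prod A B (verts H2) a c v w =
        (\<Oplus>\<^bsub>TT\<^esub>x\<in>verts H2. incidence H3 w f \<odot>\<^bsub>TT\<^esub> tens A B (a v x) (c x w))"
        unfolding tens_prod_def using v w fin by (intro sm) (auto simp: ac cc tc)
      also have "\<dots> = (\<Oplus>\<^bsub>TT\<^esub>x\<in>verts H2. tens A B (a v x) (incidence H3 w f \<odot>\<^bsub>B\<^esub> c x w))"
        by (rule T.finsum_cong'[OF refl]) (use v w in \<open>auto simp: ac cc tc sr\<close>)
      finally show "(\<Oplus>\<^bsub>TT\<^esub>x\<in>verts H2. tens A B (a v x) (incidence H3 w f \<odot>\<^bsub>B\<^esub> c x w)) =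
        incidence H3 w f \<odot>\<^bsub>TT\<^esub> tens_prod A B (verts H2) a c v w" by (rule sym)
    qed (use v in \<open>auto simp: ac cc tc tens_prod_def intro!: T.finsum_closed\<close>)
    finally show ?thesis .
  qed
  then show ?thesis
    unfolding game_pair_def
    using tens_prod_magic[OF fin(1,2,3) game_pair_verts[OF ab] game_pair_verts[OF cd]]
      tens_prod_magic[OF fin(4,5,6) game_pair_edges[OF ab] game_pair_edges[OF cd]] by blast
qed

end

lemma opposite_simps [simp]:
  "carrier (opposite_alg A) = carrier A" "one (opposite_alg A) = one A" "zero (opposite_alg A) = zero A"
  "add (opposite_alg A) = add A" "smult (opposite_alg A) = smult A" "adj (opposite_alg A) = adj A"
  "x \<otimes>\<^bsub>opposite_alg A\<^esub> y = y \<otimes>\<^bsub>A\<^esub> x"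
  by (simp_all add: opposite_alg_def)

lemma finsum_opposite [simp]: "finsum (opposite_alg A) f I = finsum A f I"
  by (simp add: finsum_def)

lemma linear_on_opposite [simp]: "linear_on A (opposite_alg B) h \<longleftrightarrow> linear_on A B h"
  by (simp add: linear_on_def)

lemma star_algebra_opposite:
  assumes A: "star_algebra A"
  shows "star_algebra (opposite_alg A)"
proof -
  interpret A: star_alg_ring A by (rule star_alg_ringI[OF A])
  show ?thesis
  proof (rule star_algebraI)
    show "ring (opposite_alg A)"
    proof (rule ringI)
      show "abelian_group (opposite_alg A)"
      proof (rule abelian_groupI)
        fix x assume "x \<in> carrier (opposite_alg A)"
        then show "\<exists>y\<in>carrier (opposite_alg A). y \<oplus>\<^bsub>opposite_alg A\<^esub> x = \<zero>\<^bsub>opposite_alg A\<^esub>"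
          by (intro bexI[of _ "\<ominus>\<^bsub>A\<^esub> x"]) (simp_all add: A.l_neg)
      qed (simp_all add: A.a_ac)
      show "Group.monoid (opposite_alg A)" by (rule monoidI) (simp_all add: A.m_assoc)
    qed (simp_all add: A.l_distr A.r_distr)
  qed (simp_all add: A.smult_add_scalar A.smult_add_vector A.smult_smult A.smult_mult_l A.smult_mult_r
      A.adj_adj A.adj_add A.adj_smult A.adj_mult)
qed

lemma magic_transpose:
  "magic_unitary A I J p \<Longrightarrow> magic_unitary (opposite_alg A) J I (\<lambda>j i. p i j)"
  unfolding magic_unitary_def by auto

text \<open>Multiplying $A_1 P_E = P_V A_2$ by $P_V^t$ from the left and by $P_E^t$ from the right gives
  $P_V^t A_1 = A_2 P_E^t$.  Entrywise, multiplying the relation for $(v,f)$ by $p_{v,w}$ on the left and by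
  $p_{e,f}$ on the right leaves one term on each side (\<open>key\<close>); summing over $v$ and $f$ gives the claim.  The
  intertwining relation involves no products and so does not see that the multiplication is reversed.\<close>

lemma game_pair_transpose:
  assumes A: "star_algebra A" and full: "full_hypergraph H1" "full_hypergraph H2"
    and ab: "game_pair A H1 H2 a b"
  shows "game_pair (opposite_alg A) H2 H1 (\<lambda>w v. a v w) (\<lambda>f e. b e f)"
proof -
  interpret A: star_alg_ring A by (rule star_alg_ringI[OF A])
  have fin: "finite (verts H1)" "finite (verts H2)" "finite (edges H1)" "finite (edges H2)"
    using full by (auto simp: full_hypergraph_def)
  note a = game_pair_verts[OF ab] and b = game_pair_edges[OF ab]
  note ac = magic_closed[OF a] and bc = magic_closed[OF b]
  have key: "incidence H1 v e \<odot>\<^bsub>A\<^esub> (a v w \<otimes>\<^bsub>A\<^esub> b e f) = incidence H2 w f \<odot>\<^bsub>A\<^esub> (a v w \<otimes>\<^bsub>A\<^esub> b e f)"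
    if "v \<in> verts H1" "w \<in> verts H2" "e \<in> edges H1" "f \<in> edges H2" for v w e f
  proof -
    have "(\<Oplus>\<^bsub>A\<^esub>e'\<in>edges H1. incidence H1 v e' \<odot>\<^bsub>A\<^esub> b e' f) \<otimes>\<^bsub>A\<^esub> b e f =
       (\<Oplus>\<^bsub>A\<^esub>e'\<in>edges H1. if e = e' then incidence H1 v e' \<odot>\<^bsub>A\<^esub> b e' f else \<zero>\<^bsub>A\<^esub>)"
      using that fin by (subst A.finsum_ldistr)
        (auto simp: bc A.smult_mult_l magic_col[OF b] intro!: A.finsum_cong')
    also have "\<dots> = incidence H1 v e \<odot>\<^bsub>A\<^esub> b e f"
      using that fin by (intro A.finsum_delta) (auto simp: bc)
    finally have 1: "(\<Oplus>\<^bsub>A\<^esub>e'\<in>edges H1. incidence H1 v e' \<odot>\<^bsub>A\<^esub> b e' f) \<otimes>\<^bsub>A\<^esub> b e f = incidence H1 v e \<odot>\<^bsub>A\<^esub> b e f" .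
    have "a v w \<otimes>\<^bsub>A\<^esub> (\<Oplus>\<^bsub>A\<^esub>w'\<in>verts H2. incidence H2 w' f \<odot>\<^bsub>A\<^esub> a v w') =
       (\<Oplus>\<^bsub>A\<^esub>w'\<in>verts H2. if w = w' then incidence H2 w' f \<odot>\<^bsub>A\<^esub> a v w' else \<zero>\<^bsub>A\<^esub>)"
      using that fin by (subst A.finsum_rdistr)
        (auto simp: ac A.smult_mult_r magic_row[OF a] intro!: A.finsum_cong')
    also have "\<dots> = incidence H2 w f \<odot>\<^bsub>A\<^esub> a v w"
      using that fin by (intro A.finsum_delta) (auto simp: ac)
    finally have 2: "a v w \<otimes>\<^bsub>A\<^esub> (\<Oplus>\<^bsub>A\<^esub>w'\<in>verts H2. incidence H2 w' f \<odot>\<^bsub>A\<^esub> a v w') = incidence H2 w f \<odot>\<^bsub>A\<^esub> a v w" .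
    have c: "(\<Oplus>\<^bsub>A\<^esub>w'\<in>verts H2. incidence H2 w' f \<odot>\<^bsub>A\<^esub> a v w') \<in> carrier A"
      using that by (intro A.finsum_closed) (auto simp: ac)
    have "incidence H1 v e \<odot>\<^bsub>A\<^esub> (a v w \<otimes>\<^bsub>A\<^esub> b e f) =
      a v w \<otimes>\<^bsub>A\<^esub> ((\<Oplus>\<^bsub>A\<^esub>w'\<in>verts H2. incidence H2 w' f \<odot>\<^bsub>A\<^esub> a v w') \<otimes>\<^bsub>A\<^esub> b e f)"
      using that 1 by (simp add: ac bc A.smult_mult_r game_pair_intertwines[OF ab])
    also have "\<dots> = (a v w \<otimes>\<^bsub>A\<^esub> (\<Oplus>\<^bsub>A\<^esub>w'\<in>verts H2. incidence H2 w' f \<odot>\<^bsub>A\<^esub> a v w')) \<otimes>\<^bsub>A\<^esub> b e f"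
      using that c by (simp add: A.m_assoc ac bc)
    also have "\<dots> = incidence H2 w f \<odot>\<^bsub>A\<^esub> (a v w \<otimes>\<^bsub>A\<^esub> b e f)"
      using that by (simp add: 2 A.smult_mult_l ac bc)
    finally show ?thesis .
  qed
  have "(\<Oplus>\<^bsub>A\<^esub>f\<in>edges H2. incidence H2 w f \<odot>\<^bsub>A\<^esub> b e f) = (\<Oplus>\<^bsub>A\<^esub>v\<in>verts H1. incidence H1 v e \<odot>\<^bsub>A\<^esub> a v w)"
    if w: "w \<in> verts H2" and e: "e \<in> edges H1" for w e
  proof -
    have "(\<Oplus>\<^bsub>A\<^esub>f\<in>edges H2. incidence H2 w f \<odot>\<^bsub>A\<^esub> b e f) =
      (\<Oplus>\<^bsub>A\<^esub>f\<in>edges H2. (\<Oplus>\<^bsub>A\<^esub>v\<in>verts H1. a v w) \<otimes>\<^bsub>A\<^esub> (incidence H2 w f \<odot>\<^bsub>A\<^esub> b e f))"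
      using that by (intro A.finsum_cong') (auto simp: magic_col_sum[OF a] bc)
    also have "\<dots> = (\<Oplus>\<^bsub>A\<^esub>f\<in>edges H2. \<Oplus>\<^bsub>A\<^esub>v\<in>verts H1. incidence H2 w f \<odot>\<^bsub>A\<^esub> (a v w \<otimes>\<^bsub>A\<^esub> b e f))"
      using that fin by (intro A.finsum_cong' refl)
        (auto simp: A.finsum_ldistr ac bc A.smult_mult_r smult_finsum[OF A] intro!: A.finsum_cong' A.finsum_closed)
    also have "\<dots> = (\<Oplus>\<^bsub>A\<^esub>v\<in>verts H1. \<Oplus>\<^bsub>A\<^esub>f\<in>edges H2. incidence H2 w f \<odot>\<^bsub>A\<^esub> (a v w \<otimes>\<^bsub>A\<^esub> b e f))"
      using that fin by (intro finsum_swap A.abelian_monoid_axioms) (auto simp: ac bc)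
    also have "\<dots> = (\<Oplus>\<^bsub>A\<^esub>v\<in>verts H1. \<Oplus>\<^bsub>A\<^esub>f\<in>edges H2. incidence H1 v e \<odot>\<^bsub>A\<^esub> (a v w \<otimes>\<^bsub>A\<^esub> b e f))"
      using that by (intro A.finsum_cong' refl) (auto simp: key ac bc intro!: A.finsum_closed)
    also have "\<dots> = (\<Oplus>\<^bsub>A\<^esub>v\<in>verts H1. (incidence H1 v e \<odot>\<^bsub>A\<^esub> a v w) \<otimes>\<^bsub>A\<^esub> (\<Oplus>\<^bsub>A\<^esub>f\<in>edges H2. b e f))"
      using that fin by (intro A.finsum_cong' refl)
        (auto simp: A.finsum_rdistr ac bc A.smult_mult_l intro!: A.finsum_cong' A.finsum_closed)
    also have "\<dots> = (\<Oplus>\<^bsub>A\<^esub>v\<in>verts H1. incidence H1 v e \<odot>\<^bsub>A\<^esub> a v w)"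
      using that by (intro A.finsum_cong') (auto simp: magic_row_sum[OF b] ac)
    finally show ?thesis .
  qed
  then show ?thesis
    unfolding game_pair_def using magic_transpose[OF a] magic_transpose[OF b] by simp
qed

lemma finsum_cplx: "finite I \<Longrightarrow> finsum cplx g I = sum g I"
proof -
  interpret C: ring cplx by (rule star_algebra.ring_A[OF star_algebra_cplx])
  show "finite I \<Longrightarrow> finsum cplx g I = sum g I" by (induction I rule: finite_induct) auto
qed

lemma magic_identity: "finite I \<Longrightarrow> magic_unitary cplx I I (\<lambda>i j. if i = j then 1 else 0)"
  by (auto simp: magic_unitary_def finsum_cplx)

lemma game_pair_identity:
  assumes "full_hypergraph H"
  shows "game_pair cplx H H (\<lambda>v w. if v = w then 1 else 0) (\<lambda>e f. if e = f then 1 else 0)"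
proof -
  have "finite (verts H)" "finite (edges H)" using assms by (auto simp: full_hypergraph_def)
  then show ?thesis
    by (simp add: game_pair_def finsum_cplx magic_identity if_distrib[of "(*) _"] sum.delta sum.delta' cong: if_cong)
qed

section \<open>Cocomposition of game algebras\<close>

lemma lift_tens_prod:
  assumes A: "star_algebra A" and B: "star_algebra B" and C: "star_algebra C"
    and F: "linear_on (tensor_alg A B) C F" and fin: "finite K"
    and "\<And>k. k \<in> K \<Longrightarrow> p i k \<in> carrier A" "\<And>k. k \<in> K \<Longrightarrow> q k j \<in> carrier B"
  shows "F (tens_prod A B K p q i j) = (\<Oplus>\<^bsub>C\<^esub>k\<in>K. F (tens A B (p i k) (q k j)))"
  unfolding tens_prod_def
  by (rule linear_finsum[OF star_algebra_tensor[OF A B] C F fin]) (simp add: assms tens_closed[OF A B])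

lemma tens_prod_cong:
  assumes A: "star_algebra A" and B: "star_algebra B"
    and "\<And>k. k \<in> K \<Longrightarrow> p i k = p' i k" "\<And>k. k \<in> K \<Longrightarrow> q k j = q' k j"
    and "\<And>k. k \<in> K \<Longrightarrow> p' i k \<in> carrier A" "\<And>k. k \<in> K \<Longrightarrow> q' k j \<in> carrier B"
  shows "tens_prod A B K p q i j = tens_prod A B K p' q' i j"
proof -
  interpret TR: ring "tensor_alg A B" by (rule star_algebra.ring_A[OF star_algebra_tensor[OF A B]])
  show ?thesis unfolding tens_prod_def
    by (rule TR.finsum_cong') (use assms tens_closed[OF A B] in auto)
qed

lemma tens_prod_closed:
  assumes A: "star_algebra A" and B: "star_algebra B"
    and "\<And>k. k \<in> K \<Longrightarrow> p i k \<in> carrier A" "\<And>k. k \<in> K \<Longrightarrow> q k j \<in> carrier B"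
  shows "tens_prod A B K p q i j \<in> carrier (tensor_alg A B)"
proof -
  interpret TR: ring "tensor_alg A B" by (rule star_algebra.ring_A[OF star_algebra_tensor[OF A B]])
  show ?thesis unfolding tens_prod_def
    by (rule TR.finsum_closed) (use assms tens_closed[OF A B] in auto)
qed

lemma tensor_map_tens_prod:
  assumes A: "star_algebra A" and B: "star_algebra B" and C: "star_algebra C" and D: "star_algebra D"
    and f: "linear_on A C f" and g: "linear_on B D g" and fin: "finite K"
    and p: "\<And>k. k \<in> K \<Longrightarrow> p i k \<in> carrier A" and q: "\<And>k. k \<in> K \<Longrightarrow> q k j \<in> carrier B"
  shows "tensor_map C D f g (tens_prod A B K p q i j) =
    tens_prod C D K (\<lambda>i k. f (p i k)) (\<lambda>k j. g (q k j)) i j"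
proof -
  interpret TR: ring "tensor_alg C D" by (rule star_algebra.ring_A[OF star_algebra_tensor[OF C D]])
  have "tensor_map C D f g (tens_prod A B K p q i j) =
    (\<Oplus>\<^bsub>tensor_alg C D\<^esub>k\<in>K. tensor_map C D f g (tens A B (p i k) (q k j)))"
    by (rule lift_tens_prod[OF A B star_algebra_tensor[OF C D] tensor_map_linear[OF A B C D f g] fin])
       (use p q in auto)
  also have "\<dots> = (\<Oplus>\<^bsub>tensor_alg C D\<^esub>k\<in>K. tens C D (f (p i k)) (g (q k j)))"
    by (rule TR.finsum_cong'[OF refl])
       (use p q in \<open>auto simp: tensor_map_tens[OF A B C D f g] tens_closed[OF C D] linear_closed[OF f] linear_closed[OF g]\<close>)
  finally show ?thesis by (simp add: tens_prod_def)
qed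

lemma tens_prod_assoc:
  assumes A: "star_algebra A" and B: "star_algebra B" and C: "star_algebra C"
    and fin: "finite L" "finite K"
    and p: "\<And>l. l \<in> L \<Longrightarrow> p i l \<in> carrier A" and q: "\<And>l k. l \<in> L \<Longrightarrow> k \<in> K \<Longrightarrow> q l k \<in> carrier B"
    and r: "\<And>k. k \<in> K \<Longrightarrow> r k j \<in> carrier C"
  shows "tensor_assoc A B C (tens_prod (tensor_alg A B) C K (tens_prod A B L p q) r i j) =
    tens_prod A (tensor_alg B C) L p (tens_prod B C K q r) i j"
proof -
  let ?AB = "tensor_alg A B" and ?BC = "tensor_alg B C" and ?T = "tensor_alg A (tensor_alg B C)"
  note AB = star_algebra_tensor[OF A B] and BC = star_algebra_tensor[OF B C]
  note T = star_algebra_tensor[OF A BC]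
  interpret TR: ring ?T by (rule star_algebra.ring_A[OF T])
  note tc = tens_closed[OF A B] tens_closed[OF B C] tens_closed[OF A BC] tens_closed[OF AB C]
  have "tensor_assoc A B C (tens_prod ?AB C K (tens_prod A B L p q) r i j) =
    (\<Oplus>\<^bsub>?T\<^esub>k\<in>K. tensor_assoc A B C (tens ?AB C (tens_prod A B L p q i k) (r k j)))"
    by (rule lift_tens_prod[OF AB C T tensor_assoc_linear[OF A B C] fin(2)])
       (use p q r in \<open>auto intro!: tens_prod_closed[OF A B]\<close>)
  also have "\<dots> = (\<Oplus>\<^bsub>?T\<^esub>k\<in>K. \<Oplus>\<^bsub>?T\<^esub>l\<in>L. tens A ?BC (p i l) (tens B C (q l k) (r k j)))"
  proof (rule TR.finsum_cong'[OF refl])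
    fix k assume k: "k \<in> K"
    have lin: "linear_on ?AB ?T (\<lambda>t. tensor_assoc A B C (tens ?AB C t (r k j)))"
      by (rule linear_compose[OF bilinear_left[OF bilinear_tens[OF AB C] r[OF k]] tensor_assoc_linear[OF A B C]])
    have "tensor_assoc A B C (tens ?AB C (tens_prod A B L p q i k) (r k j)) =
      (\<Oplus>\<^bsub>?T\<^esub>l\<in>L. tensor_assoc A B C (tens ?AB C (tens A B (p i l) (q l k)) (r k j)))"
      by (rule lift_tens_prod[OF A B T lin fin(1)]) (use p q k in auto)
    also have "\<dots> = (\<Oplus>\<^bsub>?T\<^esub>l\<in>L. tens A ?BC (p i l) (tens B C (q l k) (r k j)))"
      by (rule TR.finsum_cong'[OF refl]) (use p q r k in \<open>auto simp: tensor_assoc_tens[OF A B C] tc\<close>)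
    finally show "tensor_assoc A B C (tens ?AB C (tens_prod A B L p q i k) (r k j)) =
      (\<Oplus>\<^bsub>?T\<^esub>l\<in>L. tens A ?BC (p i l) (tens B C (q l k) (r k j)))" .
  qed (use p q r in \<open>auto simp: tc intro!: TR.finsum_closed\<close>)
  also have "\<dots> = (\<Oplus>\<^bsub>?T\<^esub>l\<in>L. \<Oplus>\<^bsub>?T\<^esub>k\<in>K. tens A ?BC (p i l) (tens B C (q l k) (r k j)))"
    by (rule finsum_swap[OF star_algebra.abelian_monoid_A[OF T] fin(2,1)]) (use p q r in \<open>auto simp: tc\<close>)
  also have "\<dots> = (\<Oplus>\<^bsub>?T\<^esub>l\<in>L. tens A ?BC (p i l) (tens_prod B C K q r l j))"
  proof (rule TR.finsum_cong'[OF refl])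
    fix l assume l: "l \<in> L"
    show "(\<Oplus>\<^bsub>?T\<^esub>k\<in>K. tens A ?BC (p i l) (tens B C (q l k) (r k j))) = tens A ?BC (p i l) (tens_prod B C K q r l j)"
      by (rule lift_tens_prod[OF B C T bilinear_right[OF bilinear_tens[OF A BC] p[OF l]] fin(2), symmetric])
         (use q r l in auto)
  qed (use p q r in \<open>auto intro!: tc tens_prod_closed[OF B C]\<close>)
  finally show ?thesis by (simp add: tens_prod_def[of A])
qed

text \<open>Both iterated products equal the triple product $\sum_{l,k} p_{il} \otimes q_{lk} \otimes r_{kj}$.  The
  matrices \<open>s\<close> and \<open>t\<close> are the generators that \<open>f\<close> and \<open>g\<close> expand.\<close>

lemma coassoc_entry:
  assumes A: "star_algebra A" and B: "star_algebra B" and C: "star_algebra C"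
    and X: "star_algebra X" and Y: "star_algebra Y"
    and f: "linear_on X (tensor_alg A B) f" and g: "linear_on Y (tensor_alg B C) g"
    and fin: "finite L" "finite K"
    and p: "\<And>l. l \<in> L \<Longrightarrow> p i l \<in> carrier A" and q: "\<And>l k. l \<in> L \<Longrightarrow> k \<in> K \<Longrightarrow> q l k \<in> carrier B"
    and r: "\<And>k. k \<in> K \<Longrightarrow> r k j \<in> carrier C"
    and s: "\<And>k. k \<in> K \<Longrightarrow> s i k \<in> carrier X" and t: "\<And>l. l \<in> L \<Longrightarrow> t l j \<in> carrier Y"
    and fs: "\<And>k. k \<in> K \<Longrightarrow> f (s i k) = tens_prod A B L p q i k"
    and gt: "\<And>l. l \<in> L \<Longrightarrow> g (t l j) = tens_prod B C K q r l j"
  shows "tensor_assoc A B C (tensor_map (tensor_alg A B) C f id (tens_prod X C K s r i j)) =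
    tensor_map A (tensor_alg B C) id g (tens_prod A Y L p t i j)"
proof -
  note AB = star_algebra_tensor[OF A B] and BC = star_algebra_tensor[OF B C] and id = hom_linear[OF hom_id]
  have "tensor_map (tensor_alg A B) C f id (tens_prod X C K s r i j) =
      tens_prod (tensor_alg A B) C K (\<lambda>i k. f (s i k)) (\<lambda>k j. id (r k j)) i j"
    by (rule tensor_map_tens_prod[OF X C AB C f id fin(2)]) (use s r in auto)
  also have "\<dots> = tens_prod (tensor_alg A B) C K (tens_prod A B L p q) r i j"
    by (rule tens_prod_cong[OF AB C]) (use p q r fs in \<open>auto intro!: tens_prod_closed[OF A B]\<close>)
  finally have 1: "tensor_map (tensor_alg A B) C f id (tens_prod X C K s r i j) =
      tens_prod (tensor_alg A B) C K (tens_prod A B L p q) r i j" .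
  have "tensor_map A (tensor_alg B C) id g (tens_prod A Y L p t i j) =
      tens_prod A (tensor_alg B C) L (\<lambda>i l. id (p i l)) (\<lambda>l j. g (t l j)) i j"
    by (rule tensor_map_tens_prod[OF A Y A BC id g fin(1)]) (use p t in auto)
  also have "\<dots> = tens_prod A (tensor_alg B C) L p (tens_prod B C K q r) i j"
    by (rule tens_prod_cong[OF A BC]) (use p q r gt in \<open>auto intro!: tens_prod_closed[OF B C]\<close>)
  also have "\<dots> = tensor_assoc A B C (tens_prod (tensor_alg A B) C K (tens_prod A B L p q) r i j)"
    by (rule tens_prod_assoc[symmetric, OF A B C fin]) (use p q r in auto)
  finally show ?thesis by (simp only: 1)
qed

lemma counit_left_entry:
  assumes A: "star_algebra A" and Z: "star_algebra Z" and F: "linear_on (tensor_alg A Z) Z F"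
    and val: "\<And>a z. a \<in> carrier A \<Longrightarrow> z \<in> carrier Z \<Longrightarrow> F (tens A Z a z) = e a \<odot>\<^bsub>Z\<^esub> z"
    and K: "finite K" "v \<in> K" and u: "\<And>k. k \<in> K \<Longrightarrow> u v k \<in> carrier A" and q: "\<And>k. k \<in> K \<Longrightarrow> q k w \<in> carrier Z"
    and e: "\<And>k. k \<in> K \<Longrightarrow> e (u v k) = (if v = k then 1 else 0)"
  shows "F (tens_prod A Z K u q v w) = q v w"
proof -
  interpret Z: star_alg_ring Z by (rule star_alg_ringI[OF Z])
  have "F (tens_prod A Z K u q v w) = (\<Oplus>\<^bsub>Z\<^esub>k\<in>K. F (tens A Z (u v k) (q k w)))"
    by (rule lift_tens_prod[OF A Z Z F K(1)]) (use u q in auto)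
  also have "\<dots> = (\<Oplus>\<^bsub>Z\<^esub>k\<in>K. if v = k then q k w else \<zero>\<^bsub>Z\<^esub>)"
    by (rule Z.finsum_cong'[OF refl]) (use u q e in \<open>auto simp: val\<close>)
  also have "\<dots> = q v w" by (rule Z.finsum_delta) (use K q in auto)
  finally show ?thesis .
qed

text \<open>The structure maps between the game algebras of different pairs of hypergraphs.  For equal hypergraphs they are
  the structure maps of the quantum automorphism group.\<close>

definition game_comult where
  "game_comult H1 H2 H3 =
     (let A = game_alg H1 H2; B = game_alg H2 H3 in
      game_hom (tensor_alg A B) (tens_prod A B (verts H2) (gen_vtx H1 H2) (gen_vtx H2 H3))
        (tens_prod A B (edges H2) (gen_edg H1 H2) (gen_edg H2 H3)))"

definition game_counit :: "('v, 'e) hypergraph \<Rightarrow> ('v, 'e, 'v, 'e) game_poly set \<Rightarrow> complex" where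
  "game_counit H = game_hom cplx (\<lambda>v w. if v = w then 1 else 0) (\<lambda>e f. if e = f then 1 else 0)"

definition game_antipode where
  "game_antipode H1 H2 = game_hom (opposite_alg (game_alg H2 H1))
     (\<lambda>v w. gen_vtx H2 H1 w v) (\<lambda>e f. gen_edg H2 H1 f e)"

lemma hypergraph_finite: "full_hypergraph H \<Longrightarrow> finite (verts H)" "full_hypergraph H \<Longrightarrow> finite (edges H)"
  by (auto simp: full_hypergraph_def)

lemma star_algebra_game: "full_hypergraph H1 \<Longrightarrow> full_hypergraph H2 \<Longrightarrow> star_algebra (game_alg H1 H2)"
  by (rule hypergraph_pair.Z[OF hypergraph_pair.intro])

lemma
  assumes "full_hypergraph H1" "full_hypergraph H2"
  shows vtx_closed: "v \<in> verts H1 \<Longrightarrow> w \<in> verts H2 \<Longrightarrow> gen_vtx H1 H2 v w \<in> carrier (game_alg H1 H2)"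
    and edg_closed: "e \<in> edges H1 \<Longrightarrow> f \<in> edges H2 \<Longrightarrow> gen_edg H1 H2 e f \<in> carrier (game_alg H1 H2)"
    and gens_pair: "game_pair (game_alg H1 H2) H1 H2 (gen_vtx H1 H2) (gen_edg H1 H2)"
  using hypergraph_pair.gen_closed[OF hypergraph_pair.intro[OF assms]]
    hypergraph_pair.gen_game_pair[OF hypergraph_pair.intro[OF assms]] by auto

context
  fixes H1 :: "('v1, 'e1) hypergraph" and H2 :: "('v2, 'e2) hypergraph" and H3 :: "('v3, 'e3) hypergraph"
  assumes full: "full_hypergraph H1" "full_hypergraph H2" "full_hypergraph H3"
begin

private lemma comult_pair: "game_pair (tensor_alg (game_alg H1 H2) (game_alg H2 H3)) H1 H3
    (tens_prod (game_alg H1 H2) (game_alg H2 H3) (verts H2) (gen_vtx H1 H2) (gen_vtx H2 H3))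
    (tens_prod (game_alg H1 H2) (game_alg H2 H3) (edges H2) (gen_edg H1 H2) (gen_edg H2 H3))"
  by (rule tens_prod_game_pair[OF star_algebra_game[OF full(1,2)] star_algebra_game[OF full(2,3)] full
      gens_pair[OF full(1,2)] gens_pair[OF full(2,3)]])

lemma comult_hom: "unital_star_hom (game_alg H1 H3) (tensor_alg (game_alg H1 H2) (game_alg H2 H3))
    (game_comult H1 H2 H3)"
  unfolding game_comult_def Let_def
  by (rule hypergraph_pair.game_hom_hom[OF hypergraph_pair.intro[OF full(1,3)]
      star_algebra_tensor[OF star_algebra_game[OF full(1,2)] star_algebra_game[OF full(2,3)]] comult_pair])

lemmas comult_gen = hypergraph_pair.game_hom_gen[OF hypergraph_pair.intro[OF full(1,3)]
      star_algebra_tensor[OF star_algebra_game[OF full(1,2)] star_algebra_game[OF full(2,3)]] comult_pair,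
      folded game_comult_def[unfolded Let_def]]

end

text \<open>The four hypergraphs are arbitrary; repetitions among them give coassociativity, the comodule laws, the compatibility
  of the coactions and the identities needed for the Galois maps.\<close>

lemma comult_coassoc:
  assumes full: "full_hypergraph H1" "full_hypergraph H2" "full_hypergraph H3" "full_hypergraph H4"
    and x: "x \<in> carrier (game_alg H1 H4)"
  shows "tensor_assoc (game_alg H1 H2) (game_alg H2 H3) (game_alg H3 H4)
      (tensor_map (tensor_alg (game_alg H1 H2) (game_alg H2 H3)) (game_alg H3 H4) (game_comult H1 H2 H3) id
        (game_comult H1 H3 H4 x)) =
    tensor_map (game_alg H1 H2) (tensor_alg (game_alg H2 H3) (game_alg H3 H4)) id (game_comult H2 H3 H4)
      (game_comult H1 H2 H4 x)"
proof -
  let ?A = "game_alg H1 H2" and ?B = "game_alg H2 H3" and ?C = "game_alg H3 H4"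
  let ?AB = "tensor_alg ?A ?B" and ?BC = "tensor_alg ?B ?C"
  note A = star_algebra_game[OF full(1,2)] and B = star_algebra_game[OF full(2,3)]
    and C = star_algebra_game[OF full(3,4)]
  note AB = star_algebra_tensor[OF A B] and BC = star_algebra_tensor[OF B C]
  note X = star_algebra_game[OF full(1,3)] and Y = star_algebra_game[OF full(2,4)]
  note h1 = comult_hom[OF full(1,3,4)] and h2 = comult_hom[OF full(1,2,3)]
    and h3 = comult_hom[OF full(1,2,4)] and h4 = comult_hom[OF full(2,3,4)]
  note g1 = comult_gen[OF full(1,3,4)] and g2 = comult_gen[OF full(1,2,3)]
    and g3 = comult_gen[OF full(1,2,4)] and g4 = comult_gen[OF full(2,3,4)]
  note fin = hypergraph_finite[OF full(2)] hypergraph_finite[OF full(3)]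
  note cl = vtx_closed[OF full(1,2)] vtx_closed[OF full(2,3)] vtx_closed[OF full(3,4)]
    vtx_closed[OF full(1,3)] vtx_closed[OF full(2,4)]
    edg_closed[OF full(1,2)] edg_closed[OF full(2,3)] edg_closed[OF full(3,4)]
    edg_closed[OF full(1,3)] edg_closed[OF full(2,4)]
  show ?thesis
  proof (rule hypergraph_pair.game_hom_eqI[OF hypergraph_pair.intro[OF full(1,4)]
        hom_compose[OF hom_compose[OF h1 tensor_map_hom[OF X C AB C h2 hom_id]] tensor_assoc_hom[OF A B C]]
        hom_compose[OF h3 tensor_map_hom[OF A Y A BC hom_id h4]] _ _ x])
    fix v w assume vw: "v \<in> verts H1" "w \<in> verts H4"
    show "tensor_assoc ?A ?B ?C (tensor_map ?AB ?C (game_comult H1 H2 H3) id (game_comult H1 H3 H4 (gen_vtx H1 H4 v w))) =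
      tensor_map ?A ?BC id (game_comult H2 H3 H4) (game_comult H1 H2 H4 (gen_vtx H1 H4 v w))"
      unfolding g1(1)[OF vw] g3(1)[OF vw]
      by (rule coassoc_entry[OF A B C X Y hom_linear[OF h2] hom_linear[OF h4] fin(1,3)]) (use vw cl g2 g4 in auto)
  next
    fix e f assume ef: "e \<in> edges H1" "f \<in> edges H4"
    show "tensor_assoc ?A ?B ?C (tensor_map ?AB ?C (game_comult H1 H2 H3) id (game_comult H1 H3 H4 (gen_edg H1 H4 e f))) =
      tensor_map ?A ?BC id (game_comult H2 H3 H4) (game_comult H1 H2 H4 (gen_edg H1 H4 e f))"
      unfolding g1(2)[OF ef] g3(2)[OF ef]
      by (rule coassoc_entry[OF A B C X Y hom_linear[OF h2] hom_linear[OF h4] fin(2,4)]) (use ef cl g2 g4 in auto)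
  qed
qed

lemma
  assumes "full_hypergraph H"
  shows counit_hom: "unital_star_hom (game_alg H H) cplx (game_counit H)"
    and counit_vtx: "v \<in> verts H \<Longrightarrow> w \<in> verts H \<Longrightarrow> game_counit H (gen_vtx H H v w) = (if v = w then 1 else 0)"
    and counit_edg: "e \<in> edges H \<Longrightarrow> f \<in> edges H \<Longrightarrow> game_counit H (gen_edg H H e f) = (if e = f then 1 else 0)"
  unfolding game_counit_def
  using hypergraph_pair.game_hom_hom[OF hypergraph_pair.intro[OF assms assms] star_algebra_cplx game_pair_identity[OF assms]]
    hypergraph_pair.game_hom_gen[OF hypergraph_pair.intro[OF assms assms] star_algebra_cplx game_pair_identity[OF assms]]
  by auto

lemma
  assumes full: "full_hypergraph H1" "full_hypergraph H2"
  shows antipode_hom: "unital_star_hom (game_alg H1 H2) (opposite_alg (game_alg H2 H1)) (game_antipode H1 H2)"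
    and antipode_vtx: "v \<in> verts H1 \<Longrightarrow> w \<in> verts H2 \<Longrightarrow> game_antipode H1 H2 (gen_vtx H1 H2 v w) = gen_vtx H2 H1 w v"
    and antipode_edg: "e \<in> edges H1 \<Longrightarrow> f \<in> edges H2 \<Longrightarrow> game_antipode H1 H2 (gen_edg H1 H2 e f) = gen_edg H2 H1 f e"
proof -
  note hp = hypergraph_pair.intro[OF full]
  note B = star_algebra_opposite[OF star_algebra_game[OF full(2,1)]]
  note pair = game_pair_transpose[OF star_algebra_game[OF full(2,1)] full(2,1) gens_pair[OF full(2,1)]]
  show "unital_star_hom (game_alg H1 H2) (opposite_alg (game_alg H2 H1)) (game_antipode H1 H2)"
    unfolding game_antipode_def by (rule hypergraph_pair.game_hom_hom[OF hp B pair])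
  show "v \<in> verts H1 \<Longrightarrow> w \<in> verts H2 \<Longrightarrow> game_antipode H1 H2 (gen_vtx H1 H2 v w) = gen_vtx H2 H1 w v"
    "e \<in> edges H1 \<Longrightarrow> f \<in> edges H2 \<Longrightarrow> game_antipode H1 H2 (gen_edg H1 H2 e f) = gen_edg H2 H1 f e"
    unfolding game_antipode_def by (rule hypergraph_pair.game_hom_gen[OF hp B pair]; assumption)+
qed

lemma comult_counit_left:
  assumes full: "full_hypergraph H1" "full_hypergraph H2" and x: "x \<in> carrier (game_alg H1 H2)"
  shows "induced (game_alg H1 H2) (\<lambda>(a, y). game_counit H1 a \<odot>\<^bsub>game_alg H1 H2\<^esub> y) (game_comult H1 H1 H2 x) = x"
proof -
  let ?A = "game_alg H1 H1" and ?Z = "game_alg H1 H2"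
  note A = star_algebra_game[OF full(1,1)] and Z = star_algebra_game[OF full]
  interpret Z: star_alg_ring ?Z by (rule star_alg_ringI[OF Z])
  note e = counit_hom[OF full(1)]
  note bil = bilinear_smult[OF A Z Z hom_linear[OF e] hom_linear[OF hom_id], unfolded id_apply]
  have hom: "unital_star_hom (tensor_alg ?A ?Z) ?Z (induced ?Z (\<lambda>(a, y). game_counit H1 a \<odot>\<^bsub>?Z\<^esub> y))"
    by (rule tensor_lift_hom[OF A Z Z bil])
       (simp_all add: hom_mult[OF e] hom_one[OF e] hom_adj[OF e] Z.smult_mult_l Z.smult_mult_r Z.smult_smult Z.adj_smult mult.commute)
  note val = tensor_lift_tens[OF A Z Z bil] and g = comult_gen[OF full(1,1,2)]
  note entry = counit_left_entry[OF A Z hom_linear[OF hom] val]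
  note cl = vtx_closed[OF full(1,1)] edg_closed[OF full(1,1)] vtx_closed[OF full] edg_closed[OF full]
  show ?thesis
  proof (rule hypergraph_pair.game_hom_eqI[OF hypergraph_pair.intro[OF full] hom_compose[OF comult_hom[OF full(1,1,2)] hom] hom_id _ _ x, unfolded id_apply])
    fix v w assume vw: "v \<in> verts H1" "w \<in> verts H2"
    show "induced ?Z (\<lambda>(a, y). game_counit H1 a \<odot>\<^bsub>?Z\<^esub> y) (game_comult H1 H1 H2 (gen_vtx H1 H2 v w)) = gen_vtx H1 H2 v w"
      unfolding g(1)[OF vw] by (rule entry) (use vw cl hypergraph_finite full counit_vtx[OF full(1)] in auto)
  next
    fix e f assume ef: "e \<in> edges H1" "f \<in> edges H2"
    show "induced ?Z (\<lambda>(a, y). game_counit H1 a \<odot>\<^bsub>?Z\<^esub> y) (game_comult H1 H1 H2 (gen_edg H1 H2 e f)) = gen_edg H1 H2 e f"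
      unfolding g(2)[OF ef] by (rule entry) (use ef cl hypergraph_finite full counit_edg[OF full(1)] in auto)
  qed
qed

section \<open>The antipode\<close>

context
  fixes A :: "('a, 'm) star_alg_scheme" and B :: "('b, 'n) star_alg_scheme" and S
  assumes A: "star_algebra A" and B: "star_algebra B" and S: "unital_star_hom A (opposite_alg B) S"
begin

interpretation A: star_alg_ring A by (rule star_alg_ringI[OF A])
interpretation B: star_alg_ring B by (rule star_alg_ringI[OF B])

private lemma S_linear: "linear_on A B S"
  using hom_linear[OF S] by simp

private lemma S_closed: "a \<in> carrier A \<Longrightarrow> S a \<in> carrier B"
  by (rule linear_closed[OF S_linear])

private lemma S_mult: "a \<in> carrier A \<Longrightarrow> a' \<in> carrier A \<Longrightarrow> S (a \<otimes>\<^bsub>A\<^esub> a') = S a' \<otimes>\<^bsub>B\<^esub> S a"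
  using hom_mult[OF S] by simp

lemmas left_convolution_bilinear = bilinear_mult[OF A B B S_linear hom_linear[OF hom_id], unfolded id_apply]
lemmas right_convolution_bilinear = bilinear_mult[OF B A B hom_linear[OF hom_id] S_linear, unfolded id_apply]

private abbreviation (input) "L \<equiv> induced B (\<lambda>(a, b). S a \<otimes>\<^bsub>B\<^esub> b)"
private abbreviation (input) "R \<equiv> induced B (\<lambda>(b, a). b \<otimes>\<^bsub>B\<^esub> S a)"

lemmas left_convolution_linear = tensor_lift_linear[OF A B B left_convolution_bilinear]
lemmas left_convolution_tens = tensor_lift_tens[OF A B B left_convolution_bilinear]
lemmas right_convolution_linear = tensor_lift_linear[OF B A B right_convolution_bilinear]
lemmas right_convolution_tens = tensor_lift_tens[OF B A B right_convolution_bilinear]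

text \<open>The key to the antipode laws.  With $L(a \otimes b) = S(a) b$, antimultiplicativity of $S$ gives
  $L(U (a \otimes b)) = S(a) L(U) b$.  If $L(X)$ is a scalar $c$, it moves out of the middle and
  $L(X Y) = c L(Y)$.\<close>

lemma left_convolution_mult:
  assumes X: "X \<in> carrier (tensor_alg A B)" "L X = c \<odot>\<^bsub>B\<^esub> \<one>\<^bsub>B\<^esub>" and Y: "Y \<in> carrier (tensor_alg A B)"
  shows "L (X \<otimes>\<^bsub>tensor_alg A B\<^esub> Y) = c \<odot>\<^bsub>B\<^esub> L Y"
proof -
  interpret TR: ring "tensor_alg A B" by (rule star_algebra.ring_A[OF star_algebra_tensor[OF A B]])
  note lin = left_convolution_linear and val = left_convolution_tens
  have sandwich: "L (U \<otimes>\<^bsub>tensor_alg A B\<^esub> tens A B a b) = S a \<otimes>\<^bsub>B\<^esub> L U \<otimes>\<^bsub>B\<^esub> b"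
    if "U \<in> carrier (tensor_alg A B)" and ab: "a \<in> carrier A" "b \<in> carrier B" for U a b
    using that(1)
  proof (induction U rule: tensor_induct[OF A B, consumes 1, case_names tens add])
    case (tens a' b')
    then show ?case using ab by (simp add: tens_mult[OF A B] val S_mult S_closed B.m_assoc)
  next
    case (add U V)
    then show ?case using ab
      by (simp add: TR.l_distr tens_closed[OF A B] linear_add[OF lin] linear_closed[OF lin] S_closed B.l_distr B.r_distr)
  qed
  show ?thesis using Y
  proof (induction Y rule: tensor_induct[OF A B, consumes 1, case_names tens add])
    case (tens a b)
    then show ?case using X(1) by (simp add: sandwich X(2) val S_closed B.smult_mult_l B.smult_mult_r)
  next
    case (add U V)
    then show ?case using X(1)
      by (simp add: TR.r_distr linear_add[OF lin] linear_closed[OF lin] B.smult_add_vector)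
  qed
qed

end

text \<open>On generators the antipode law reads $Q^t Q = 1$, where $Q$ is the magic unitary with entries \<open>q\<close>.\<close>

lemma antipode_left_entry:
  assumes A: "star_algebra A" and B: "star_algebra B" and F: "linear_on (tensor_alg A B) B F"
    and fin: "finite K" and q: "magic_unitary B K I q"
    and vw: "v \<in> I" "w \<in> I"
    and val: "\<And>a b. a \<in> carrier A \<Longrightarrow> b \<in> carrier B \<Longrightarrow> F (tens A B a b) = S a \<otimes>\<^bsub>B\<^esub> b"
    and p: "\<And>k. k \<in> K \<Longrightarrow> p v k \<in> carrier A" "\<And>k. k \<in> K \<Longrightarrow> S (p v k) = q k v"
  shows "F (tens_prod A B K p q v w) = (if v = w then 1 else 0) \<odot>\<^bsub>B\<^esub> \<one>\<^bsub>B\<^esub>"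
proof -
  interpret B: star_alg_ring B by (rule star_alg_ringI[OF B])
  note cl = magic_closed[OF q]
  have "F (tens_prod A B K p q v w) = (\<Oplus>\<^bsub>B\<^esub>k\<in>K. F (tens A B (p v k) (q k w)))"
    by (rule lift_tens_prod[OF A B B F fin]) (use p vw cl in auto)
  also have "\<dots> = (\<Oplus>\<^bsub>B\<^esub>k\<in>K. if v = w then q k v else \<zero>\<^bsub>B\<^esub>)"
    by (rule B.finsum_cong'[OF refl]) (use p vw cl in \<open>auto simp: val magic_row[OF q]\<close>)
  also have "\<dots> = (if v = w then 1 else 0) \<odot>\<^bsub>B\<^esub> \<one>\<^bsub>B\<^esub>"
    using vw by (simp add: magic_col_sum[OF q])
  finally show ?thesis .
qed

text \<open>The elements satisfying the law form a subspace, and by \<open>left_convolution_mult\<close> a subalgebra.\<close>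

lemma antipode_left:
  assumes full: "full_hypergraph H1" "full_hypergraph H2" and x: "x \<in> carrier (game_alg H1 H1)"
  shows "induced (game_alg H2 H1) (\<lambda>(a, b). game_antipode H1 H2 a \<otimes>\<^bsub>game_alg H2 H1\<^esub> b) (game_comult H1 H2 H1 x) =
    game_counit H1 x \<odot>\<^bsub>game_alg H2 H1\<^esub> \<one>\<^bsub>game_alg H2 H1\<^esub>"
proof -
  let ?A = "game_alg H1 H2" and ?B = "game_alg H2 H1"
  let ?L = "induced ?B (\<lambda>(a, b). game_antipode H1 H2 a \<otimes>\<^bsub>?B\<^esub> b)"
  note A = star_algebra_game[OF full] and B = star_algebra_game[OF full(2,1)]
  interpret A: ring ?A by (rule star_algebra.ring_A[OF A])
  interpret B: star_alg_ring ?B by (rule star_alg_ringI[OF B])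
  note S = antipode_hom[OF full] and e = counit_hom[OF full(1)] and D = comult_hom[OF full(1,2,1)]
  note lin = left_convolution_linear[OF A B S] and val = left_convolution_tens[OF A B S]
  note entry = antipode_left_entry[OF A B lin]
  show ?thesis
    using x
  proof (induction x rule: hypergraph_pair.game_alg_induct[OF hypergraph_pair.intro[OF full(1,1)], consumes 1, case_names one vtx edg mult add smult])
    case one
    show ?case
      by (simp add: hom_one[OF D] hom_one[OF e] tens_one[OF A B] val hom_one[OF S, simplified])
  next
    case (vtx v w)
    show ?case unfolding comult_gen(1)[OF full(1,2,1) vtx] counit_vtx[OF full(1) vtx]
      by (rule entry[OF hypergraph_finite(1)[OF full(2)] game_pair_verts[OF gens_pair[OF full(2,1)]]])
        (use vtx val vtx_closed[OF full] antipode_vtx[OF full] in auto)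
  next
    case (edg v w)
    show ?case unfolding comult_gen(2)[OF full(1,2,1) edg] counit_edg[OF full(1) edg]
      by (rule entry[OF hypergraph_finite(2)[OF full(2)] game_pair_edges[OF gens_pair[OF full(2,1)]]])
        (use edg val edg_closed[OF full] antipode_edg[OF full] in auto)
  next
    case (mult x y)
    then show ?case
      by (simp add: hom_mult[OF D] hom_mult[OF e] left_convolution_mult[OF A B S] hom_closed[OF D] B.smult_smult)
  next
    case (add x y)
    then show ?case
      by (simp add: linear_add[OF hom_linear[OF D]] linear_add[OF hom_linear[OF e]] linear_add[OF lin] hom_closed[OF D] B.smult_add_scalar)
  next
    case (smult c x)
    then show ?case
      by (simp add: linear_smult[OF hom_linear[OF D]] linear_smult[OF hom_linear[OF e]] linear_smult[OF lin] hom_closed[OF D] B.smult_smult)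
  qed
qed

section \<open>Reversal\<close>

lemma hom_opposite: "unital_star_hom A B h \<Longrightarrow> unital_star_hom (opposite_alg A) (opposite_alg B) h"
  by (simp add: unital_star_hom_def ring_hom_def linear_on_def)

lemma hom_opposite_swap: "unital_star_hom A (opposite_alg B) h \<Longrightarrow> unital_star_hom (opposite_alg A) B h"
  by (simp add: unital_star_hom_def ring_hom_def linear_on_def)

lemma opposite_cplx: "opposite_alg cplx = cplx"
  by (simp add: opposite_alg_def cplx_def mult.commute)

lemma antipode_linear:
  assumes "full_hypergraph H1" "full_hypergraph H2"
  shows "linear_on (game_alg H1 H2) (game_alg H2 H1) (game_antipode H1 H2)"
  using hom_linear[OF antipode_hom[OF assms]] by simp

text \<open>The composite of two antihomomorphisms is a homomorphism, and transposing a matrix twice changes nothing.\<close>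

lemma antipode_antipode:
  assumes full: "full_hypergraph H1" "full_hypergraph H2" and x: "x \<in> carrier (game_alg H1 H2)"
  shows "game_antipode H2 H1 (game_antipode H1 H2 x) = x"
  by (rule hypergraph_pair.game_hom_eqI[OF hypergraph_pair.intro[OF full]
        hom_compose[OF antipode_hom[OF full] hom_opposite_swap[OF antipode_hom[OF full(2,1)]]] hom_id _ _ x, unfolded id_apply])
     (simp_all add: antipode_vtx antipode_edg full)

lemma counit_antipode:
  assumes full: "full_hypergraph H" and x: "x \<in> carrier (game_alg H H)"
  shows "game_counit H (game_antipode H H x) = game_counit H x"
  by (rule hypergraph_pair.game_hom_eqI[OF hypergraph_pair.intro[OF full full]
        hom_compose[OF antipode_hom[OF full full] hom_opposite[OF counit_hom[OF full], unfolded opposite_cplx]]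
        counit_hom[OF full] _ _ x])
     (auto simp: antipode_vtx antipode_edg counit_vtx counit_edg full)

text \<open>The map $a \otimes b \mapsto g(b) \otimes f(a)$.  If \<open>f\<close> and \<open>g\<close> are antihomomorphisms, it is one too.\<close>

definition tensor_rev ::
    "('c, 'k) star_alg_scheme \<Rightarrow> ('d, 'l) star_alg_scheme \<Rightarrow> ('a \<Rightarrow> 'c) \<Rightarrow> ('b \<Rightarrow> 'd) \<Rightarrow>
     ('a \<times> 'b \<Rightarrow>\<^sub>0 complex) set \<Rightarrow> ('d \<times> 'c \<Rightarrow>\<^sub>0 complex) set" where
  "tensor_rev C D f g = induced (tensor_alg D C) (\<lambda>(a, b). tens D C (g b) (f a))"

context
  fixes A :: "('a, 'm) star_alg_scheme" and B :: "('b, 'n) star_alg_scheme"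
    and C :: "('c, 'k) star_alg_scheme" and D :: "('d, 'l) star_alg_scheme"
  assumes A: "star_algebra A" and B: "star_algebra B" and C: "star_algebra C" and D: "star_algebra D"
begin

private lemma rev_bilinear:
  "linear_on A C f \<Longrightarrow> linear_on B D g \<Longrightarrow> bilinear_on A B (tensor_alg D C) (\<lambda>a b. tens D C (g b) (f a))"
  by (rule bilinear_swap[OF B A bilinear_compose[OF B A bilinear_tens[OF D C]]])

lemma tensor_rev_linear:
  "linear_on A C f \<Longrightarrow> linear_on B D g \<Longrightarrow> linear_on (tensor_alg A B) (tensor_alg D C) (tensor_rev C D f g)"
  unfolding tensor_rev_def by (rule tensor_lift_linear[OF A B star_algebra_tensor[OF D C] rev_bilinear])

lemma tensor_rev_tens:
  "linear_on A C f \<Longrightarrow> linear_on B D g \<Longrightarrow> a \<in> carrier A \<Longrightarrow> b \<in> carrier B \<Longrightarrow>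
    tensor_rev C D f g (tens A B a b) = tens D C (g b) (f a)"
  unfolding tensor_rev_def by (rule tensor_lift_tens[OF A B star_algebra_tensor[OF D C] rev_bilinear])

lemma tensor_rev_hom:
  assumes f: "unital_star_hom A (opposite_alg C) f" and g: "unital_star_hom B (opposite_alg D) g"
  shows "unital_star_hom (tensor_alg A B) (opposite_alg (tensor_alg D C)) (tensor_rev C D f g)"
proof -
  have lin: "linear_on A C f" "linear_on B D g" using hom_linear[OF f] hom_linear[OF g] by simp_all
  have eq: "tensor_rev C D f g = induced (opposite_alg (tensor_alg D C)) (\<lambda>(a, b). tens D C (g b) (f a))"
    by (intro ext) (simp add: tensor_rev_def induced_def lin_ext_def)
  show ?thesis
    unfolding eq
    by (rule tensor_lift_hom[OF A B star_algebra_opposite[OF star_algebra_tensor[OF D C]]])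
       (use rev_bilinear[OF lin] in \<open>simp_all add: bilinear_on_def hom_mult[OF f] hom_mult[OF g] hom_one[OF f] hom_one[OF g]
         hom_adj[OF f] hom_adj[OF g] linear_closed[OF lin(1)] linear_closed[OF lin(2)]
         tens_mult[OF D C] tens_adj[OF D C] tens_one[OF D C]\<close>)
qed

end

lemma tensor_rev_bij:
  assumes A: "star_algebra A" and B: "star_algebra B" and C: "star_algebra C" and D: "star_algebra D"
    and f: "linear_on A C f" and g: "linear_on B D g" and f': "linear_on C A f'" and g': "linear_on D B g'"
    and inv: "\<And>a. a \<in> carrier A \<Longrightarrow> f' (f a) = a" "\<And>b. b \<in> carrier B \<Longrightarrow> g' (g b) = b"
      "\<And>c. c \<in> carrier C \<Longrightarrow> f (f' c) = c" "\<And>d. d \<in> carrier D \<Longrightarrow> g (g' d) = d"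
  shows "bij_betw (tensor_rev C D f g) (carrier (tensor_alg A B)) (carrier (tensor_alg D C))"
proof -
  note l = tensor_rev_linear[OF A B C D f g] and l' = tensor_rev_linear[OF D C B A g' f']
  note v = tensor_rev_tens[OF A B C D f g] and v' = tensor_rev_tens[OF D C B A g' f']
  have id: "linear_on X X (\<lambda>x. x)" for X :: "('x, 'y) star_alg_scheme" by (simp add: linear_on_def)
  have 1: "tensor_rev B A g' f' (tensor_rev C D f g X) = X" if "X \<in> carrier (tensor_alg A B)" for X
    by (rule tensor_eqI[OF A B linear_compose[OF l l'] _ _ that])
       (simp_all add: linear_on_def v v' inv linear_closed[OF f] linear_closed[OF g])
  have 2: "tensor_rev C D f g (tensor_rev B A g' f' X) = X" if "X \<in> carrier (tensor_alg D C)" for X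
    by (rule tensor_eqI[OF D C linear_compose[OF l' l] _ _ that])
       (simp_all add: linear_on_def v v' inv linear_closed[OF f'] linear_closed[OF g'])
  show ?thesis
    by (rule bij_betw_byWitness[where f' = "tensor_rev B A g' f'"])
       (use 1 2 linear_closed[OF l] linear_closed[OF l'] in auto)
qed

text \<open>The transpose of a matrix product is the product of the transposes in reverse order.\<close>

lemma comult_antipode:
  assumes full: "full_hypergraph H1" "full_hypergraph H2" "full_hypergraph H3"
    and x: "x \<in> carrier (game_alg H1 H3)"
  shows "tensor_rev (game_alg H2 H1) (game_alg H3 H2) (game_antipode H1 H2) (game_antipode H2 H3) (game_comult H1 H2 H3 x) =
    game_comult H3 H2 H1 (game_antipode H1 H3 x)"
proof -
  let ?T = "tensor_alg (game_alg H3 H2) (game_alg H2 H1)"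
  note algs = star_algebra_game[OF full(1,2)] star_algebra_game[OF full(2,3)] star_algebra_game[OF full(2,1)] star_algebra_game[OF full(3,2)]
  note S = antipode_hom[OF full(1,2)] antipode_hom[OF full(2,3)]
  note S_lin = antipode_linear[OF full(1,2)] antipode_linear[OF full(2,3)]
  interpret T: ring ?T by (rule star_algebra.ring_A[OF star_algebra_tensor[OF algs(4,3)]])
  note fin = hypergraph_finite[OF full(2)]
  note cl = vtx_closed[OF full(1,2)] vtx_closed[OF full(2,3)] vtx_closed[OF full(2,1)] vtx_closed[OF full(3,2)]
    edg_closed[OF full(1,2)] edg_closed[OF full(2,3)] edg_closed[OF full(2,1)] edg_closed[OF full(3,2)]
  note sum = lift_tens_prod[OF algs(1,2) star_algebra_tensor[OF algs(4,3)] tensor_rev_linear[OF algs S_lin]]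
  note simps = tensor_rev_tens[OF algs S_lin] tens_closed[OF algs(4,3)] antipode_vtx antipode_edg full cl
  show ?thesis
  proof (rule hypergraph_pair.game_hom_eqI[OF hypergraph_pair.intro[OF full(1,3)]
        hom_compose[OF comult_hom[OF full] tensor_rev_hom[OF algs S]]
        hom_compose[OF antipode_hom[OF full(1,3)] hom_opposite[OF comult_hom[OF full(3,2,1)]]] _ _ x])
    fix v w assume vw: "v \<in> verts H1" "w \<in> verts H3"
    show "tensor_rev (game_alg H2 H1) (game_alg H3 H2) (game_antipode H1 H2) (game_antipode H2 H3)
        (game_comult H1 H2 H3 (gen_vtx H1 H3 v w)) = game_comult H3 H2 H1 (game_antipode H1 H3 (gen_vtx H1 H3 v w))"
      unfolding comult_gen(1)[OF full vw] antipode_vtx[OF full(1,3) vw] comult_gen(1)[OF full(3,2,1) vw(2,1)]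
      by (subst sum) (use vw fin in \<open>auto simp: cl tens_prod_def[of "game_alg H3 H2"] simps intro!: T.finsum_cong'[OF refl]\<close>)
  next
    fix e f assume ef: "e \<in> edges H1" "f \<in> edges H3"
    show "tensor_rev (game_alg H2 H1) (game_alg H3 H2) (game_antipode H1 H2) (game_antipode H2 H3)
        (game_comult H1 H2 H3 (gen_edg H1 H3 e f)) = game_comult H3 H2 H1 (game_antipode H1 H3 (gen_edg H1 H3 e f))"
      unfolding comult_gen(2)[OF full ef] antipode_edg[OF full(1,3) ef] comult_gen(2)[OF full(3,2,1) ef(2,1)]
      by (subst sum) (use ef fin in \<open>auto simp: cl tens_prod_def[of "game_alg H3 H2"] simps intro!: T.finsum_cong'[OF refl]\<close>)
  qed
qed

text \<open>Reversal turns the left counit law of \<open>game_alg H2 H1\<close>, at the element \<open>game_antipode H1 H2 x\<close>, into this one.\<close>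

lemma comult_counit_right:
  assumes full: "full_hypergraph H1" "full_hypergraph H2" and x: "x \<in> carrier (game_alg H1 H2)"
  shows "induced (game_alg H1 H2) (\<lambda>(y, b). game_counit H2 b \<odot>\<^bsub>game_alg H1 H2\<^esub> y) (game_comult H1 H2 H2 x) = x"
proof -
  let ?Z = "game_alg H1 H2" and ?B = "game_alg H2 H2" and ?Z' = "game_alg H2 H1"
  let ?S = "game_antipode H1 H2" and ?rev = "tensor_rev (game_alg H2 H1) (game_alg H2 H2) (game_antipode H1 H2) (game_antipode H2 H2)"
  let ?E = "induced ?Z (\<lambda>(y, b). game_counit H2 b \<odot>\<^bsub>?Z\<^esub> y)" and ?E' = "induced ?Z' (\<lambda>(b, y). game_counit H2 b \<odot>\<^bsub>?Z'\<^esub> y)"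
  note Z = star_algebra_game[OF full] and B = star_algebra_game[OF full(2,2)] and Z' = star_algebra_game[OF full(2,1)]
  note e = hom_linear[OF counit_hom[OF full(2)]]
  note bil = bilinear_swap[OF B Z bilinear_smult[OF B Z Z e hom_linear[OF hom_id], unfolded id_apply]]
    and bil' = bilinear_smult[OF B Z' Z' e hom_linear[OF hom_id], unfolded id_apply]
  note S = antipode_linear[OF full] and SB = antipode_linear[OF full(2,2)]
  note rev = tensor_rev_linear[OF Z B Z' B S SB]
  have "?S (?E Y) = ?E' (?rev Y)" if "Y \<in> carrier (tensor_alg ?Z ?B)" for Y
    by (rule tensor_eqI[OF Z B linear_compose[OF tensor_lift_linear[OF Z B Z bil] S]
          linear_compose[OF rev tensor_lift_linear[OF B Z' Z' bil']] _ that])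
       (simp add: tensor_lift_tens[OF Z B Z bil] tensor_rev_tens[OF Z B Z' B S SB] tensor_lift_tens[OF B Z' Z' bil']
         linear_smult[OF S] linear_closed[OF S] linear_closed[OF SB] counit_antipode[OF full(2)])
  then have "?S (?E (game_comult H1 H2 H2 x)) = ?E' (game_comult H2 H2 H1 (?S x))"
    using x hom_closed[OF comult_hom[OF full(1,2,2)]] by (simp add: comult_antipode[OF full(1,2,2)])
  also have "\<dots> = ?S x" by (rule comult_counit_left[OF full(2,1) linear_closed[OF S x]])
  finally have "game_antipode H2 H1 (?S (?E (game_comult H1 H2 H2 x))) = game_antipode H2 H1 (?S x)" by simp
  then show ?thesis
    using x hom_closed[OF comult_hom[OF full(1,2,2)] x] linear_closed[OF tensor_lift_linear[OF Z B Z bil]]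
    by (simp add: antipode_antipode[OF full])
qed

text \<open>Applying the antipode to $x_1 S(x_2)$ gives $S(S(x_2)) S(x_1)$.  Since $\Delta(S x) = S(x_2) \otimes S(x_1)$, this is
  the left antipode law at $S(x)$.\<close>

lemma antipode_right:
  assumes full: "full_hypergraph H1" "full_hypergraph H2" and x: "x \<in> carrier (game_alg H1 H1)"
  shows "induced (game_alg H1 H2) (\<lambda>(b, a). b \<otimes>\<^bsub>game_alg H1 H2\<^esub> game_antipode H2 H1 a) (game_comult H1 H2 H1 x) =
    game_counit H1 x \<odot>\<^bsub>game_alg H1 H2\<^esub> \<one>\<^bsub>game_alg H1 H2\<^esub>"
proof -
  let ?A = "game_alg H2 H1" and ?B = "game_alg H1 H2" and ?S = "game_antipode H1 H2" and ?S' = "game_antipode H2 H1"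
  let ?R = "induced ?B (\<lambda>(b, a). b \<otimes>\<^bsub>?B\<^esub> ?S' a)" and ?L = "induced ?A (\<lambda>(b, a). ?S b \<otimes>\<^bsub>?A\<^esub> a)"
  let ?rev = "tensor_rev ?A ?B ?S ?S'"
  note A = star_algebra_game[OF full(2,1)] and B = star_algebra_game[OF full]
  interpret A: star_alg_ring ?A by (rule star_alg_ringI[OF A])
  interpret B: star_alg_ring ?B by (rule star_alg_ringI[OF B])
  note h = antipode_hom[OF full] and h' = antipode_hom[OF full(2,1)]
  note S = antipode_linear[OF full] and S' = antipode_linear[OF full(2,1)]
  note R = right_convolution_linear[OF A B h'] and L = left_convolution_linear[OF B A h]
  note D = hom_closed[OF comult_hom[OF full(1,2,1)] x]
  have "?S (?R Y) = ?L (?rev Y)" if "Y \<in> carrier (tensor_alg ?B ?A)" for Y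
  proof (rule tensor_eqI[OF B A linear_compose[OF R S] linear_compose[OF tensor_rev_linear[OF B A A B S S'] L] _ that])
    fix b a assume "b \<in> carrier ?B" "a \<in> carrier ?A"
    then show "?S (?R (tens ?B ?A b a)) = ?L (?rev (tens ?B ?A b a))"
      by (simp add: right_convolution_tens[OF A B h'] tensor_rev_tens[OF B A A B S S'] left_convolution_tens[OF B A h]
        linear_closed[OF S] linear_closed[OF S'] hom_mult[OF h])
  qed
  then have "?S (?R (game_comult H1 H2 H1 x)) = ?L (game_comult H1 H2 H1 (game_antipode H1 H1 x))"
    using D by (simp add: comult_antipode[OF full(1,2,1) x])
  also have "\<dots> = game_counit H1 x \<odot>\<^bsub>?A\<^esub> \<one>\<^bsub>?A\<^esub>"
    using x by (simp add: antipode_left[OF full] linear_closed[OF antipode_linear[OF full(1,1)]] counit_antipode[OF full(1)])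
  finally have "?S' (?S (?R (game_comult H1 H2 H1 x))) = ?S' (game_counit H1 x \<odot>\<^bsub>?A\<^esub> \<one>\<^bsub>?A\<^esub>)" by simp
  then show ?thesis
    using linear_closed[OF R D] hom_one[OF h'] by (simp add: antipode_antipode[OF full] linear_smult[OF S'])
qed

section \<open>Module extensions\<close>

text \<open>The extension of $f : A \to B \otimes Z$ to a map $A \otimes Z \to B \otimes Z$ that commutes with right multiplication
  by $Z$.  The Galois map is the extension of the coaction; for its inverse, \<open>A\<close> and \<open>B\<close> exchange their roles.\<close>

definition module_ext ::
    "('b, 'n) star_alg_scheme \<Rightarrow> ('z, 'k) star_alg_scheme \<Rightarrow> ('a \<Rightarrow> ('b \<times> 'z \<Rightarrow>\<^sub>0 complex) set) \<Rightarrow>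
     ('a \<times> 'z \<Rightarrow>\<^sub>0 complex) set \<Rightarrow> ('b \<times> 'z \<Rightarrow>\<^sub>0 complex) set" where
  "module_ext B Z f = induced (tensor_alg B Z)
     (\<lambda>(a, z). f a \<otimes>\<^bsub>tensor_alg B Z\<^esub> tens B Z \<one>\<^bsub>B\<^esub> z)"

lemma galois_map_left_module_ext: "galois_map_left = module_ext"
  by (intro ext) (simp add: galois_map_left_def module_ext_def)

context
  fixes A :: "('a, 'm) star_alg_scheme" and B :: "('b, 'n) star_alg_scheme"
    and Z :: "('z, 'k) star_alg_scheme"
  assumes A: "star_algebra A" and B: "star_algebra B" and Z: "star_algebra Z"
begin

interpretation A: ring A by (rule star_algebra.ring_A[OF A])
interpretation B: ring B by (rule star_algebra.ring_A[OF B])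
interpretation ZR: ring Z by (rule star_algebra.ring_A[OF Z])

lemma tens_one_left_linear: "linear_on Z (tensor_alg B Z) (tens B Z \<one>\<^bsub>B\<^esub>)"
  using bilinear_right[OF bilinear_tens[OF B Z], of "\<one>\<^bsub>B\<^esub>"] by simp

lemma tens_one_right_linear: "linear_on Z (tensor_alg Z B) (\<lambda>z. tens Z B z \<one>\<^bsub>B\<^esub>)"
  using bilinear_left[OF bilinear_tens[OF Z B], of "\<one>\<^bsub>B\<^esub>"] by simp

lemma module_ext_bilinear:
  "linear_on A (tensor_alg B Z) f \<Longrightarrow>
    bilinear_on A Z (tensor_alg B Z) (\<lambda>a z. f a \<otimes>\<^bsub>tensor_alg B Z\<^esub> tens B Z \<one>\<^bsub>B\<^esub> z)"
  by (rule bilinear_mult[OF A Z star_algebra_tensor[OF B Z] _ tens_one_left_linear])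

lemma module_ext_linear: "linear_on A (tensor_alg B Z) f \<Longrightarrow>
    linear_on (tensor_alg A Z) (tensor_alg B Z) (module_ext B Z f)"
  unfolding module_ext_def
  by (rule tensor_lift_linear[OF A Z star_algebra_tensor[OF B Z] module_ext_bilinear])

lemma module_ext_tens: "linear_on A (tensor_alg B Z) f \<Longrightarrow> a \<in> carrier A \<Longrightarrow> z \<in> carrier Z \<Longrightarrow>
    module_ext B Z f (tens A Z a z) = f a \<otimes>\<^bsub>tensor_alg B Z\<^esub> tens B Z \<one>\<^bsub>B\<^esub> z"
  unfolding module_ext_def
  by (rule tensor_lift_tens[OF A Z star_algebra_tensor[OF B Z] module_ext_bilinear])

lemma module_ext_mult:
  assumes f: "linear_on A (tensor_alg B Z) f" and X: "X \<in> carrier (tensor_alg A Z)" and z: "z \<in> carrier Z"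
  shows "module_ext B Z f (X \<otimes>\<^bsub>tensor_alg A Z\<^esub> tens A Z \<one>\<^bsub>A\<^esub> z) =
    module_ext B Z f X \<otimes>\<^bsub>tensor_alg B Z\<^esub> tens B Z \<one>\<^bsub>B\<^esub> z"
proof -
  interpret S: ring "tensor_alg A Z" by (rule star_algebra.ring_A[OF star_algebra_tensor[OF A Z]])
  interpret T: ring "tensor_alg B Z" by (rule star_algebra.ring_A[OF star_algebra_tensor[OF B Z]])
  note lin = module_ext_linear[OF f] and tc = tens_closed[OF A Z] tens_closed[OF B Z]
  show ?thesis using X
  proof (induction X rule: tensor_induct[OF A Z, consumes 1, case_names tens add])
    case (tens a y)
    then show ?case using z
      by (simp add: tens_mult[OF A Z] tens_mult[OF B Z] module_ext_tens[OF f] T.m_assoc linear_closed[OF f] tc)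
  next
    case (add s t)
    then show ?case using z
      by (simp add: S.l_distr T.l_distr tc linear_add[OF lin] linear_closed[OF lin])
  qed
qed

end

context
  fixes A :: "('a, 'm) star_alg_scheme" and B :: "('b, 'n) star_alg_scheme"
    and Z :: "('z, 'k) star_alg_scheme"
  assumes A: "star_algebra A" and B: "star_algebra B" and Z: "star_algebra Z"
begin

text \<open>Module maps are determined by their values on $a \otimes 1$.\<close>

lemma module_ext_inverse:
  assumes f: "linear_on A (tensor_alg B Z) f" and g: "linear_on B (tensor_alg A Z) g"
    and gf: "\<And>a. a \<in> carrier A \<Longrightarrow> module_ext A Z g (f a) = tens A Z a \<one>\<^bsub>Z\<^esub>"
    and X: "X \<in> carrier (tensor_alg A Z)"
  shows "module_ext A Z g (module_ext B Z f X) = X"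
proof (rule tensor_eqI[OF A Z _ _ _ X])
  interpret A: ring A by (rule star_algebra.ring_A[OF A])
  interpret ZR: ring Z by (rule star_algebra.ring_A[OF Z])
  show "linear_on (tensor_alg A Z) (tensor_alg A Z) (\<lambda>X. module_ext A Z g (module_ext B Z f X))"
    by (rule linear_compose[OF module_ext_linear[OF A B Z f] module_ext_linear[OF B A Z g]])
  show "linear_on (tensor_alg A Z) (tensor_alg A Z) (\<lambda>X. X)" by (rule linear_onI) auto
  fix a z assume az: "a \<in> carrier A" "z \<in> carrier Z"
  then show "module_ext A Z g (module_ext B Z f (tens A Z a z)) = tens A Z a z"
    by (simp add: module_ext_tens[OF A B Z f] module_ext_mult[OF B A Z g] linear_closed[OF f] gf tens_mult[OF A Z])
qed

end

lemma module_ext_bij: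
  assumes A: "star_algebra A" and B: "star_algebra B" and Z: "star_algebra Z"
    and f: "linear_on A (tensor_alg B Z) f" and g: "linear_on B (tensor_alg A Z) g"
    and "\<And>a. a \<in> carrier A \<Longrightarrow> module_ext A Z g (f a) = tens A Z a \<one>\<^bsub>Z\<^esub>"
    and "\<And>b. b \<in> carrier B \<Longrightarrow> module_ext B Z f (g b) = tens B Z b \<one>\<^bsub>Z\<^esub>"
  shows "bij_betw (module_ext B Z f) (carrier (tensor_alg A Z)) (carrier (tensor_alg B Z))"
  by (rule bij_betw_byWitness[where f' = "module_ext A Z g"])
     (use assms module_ext_inverse[OF A B Z f g] module_ext_inverse[OF B A Z g f]
       linear_closed[OF module_ext_linear[OF A B Z f]] linear_closed[OF module_ext_linear[OF B A Z g]] in auto)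

section \<open>The Galois maps\<close>

lemma tens_smult_swap:
  assumes "star_algebra A" "star_algebra B" "a \<in> carrier A" "b \<in> carrier B"
  shows "tens A B (c \<odot>\<^bsub>A\<^esub> a) b = tens A B a (c \<odot>\<^bsub>B\<^esub> b)"
  using linear_smult[OF bilinear_left[OF bilinear_tens[OF assms(1,2)] assms(4)] assms(3), of c]
    linear_smult[OF bilinear_right[OF bilinear_tens[OF assms(1,2)] assms(3)] assms(4), of c] by simp

lemma mult_right_linear:
  assumes A: "star_algebra A" and a: "a \<in> carrier A"
  shows "linear_on A A (\<lambda>x. x \<otimes>\<^bsub>A\<^esub> a)"
proof -
  interpret A: star_alg_ring A by (rule star_alg_ringI[OF A])
  show ?thesis using a by (intro linear_onI) (auto simp: A.l_distr A.smult_mult_l)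
qed

context
  fixes H1 :: "('v1, 'e1) hypergraph" and H2 :: "('v2, 'e2) hypergraph"
  assumes full: "full_hypergraph H1" "full_hypergraph H2"
begin

private abbreviation (input) "A \<equiv> game_alg H1 H1"
private abbreviation (input) "B \<equiv> game_alg H2 H2"
private abbreviation (input) "Z \<equiv> game_alg H1 H2"
private abbreviation (input) "D \<equiv> game_alg H2 H1"
private abbreviation (input) "S \<equiv> game_antipode H2 H1"
private abbreviation (input) "SL \<equiv> induced Z (\<lambda>(a, b). S a \<otimes>\<^bsub>Z\<^esub> b)"
private abbreviation (input) "SR \<equiv> induced Z (\<lambda>(b, a). b \<otimes>\<^bsub>Z\<^esub> S a)"

private lemmas A = star_algebra_game[OF full(1,1)] and B = star_algebra_game[OF full(2,2)]
  and Z = star_algebra_game[OF full] and D = star_algebra_game[OF full(2,1)]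
private lemmas ZD = star_algebra_tensor[OF Z D] and DZ = star_algebra_tensor[OF D Z]
  and AZ = star_algebra_tensor[OF A Z] and ZZ = star_algebra_tensor[OF Z Z]
private lemmas id_lin = hom_linear[OF hom_id]
private lemmas S_lin = antipode_linear[OF full(2,1)]
private lemmas L_lin = left_convolution_linear[OF D Z antipode_hom[OF full(2,1)]]
private lemmas R_lin = right_convolution_linear[OF D Z antipode_hom[OF full(2,1)]]
private lemmas L_tens = left_convolution_tens[OF D Z antipode_hom[OF full(2,1)]]
private lemmas R_tens = right_convolution_tens[OF D Z antipode_hom[OF full(2,1)]]

interpretation A: star_alg_ring A by (rule star_alg_ringI[OF A])
interpretation B: star_alg_ring B by (rule star_alg_ringI[OF B])
interpretation Z: star_alg_ring Z by (rule star_alg_ringI[OF Z])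

private abbreviation (input) "\<delta> \<equiv> game_comult H1 H1 H2"
private abbreviation (input) "\<gamma> \<equiv> game_comult H1 H2 H2"

private lemmas \<delta>_lin = hom_linear[OF comult_hom[OF full(1,1,2)]]
private lemmas \<gamma>_lin = hom_linear[OF comult_hom[OF full(1,2,2)]]
private lemmas D11_lin = hom_linear[OF comult_hom[OF full(1,2,1)]]
private lemmas D22_lin = hom_linear[OF comult_hom[OF full(2,1,2)]]

text \<open>The inverse of the left Galois map, restricted to $a \otimes 1$.\<close>

definition translation :: "('v1, 'e1, 'v1, 'e1) game_poly set \<Rightarrow>
    (('v1, 'e1, 'v2, 'e2) game_poly set \<times> ('v1, 'e1, 'v2, 'e2) game_poly set \<Rightarrow>\<^sub>0 complex) set" where
  "translation a = tensor_map Z Z id S (game_comult H1 H2 H1 a)"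

private lemmas idS_lin = tensor_map_linear[OF Z D Z Z id_lin S_lin]

lemma translation_linear: "linear_on A (tensor_alg Z Z) translation"
  unfolding translation_def by (rule linear_compose[OF D11_lin idS_lin])

private abbreviation (input) "\<Phi> \<equiv> tensor_map Z Z id SL"
private lemmas \<Phi>_lin = tensor_map_linear[OF Z DZ Z Z id_lin L_lin]
private lemmas \<Phi>_tens = tensor_map_tens[OF Z DZ Z Z id_lin L_lin]

text \<open>This is $z_1 \otimes S(z_2) z_3 = z \otimes 1$.  With $\Phi(z \otimes d \otimes z') = z \otimes S(d) z'$, the left
  side is $\Phi$ applied to $(\Delta \otimes \mathrm{id}) \delta z$.  Coassociativity turns this into
  $(\mathrm{id} \otimes \Delta) \gamma z$, where the antipode law applies to the last two factors.\<close>

lemma translation_coaction: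
  assumes x: "x \<in> carrier Z"
  shows "module_ext Z Z translation (\<delta> x) = tens Z Z x \<one>\<^bsub>Z\<^esub>"
proof -
  let ?\<alpha> = "tensor_assoc Z D Z"
  note \<alpha>_lin = tensor_assoc_linear[OF Z D Z]
  \<comment> \<open>The tensor $Y$ stands for $\Delta a$, which is not an elementary tensor in general.\<close>
  have regroup: "tensor_map Z Z id S Y \<otimes>\<^bsub>tensor_alg Z Z\<^esub> tens Z Z \<one>\<^bsub>Z\<^esub> z = \<Phi> (?\<alpha> (tens (tensor_alg Z D) Z Y z))"
    if Y: "Y \<in> carrier (tensor_alg Z D)" and z: "z \<in> carrier Z" for Y z
  proof (rule tensor_eqI[OF Z D linear_compose[OF idS_lin mult_right_linear[OF ZZ]]
        linear_compose[OF linear_compose[OF bilinear_left[OF bilinear_tens[OF ZD Z] z] \<alpha>_lin] \<Phi>_lin] _ Y])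
    show "tens Z Z \<one>\<^bsub>Z\<^esub> z \<in> carrier (tensor_alg Z Z)" using z by (simp add: tens_closed[OF Z Z])
    fix y d assume "y \<in> carrier Z" "d \<in> carrier D"
    then show "tensor_map Z Z id S (tens Z D y d) \<otimes>\<^bsub>tensor_alg Z Z\<^esub> tens Z Z \<one>\<^bsub>Z\<^esub> z =
        \<Phi> (?\<alpha> (tens (tensor_alg Z D) Z (tens Z D y d) z))" using z
      by (simp add: tensor_map_tens[OF Z D Z Z id_lin S_lin] tensor_assoc_tens[OF Z D Z] \<Phi>_tens
        tens_closed[OF D Z] L_tens tens_mult[OF Z Z] linear_closed[OF S_lin])
  qed
  have "module_ext Z Z translation t =
      \<Phi> (?\<alpha> (tensor_map (tensor_alg Z D) Z (game_comult H1 H2 H1) id t))"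
    if "t \<in> carrier (tensor_alg A Z)" for t
  proof (rule tensor_eqI[OF A Z module_ext_linear[OF A Z Z translation_linear]
        linear_compose[OF linear_compose[OF tensor_map_linear[OF A Z ZD Z D11_lin id_lin] \<alpha>_lin] \<Phi>_lin] _ that])
    fix a z assume "a \<in> carrier A" "z \<in> carrier Z"
    then show "module_ext Z Z translation (tens A Z a z) =
      \<Phi> (?\<alpha> (tensor_map (tensor_alg Z D) Z (game_comult H1 H2 H1) id (tens A Z a z)))"
      by (simp add: module_ext_tens[OF A Z Z translation_linear] tensor_map_tens[OF A Z ZD Z D11_lin id_lin]
        translation_def regroup linear_closed[OF D11_lin])
  qed
  then have "module_ext Z Z translation (\<delta> x) =
      \<Phi> (?\<alpha> (tensor_map (tensor_alg Z D) Z (game_comult H1 H2 H1) id (\<delta> x)))"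
    using linear_closed[OF \<delta>_lin x] by simp
  also have "\<dots> = \<Phi> (tensor_map Z (tensor_alg D Z) id (game_comult H2 H1 H2) (\<gamma> x))"
    by (simp only: comult_coassoc[OF full(1,2,1,2) x])
  also have "\<Phi> (tensor_map Z (tensor_alg D Z) id (game_comult H2 H1 H2) Y) =
      tens Z Z (induced Z (\<lambda>(y, b). game_counit H2 b \<odot>\<^bsub>Z\<^esub> y) Y) \<one>\<^bsub>Z\<^esub>"
    if "Y \<in> carrier (tensor_alg Z B)" for Y
  proof -
    note bil = bilinear_swap[OF B Z bilinear_smult[OF B Z Z hom_linear[OF counit_hom[OF full(2)]] id_lin, unfolded id_apply]]
    note E_lin = tensor_lift_linear[OF Z B Z bil] and E_tens = tensor_lift_tens[OF Z B Z bil]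
    show ?thesis
    proof (rule tensor_eqI[OF Z B linear_compose[OF tensor_map_linear[OF Z B Z DZ id_lin D22_lin] \<Phi>_lin]
        linear_compose[OF E_lin tens_one_right_linear[OF Z Z Z]] _ that])
      fix y b assume yb: "y \<in> carrier Z" "b \<in> carrier B"
      then show "\<Phi> (tensor_map Z (tensor_alg D Z) id (game_comult H2 H1 H2) (tens Z B y b)) =
        tens Z Z (induced Z (\<lambda>(y, b). game_counit H2 b \<odot>\<^bsub>Z\<^esub> y) (tens Z B y b)) \<one>\<^bsub>Z\<^esub>"
        by (simp add: tensor_map_tens[OF Z B Z DZ id_lin D22_lin] \<Phi>_tens linear_closed[OF D22_lin]
          antipode_left[OF full(2,1)] E_tens tens_smult_swap[OF Z Z])
    qed
  qed
  also have "induced Z (\<lambda>(y, b). game_counit H2 b \<odot>\<^bsub>Z\<^esub> y) (\<gamma> x) = x"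
    by (rule comult_counit_right[OF full x])
  finally show ?thesis using linear_closed[OF \<gamma>_lin x] by simp
qed

private abbreviation (input) "\<Psi> \<equiv> tensor_map A Z id SR"
private lemmas \<Psi>_lin = tensor_map_linear[OF A ZD A Z id_lin R_lin]
private lemmas \<Psi>_tens = tensor_map_tens[OF A ZD A Z id_lin R_lin]

text \<open>This is $a_1 \otimes a_2 S(a_3) = a \otimes 1$; the map that forms the product $a_2 S(a_3)$ is $\Psi$.\<close>

lemma coaction_translation:
  assumes a: "a \<in> carrier A"
  shows "module_ext A Z \<delta> (translation a) = tens A Z a \<one>\<^bsub>Z\<^esub>"
proof -
  let ?\<alpha> = "tensor_assoc A Z D"
  note \<alpha>_lin = tensor_assoc_linear[OF A Z D]
  have regroup: "t \<otimes>\<^bsub>tensor_alg A Z\<^esub> tens A Z \<one>\<^bsub>A\<^esub> (S w) = \<Psi> (?\<alpha> (tens (tensor_alg A Z) D t w))"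
    if t: "t \<in> carrier (tensor_alg A Z)" and w: "w \<in> carrier D" for t w
  proof (rule tensor_eqI[OF A Z mult_right_linear[OF AZ]
        linear_compose[OF linear_compose[OF bilinear_left[OF bilinear_tens[OF AZ D] w] \<alpha>_lin] \<Psi>_lin] _ t])
    show "tens A Z \<one>\<^bsub>A\<^esub> (S w) \<in> carrier (tensor_alg A Z)" using w by (simp add: tens_closed[OF A Z] linear_closed[OF S_lin])
    fix a y assume "a \<in> carrier A" "y \<in> carrier Z"
    then show "tens A Z a y \<otimes>\<^bsub>tensor_alg A Z\<^esub> tens A Z \<one>\<^bsub>A\<^esub> (S w) =
        \<Psi> (?\<alpha> (tens (tensor_alg A Z) D (tens A Z a y) w))" using w
      by (simp add: tensor_assoc_tens[OF A Z D] \<Psi>_tens tens_closed[OF Z D] R_tens tens_mult[OF A Z] linear_closed[OF S_lin])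
  qed
  have "module_ext A Z \<delta> (tensor_map Z Z id S Y) = \<Psi> (?\<alpha> (tensor_map (tensor_alg A Z) D \<delta> id Y))"
    if "Y \<in> carrier (tensor_alg Z D)" for Y
  proof (rule tensor_eqI[OF Z D linear_compose[OF idS_lin module_ext_linear[OF Z A Z \<delta>_lin]]
        linear_compose[OF linear_compose[OF tensor_map_linear[OF Z D AZ D \<delta>_lin id_lin] \<alpha>_lin] \<Psi>_lin] _ that])
    fix y w assume "y \<in> carrier Z" "w \<in> carrier D"
    then show "module_ext A Z \<delta> (tensor_map Z Z id S (tens Z D y w)) =
        \<Psi> (?\<alpha> (tensor_map (tensor_alg A Z) D \<delta> id (tens Z D y w)))"
      by (simp add: tensor_map_tens[OF Z D Z Z id_lin S_lin] module_ext_tens[OF Z A Z \<delta>_lin]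
        tensor_map_tens[OF Z D AZ D \<delta>_lin id_lin] regroup linear_closed[OF \<delta>_lin] linear_closed[OF S_lin])
  qed
  then have "module_ext A Z \<delta> (translation a) =
      \<Psi> (?\<alpha> (tensor_map (tensor_alg A Z) D \<delta> id (game_comult H1 H2 H1 a)))"
    using linear_closed[OF D11_lin a] by (simp add: translation_def)
  also have "\<dots> = \<Psi> (tensor_map A (tensor_alg Z D) id (game_comult H1 H2 H1) (game_comult H1 H1 H1 a))"
    by (simp only: comult_coassoc[OF full(1,1,2,1) a])
  also have "\<Psi> (tensor_map A (tensor_alg Z D) id (game_comult H1 H2 H1) Y) =
      tens A Z (induced A (\<lambda>(y, b). game_counit H1 b \<odot>\<^bsub>A\<^esub> y) Y) \<one>\<^bsub>Z\<^esub>"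
    if "Y \<in> carrier (tensor_alg A A)" for Y
  proof -
    note bil = bilinear_swap[OF A A bilinear_smult[OF A A A hom_linear[OF counit_hom[OF full(1)]] id_lin, unfolded id_apply]]
    note E_lin = tensor_lift_linear[OF A A A bil] and E_tens = tensor_lift_tens[OF A A A bil]
    have one: "linear_on A (tensor_alg A Z) (\<lambda>a. tens A Z a \<one>\<^bsub>Z\<^esub>)"
      by (rule bilinear_left[OF bilinear_tens[OF A Z]]) simp
    show ?thesis
    proof (rule tensor_eqI[OF A A linear_compose[OF tensor_map_linear[OF A A A ZD id_lin D11_lin] \<Psi>_lin]
        linear_compose[OF E_lin one] _ that])
      fix y b assume yb: "y \<in> carrier A" "b \<in> carrier A"
      then show "\<Psi> (tensor_map A (tensor_alg Z D) id (game_comult H1 H2 H1) (tens A A y b)) =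
        tens A Z (induced A (\<lambda>(y, b). game_counit H1 b \<odot>\<^bsub>A\<^esub> y) (tens A A y b)) \<one>\<^bsub>Z\<^esub>"
        by (simp add: tensor_map_tens[OF A A A ZD id_lin D11_lin] \<Psi>_tens linear_closed[OF D11_lin]
          antipode_right[OF full] E_tens tens_smult_swap[OF A Z])
    qed
  qed
  also have "induced A (\<lambda>(y, b). game_counit H1 b \<odot>\<^bsub>A\<^esub> y) (game_comult H1 H1 H1 a) = a"
    by (rule comult_counit_right[OF full(1,1) a])
  finally show ?thesis using linear_closed[OF hom_linear[OF comult_hom[OF full(1,1,1)]] a] by simp
qed

lemma galois_map_left_bij:
  "bij_betw (galois_map_left A Z \<delta>) (carrier (tensor_alg Z Z)) (carrier (tensor_alg A Z))"
  unfolding galois_map_left_module_ext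
  by (rule module_ext_bij[OF Z A Z \<delta>_lin translation_linear translation_coaction coaction_translation])

end

text \<open>Reversal $T$ is antimultiplicative and takes $\gamma(y)$ to $\Delta(S y)$, so that it takes $(z \otimes 1) \gamma(y)$ to
  $\Delta(S y) (1 \otimes S z)$.  This is the value of the left Galois map of \<open>game_alg H2 H1\<close> at
  $S(y) \otimes S(z)$, which is the reversal of $z \otimes y$.\<close>

lemma galois_map_right_bij:
  fixes H1 :: "('v1, 'e1) hypergraph" and H2 :: "('v2, 'e2) hypergraph"
  assumes full: "full_hypergraph H1" "full_hypergraph H2"
  shows "bij_betw (galois_map_right (game_alg H2 H2) (game_alg H1 H2) (game_comult H1 H2 H2))
    (carrier (tensor_alg (game_alg H1 H2) (game_alg H1 H2))) (carrier (tensor_alg (game_alg H1 H2) (game_alg H2 H2)))"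
proof -
  let ?Z = "game_alg H1 H2" and ?B = "game_alg H2 H2" and ?Z' = "game_alg H2 H1"
  let ?S = "game_antipode H1 H2" and ?SB = "game_antipode H2 H2"
  let ?\<kappa> = "galois_map_right ?B ?Z (game_comult H1 H2 H2)" and ?\<kappa>' = "galois_map_left ?B ?Z' (game_comult H2 H2 H1)"
  let ?U = "tensor_rev ?Z' ?Z' ?S ?S" and ?T = "tensor_rev ?Z' ?B ?S ?SB"
  note Z = star_algebra_game[OF full] and B = star_algebra_game[OF full(2,2)] and Z' = star_algebra_game[OF full(2,1)]
  note ZB = star_algebra_tensor[OF Z B]
  interpret Z: ring ?Z by (rule star_algebra.ring_A[OF Z])
  interpret B: ring ?B by (rule star_algebra.ring_A[OF B])
  note S = antipode_linear[OF full] and SB = antipode_linear[OF full(2,2)] and S' = antipode_linear[OF full(2,1)]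
  note \<gamma> = hom_linear[OF comult_hom[OF full(1,2,2)]] and \<delta> = hom_linear[OF comult_hom[OF full(2,2,1)]]
  note T = tensor_rev_hom[OF Z B Z' B antipode_hom[OF full] antipode_hom[OF full(2,2)]]
  note U = tensor_rev_linear[OF Z Z Z' Z' S S]
  note bil = bilinear_mult[OF Z Z ZB tens_one_right_linear[OF Z B Z] \<gamma>]
  note \<kappa> = tensor_lift_linear[OF Z Z ZB bil, folded galois_map_right_def]
  note \<kappa>' = module_ext_linear[OF Z' B Z' \<delta>, folded galois_map_left_module_ext]
  have conj: "?T (?\<kappa> X) = ?\<kappa>' (?U X)" if "X \<in> carrier (tensor_alg ?Z ?Z)" for X
  proof (rule tensor_eqI[OF Z Z linear_compose[OF \<kappa> hom_linear[OF T, simplified]] linear_compose[OF U \<kappa>'] _ that])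
    fix z y assume "z \<in> carrier ?Z" "y \<in> carrier ?Z"
    then show "?T (?\<kappa> (tens ?Z ?Z z y)) = ?\<kappa>' (?U (tens ?Z ?Z z y))"
      using hom_one[OF antipode_hom[OF full(2,2)]]
      by (simp add: tensor_lift_tens[OF Z Z ZB bil, folded galois_map_right_def] hom_mult[OF T] tens_closed[OF Z B]
        linear_closed[OF \<gamma>] linear_closed[OF S] tensor_rev_tens[OF Z B Z' B S SB] tensor_rev_tens[OF Z Z Z' Z' S S]
        comult_antipode[OF full(1,2,2)] module_ext_tens[OF Z' B Z' \<delta>, folded galois_map_left_module_ext])
  qed
  have "bij_betw (?\<kappa>' \<circ> ?U) (carrier (tensor_alg ?Z ?Z)) (carrier (tensor_alg ?B ?Z'))"
    by (rule bij_betw_trans[OF tensor_rev_bij[OF Z Z Z' Z' S S S' S'] galois_map_left_bij[OF full(2,1)]])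
       (simp_all add: antipode_antipode full)
  then have "bij_betw (?T \<circ> ?\<kappa>) (carrier (tensor_alg ?Z ?Z)) (carrier (tensor_alg ?B ?Z'))"
    by (rule bij_betw_cong[THEN iffD1, rotated]) (simp add: conj)
  moreover have "bij_betw ?T (carrier (tensor_alg ?Z ?B)) (carrier (tensor_alg ?B ?Z'))"
    by (rule tensor_rev_bij[OF Z B Z' B S SB S' SB]) (simp_all add: antipode_antipode full)
  moreover have "?\<kappa> ` carrier (tensor_alg ?Z ?Z) \<subseteq> carrier (tensor_alg ?Z ?B)"
    using linear_closed[OF \<kappa>] by blast
  ultimately show ?thesis by (simp add: bij_betw_comp_iff2)
qed

section \<open>The quantum automorphism group\<close>

text \<open>The quantum automorphism group extends the record of its game algebra by further fields.  Constructions that use only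
  the fields of a star algebra do not see the extension.\<close>

definition same_ops :: "('a, 'm) star_alg_scheme \<Rightarrow> ('a, 'n) star_alg_scheme \<Rightarrow> bool" where
  "same_ops A A' \<longleftrightarrow> carrier A = carrier A' \<and> mult A = mult A' \<and> one A = one A' \<and> zero A = zero A' \<and>
     add A = add A' \<and> smult A = smult A' \<and> adj A = adj A'"

lemma same_ops_refl: "same_ops A A"
  by (simp add: same_ops_def)

lemma finsum_same_ops: "same_ops A A' \<Longrightarrow> finsum A f I = finsum A' f I"
  by (simp add: finsum_def finprod_def same_ops_def)

lemma induced_same_ops:
  assumes "same_ops A A'"
  shows "induced A h X = induced A' h X"
proof -
  have "smult A = smult A'" using assms by (simp add: same_ops_def)
  then have "lin_ext A h = lin_ext A' h"
    by (intro ext) (simp add: lin_ext_def finsum_same_ops[OF assms])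
  then show ?thesis by (simp add: induced_def)
qed

context
  fixes A A' B B'
  assumes AA: "same_ops A A'" and BB: "same_ops B B'"
begin

lemma pair_alg_same_ops: "pair_alg A B = pair_alg A' B'"
  using AA BB by (simp add: pair_alg_def DirProd_def same_ops_def)

lemma tensor_null_same_ops: "tensor_null A B = tensor_null A' B'"
proof -
  have "bilinear_relators A B = bilinear_relators A' B'"
    using AA BB unfolding bilinear_relators_def same_ops_def by simp
  then show ?thesis by (simp add: tensor_null_def pair_alg_same_ops)
qed

lemma tensor_alg_same_ops: "tensor_alg A B = tensor_alg A' B'"
  by (simp add: tensor_alg_def pair_alg_same_ops tensor_null_same_ops)

lemma tens_same_ops: "tens A B a b = tens A' B' a b"
  by (simp add: tens_def pair_alg_same_ops tensor_null_same_ops)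

lemma tensor_map_same_ops: "tensor_map A B f g = tensor_map A' B' f g"
  by (simp add: tensor_map_def tensor_alg_same_ops tens_same_ops)

end

lemma tensor_assoc_same_ops:
  assumes "same_ops A A'" "same_ops B B'" "same_ops C C'"
  shows "tensor_assoc A B C = tensor_assoc A' B' C'"
  unfolding tensor_assoc_def Let_def
  by (simp add: tensor_alg_same_ops[OF assms(2,3)] tens_same_ops[OF assms(2,3)]
      tensor_alg_same_ops[OF assms(1) same_ops_refl] tens_same_ops[OF assms(1) same_ops_refl])

lemma star_algebra_same_ops:
  assumes "same_ops A A'" and A': "star_algebra A'"
  shows "star_algebra A"
proof -
  have eqs: "carrier A = carrier A'" "mult A = mult A'" "one A = one A'" "zero A = zero A'"
    "add A = add A'" "smult A = smult A'" "adj A = adj A'" using assms(1) by (simp_all add: same_ops_def)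
  interpret S: star_alg_ring A' by (rule star_alg_ringI[OF A'])
  show ?thesis
    by (rule star_algebraI)
       (simp_all add: eqs ring_eqI[OF S.ring_axioms] S.smult_add_scalar S.smult_add_vector S.smult_smult
         S.smult_mult_l S.smult_mult_r S.adj_adj S.adj_add S.adj_smult S.adj_mult)
qed

lemma qaut_same_ops: "same_ops (qaut H) (game_alg H H)"
  by (simp add: same_ops_def qaut_def Let_def star_alg.extend_def)

lemma qaut_ops:
  "comult (qaut H) = game_comult H H H" "counit (qaut H) = game_counit H"
  "antipode (qaut H) = game_antipode H H"
  by (simp_all add: qaut_def Let_def star_alg.extend_def game_comult_def game_counit_def game_antipode_def tens_prod_def)

lemma qaut_carrier_ops:
  "carrier (qaut H) = carrier (game_alg H H)" "mult (qaut H) = mult (game_alg H H)"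
  "one (qaut H) = one (game_alg H H)" "add (qaut H) = add (game_alg H H)"
  "smult (qaut H) = smult (game_alg H H)" "adj (qaut H) = adj (game_alg H H)"
  using qaut_same_ops[of H] by (simp_all add: same_ops_def)

lemmas qaut_tensor =
  tensor_alg_same_ops[OF qaut_same_ops same_ops_refl] tensor_alg_same_ops[OF same_ops_refl qaut_same_ops]
  tens_same_ops[OF qaut_same_ops same_ops_refl] tens_same_ops[OF same_ops_refl qaut_same_ops]
  tensor_map_same_ops[OF qaut_same_ops same_ops_refl] tensor_map_same_ops[OF same_ops_refl qaut_same_ops]
  tensor_assoc_same_ops[OF qaut_same_ops same_ops_refl same_ops_refl]
  tensor_assoc_same_ops[OF same_ops_refl qaut_same_ops same_ops_refl]
  tensor_assoc_same_ops[OF same_ops_refl same_ops_refl qaut_same_ops]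
  induced_same_ops[OF qaut_same_ops]

lemma qaut_hopf:
  fixes H :: "('v, 'e) hypergraph"
  assumes full: "full_hypergraph H"
  shows "hopf_star_algebra (qaut H)"
proof -
  have lin: "linear_on (qaut H) (qaut H) f = linear_on (game_alg H H) (game_alg H H) f" for f
    by (simp add: linear_on_def qaut_carrier_ops)
  have hom: "unital_star_hom (qaut H) T f = unital_star_hom (game_alg H H) T f" for T :: "('t, 'x) star_alg_scheme" and f
    by (simp add: unital_star_hom_def linear_on_def ring_hom_def qaut_carrier_ops)
  show ?thesis
  proof (intro hopf_star_algebra.intro hopf_star_algebra_axioms.intro)
    show "star_algebra (qaut H)" by (rule star_algebra_same_ops[OF qaut_same_ops star_algebra_game[OF full full]])
  qed (simp_all only: lin hom qaut_tensor qaut_carrier_ops qaut_ops comult_hom[OF full full full]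
      comult_coassoc[OF full full full full] counit_hom[OF full] comult_counit_left[OF full full]
      comult_counit_right[OF full full] antipode_linear[OF full full] antipode_left[OF full full]
      antipode_right[OF full full])
qed

theorem theorem4p3:
  fixes \<Lambda>1 :: "('v1, 'e1) hypergraph" and \<Lambda>2 :: "('v2, 'e2) hypergraph"
  assumes "full_hypergraph \<Lambda>1" and "full_hypergraph \<Lambda>2"
    and "carrier (game_alg \<Lambda>1 \<Lambda>2) \<noteq> {\<zero>\<^bsub>game_alg \<Lambda>1 \<Lambda>2\<^esub>}"
  shows "\<exists>\<delta> \<gamma>.
    bi_galois (qaut \<Lambda>1) (qaut \<Lambda>2) (game_alg \<Lambda>1 \<Lambda>2) \<delta> \<gamma> \<and>
    (\<forall>v1\<in>verts \<Lambda>1. \<forall>v2\<in>verts \<Lambda>2.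
       \<delta> (gen_vtx \<Lambda>1 \<Lambda>2 v1 v2) =
         (\<Oplus>\<^bsub>tensor_alg (qaut \<Lambda>1) (game_alg \<Lambda>1 \<Lambda>2)\<^esub>w1\<in>verts \<Lambda>1.
            tens (qaut \<Lambda>1) (game_alg \<Lambda>1 \<Lambda>2) (gen_vtx \<Lambda>1 \<Lambda>1 v1 w1) (gen_vtx \<Lambda>1 \<Lambda>2 w1 v2))) \<and>
    (\<forall>e1\<in>edges \<Lambda>1. \<forall>e2\<in>edges \<Lambda>2.
       \<delta> (gen_edg \<Lambda>1 \<Lambda>2 e1 e2) =
         (\<Oplus>\<^bsub>tensor_alg (qaut \<Lambda>1) (game_alg \<Lambda>1 \<Lambda>2)\<^esub>d1\<in>edges \<Lambda>1.
            tens (qaut \<Lambda>1) (game_alg \<Lambda>1 \<Lambda>2) (gen_edg \<Lambda>1 \<Lambda>1 e1 d1) (gen_edg \<Lambda>1 \<Lambda>2 d1 e2))) \<and>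
    (\<forall>v1\<in>verts \<Lambda>1. \<forall>v2\<in>verts \<Lambda>2.
       \<gamma> (gen_vtx \<Lambda>1 \<Lambda>2 v1 v2) =
         (\<Oplus>\<^bsub>tensor_alg (game_alg \<Lambda>1 \<Lambda>2) (qaut \<Lambda>2)\<^esub>w2\<in>verts \<Lambda>2.
            tens (game_alg \<Lambda>1 \<Lambda>2) (qaut \<Lambda>2) (gen_vtx \<Lambda>1 \<Lambda>2 v1 w2) (gen_vtx \<Lambda>2 \<Lambda>2 w2 v2))) \<and>
    (\<forall>e1\<in>edges \<Lambda>1. \<forall>e2\<in>edges \<Lambda>2.
       \<gamma> (gen_edg \<Lambda>1 \<Lambda>2 e1 e2) =
         (\<Oplus>\<^bsub>tensor_alg (game_alg \<Lambda>1 \<Lambda>2) (qaut \<Lambda>2)\<^esub>f2\<in>edges \<Lambda>2.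
            tens (game_alg \<Lambda>1 \<Lambda>2) (qaut \<Lambda>2) (gen_edg \<Lambda>1 \<Lambda>2 e1 f2) (gen_edg \<Lambda>2 \<Lambda>2 f2 e2)))"
proof (intro exI conjI ballI)
  note full = assms(1,2)
  let ?Z = "game_alg \<Lambda>1 \<Lambda>2"
  let ?\<delta> = "game_comult \<Lambda>1 \<Lambda>1 \<Lambda>2" and ?\<gamma> = "game_comult \<Lambda>1 \<Lambda>2 \<Lambda>2"
  note A = star_algebra_game[OF full(1,1)] and Z = star_algebra_game[OF full] and B = star_algebra_game[OF full(2,2)]
  have left: "left_comodule_algebra (qaut \<Lambda>1) ?Z ?\<delta>"
    unfolding left_comodule_algebra_def
    by (simp add: qaut_tensor qaut_carrier_ops qaut_ops qaut_hopf[OF full(1)] Z comult_hom[OF full(1,1,2)]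
      comult_coassoc[OF full(1,1,1,2)] comult_counit_left[OF full])
  have right: "right_comodule_algebra (qaut \<Lambda>2) ?Z ?\<gamma>"
    unfolding right_comodule_algebra_def
    by (simp add: qaut_tensor qaut_carrier_ops qaut_ops qaut_hopf[OF full(2)] Z comult_hom[OF full(1,2,2)]
      comult_coassoc[OF full(1,2,2,2)] comult_counit_right[OF full])
  show "bi_galois (qaut \<Lambda>1) (qaut \<Lambda>2) ?Z ?\<delta> ?\<gamma>"
    using left right galois_map_left_bij[OF full] galois_map_right_bij[OF full]
    unfolding bi_galois_def galois_map_left_def galois_map_right_def
    by (simp add: qaut_tensor qaut_carrier_ops comult_coassoc[OF full(1,1,2,2)])
qed (simp_all only: qaut_tensor comult_gen[OF assms(1,1,2)] comult_gen[OF assms(1,2,2)] tens_prod_def)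

end
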